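(* Let $T$ be a complete first-order theory with monster model $\bar M$. (1) If $\mathfrak p$ and $\mathfrak q$ are regular global types, $\mathfrak p$ and $\mathfrak q$ are non-orthogonal, and $\mathfrak p$ is generically stable, then $\mathfrak q$ is generically stable. (2) Non-orthogonality is an equivalence relation on the set of all global types that are both regular and generically stable.
   Context: $T$ is a complete first-order theory with monster model $\bar M$; "small" means of cardinality less than the saturation of $\bar M$. A global type is a complete type over $\bar M$; $\mathfrak p\upharpoonright A$ is the restriction of $\mathfrak p$ to parameters from $A$. For small $A$, $\mathfrak p(x)$ is $A$-invariant if for all $\bar b_1\equiv\bar b_2\,(A)$ and all formulas $\phi(x;\bar y)$ over $A$: $\phi(x,\bar b_1)\in\mathfrak p$ iff $\phi(x,\bar b_2)\in\mathfrak p$. Morley sequence: $(a_i\mid i<\alpha)$ is a Morley sequence in $\mathfrak p$ over $A$ if $a_i\models\mathfrak p\upharpoonright Aa_{<i}$ for all $i<\alpha$. Generic stability: a non-algebraic global type $\mathfrak p$ is generically stable if for some small $A$ it is $A$-invariant and, for every infinite $\alpha$ and every Morley sequence $(a_i\mid i<\alpha)$ in $\mathfrak p$ over $A$, for every formula $\phi(x)$ with parameters from $\bar M$ the set $\{i\mid\ \models\phi(a_i)\}$ is finite or co-finite. Regularity: a non-algebraic global type $\mathfrak p(x)$ in a single variable (possibly of a sort of $\bar M^{eq}$) is regular over a small set $A$ if it is $A$-invariant and for every small $B\supseteq A$ and every $a\models\mathfrak p\upharpoonright A$: either $a\models\mathfrak p\upharpoonright B$ or $\mathfrak p\upharpoonright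 B\vdash\mathfrak p\upharpoonright Ba$. $\mathfrak p$ is regular if it is regular over some small set. Orthogonality: complete types $p,q$ over the same domain are weakly orthogonal if $p(x)\cup q(y)$ (disjoint variables) determines a complete type over that domain. Global types are orthogonal if they are weakly orthogonal as types over $\bar M$; otherwise they are non-orthogonal. *)

theory Defs
  imports Main
begin

unbundle cardinal_syntax

section \<open>Many-sorted first-order logic with parameters\<close>

text \<open>A variable is a pair of a sort and an index. Formulas are over a language expanded by a
  constant \<open>Par a\<close> for every element \<open>a\<close>; \<open>formulas M A X\<close> below are those with parameters
  from \<open>A\<close> and free variables from \<open>X\<close>.\<close>

datatype ('v, 'f, 'a) tm = Var 'v | Par 'a | App 'f "('v, 'f, 'a) tm list"

datatype ('v, 'f, 'r, 'a) fm =
    Eq "('v, 'f, 'a) tm" "('v, 'f, 'a) tm"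
  | Rel 'r "('v, 'f, 'a) tm list"
  | Neg "('v, 'f, 'r, 'a) fm"
  | Conj "('v, 'f, 'r, 'a) fm" "('v, 'f, 'r, 'a) fm"
  | Exists 'v "('v, 'f, 'r, 'a) fm"

type_synonym ('s, 'f, 'r, 'a) formula = "('s \<times> nat, 'f, 'r, 'a) fm"

record ('s, 'f, 'r) signature =
  sorts :: "'s set"
  fsyms :: "'f set"
  farg :: "'f \<Rightarrow> 's list"
  fres :: "'f \<Rightarrow> 's"
  rsyms :: "'r set"
  rarg :: "'r \<Rightarrow> 's list"

record ('s, 'f, 'r, 'a) struct = "('s, 'f, 'r) signature" +
  univ :: "'a set"
  sort_of :: "'a \<Rightarrow> 's"
  fint :: "'f \<Rightarrow> 'a list \<Rightarrow> 'a"
  rint :: "'r \<Rightarrow> 'a list \<Rightarrow> bool"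

definition tuples :: "('s, 'f, 'r, 'a) struct \<Rightarrow> 's list \<Rightarrow> 'a list set" where
  "tuples M ss = {as. set as \<subseteq> univ M \<and> map (sort_of M) as = ss}"

definition is_structure :: "('s, 'f, 'r, 'a) struct \<Rightarrow> bool" where
  "is_structure M \<longleftrightarrow>
     sorts M \<noteq> {} \<and> sort_of M ` univ M = sorts M \<and>
     (\<forall>f\<in>fsyms M. set (farg M f) \<subseteq> sorts M \<and> fres M f \<in> sorts M \<and>
        (\<forall>as\<in>tuples M (farg M f). fint M f as \<in> univ M \<and> sort_of M (fint M f as) = fres M f)) \<and>
     (\<forall>r\<in>rsyms M. set (rarg M r) \<subseteq> sorts M)"

fun tm_sort :: "('s, 'f, 'r, 'a) struct \<Rightarrow> ('s \<times> nat, 'f, 'a) tm \<Rightarrow> 's" where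
  "tm_sort M (Var v) = fst v"
| "tm_sort M (Par a) = sort_of M a"
| "tm_sort M (App f ts) = fres M f"

fun wf_tm :: "('s, 'f, 'r, 'a) struct \<Rightarrow> 'a set \<Rightarrow> ('s \<times> nat, 'f, 'a) tm \<Rightarrow> bool" where
  "wf_tm M A (Var v) \<longleftrightarrow> fst v \<in> sorts M"
| "wf_tm M A (Par a) \<longleftrightarrow> a \<in> A"
| "wf_tm M A (App f ts) \<longleftrightarrow>
     f \<in> fsyms M \<and> (\<forall>t\<in>set ts. wf_tm M A t) \<and> map (tm_sort M) ts = farg M f"

fun wf_fm :: "('s, 'f, 'r, 'a) struct \<Rightarrow> 'a set \<Rightarrow> ('s, 'f, 'r, 'a) formula \<Rightarrow> bool" where
  "wf_fm M A (Eq t u) \<longleftrightarrow> wf_tm M A t \<and> wf_tm M A u \<and> tm_sort M t = tm_sort M u"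
| "wf_fm M A (Rel r ts) \<longleftrightarrow>
     r \<in> rsyms M \<and> (\<forall>t\<in>set ts. wf_tm M A t) \<and> map (tm_sort M) ts = rarg M r"
| "wf_fm M A (Neg \<phi>) \<longleftrightarrow> wf_fm M A \<phi>"
| "wf_fm M A (Conj \<phi> \<psi>) \<longleftrightarrow> wf_fm M A \<phi> \<and> wf_fm M A \<psi>"
| "wf_fm M A (Exists v \<phi>) \<longleftrightarrow> fst v \<in> sorts M \<and> wf_fm M A \<phi>"

fun fv_tm :: "('v, 'f, 'a) tm \<Rightarrow> 'v set" where
  "fv_tm (Var v) = {v}"
| "fv_tm (Par a) = {}"
| "fv_tm (App f ts) = (\<Union>t\<in>set ts. fv_tm t)"

fun fv :: "('v, 'f, 'r, 'a) fm \<Rightarrow> 'v set" where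
  "fv (Eq t u) = fv_tm t \<union> fv_tm u"
| "fv (Rel r ts) = (\<Union>t\<in>set ts. fv_tm t)"
| "fv (Neg \<phi>) = fv \<phi>"
| "fv (Conj \<phi> \<psi>) = fv \<phi> \<union> fv \<psi>"
| "fv (Exists v \<phi>) = fv \<phi> - {v}"

definition formulas ::
  "('s, 'f, 'r, 'a) struct \<Rightarrow> 'a set \<Rightarrow> ('s \<times> nat) set \<Rightarrow> ('s, 'f, 'r, 'a) formula set" where
  "formulas M A X = {\<phi>. wf_fm M A \<phi> \<and> fv \<phi> \<subseteq> X}"

fun tm_val :: "('s, 'f, 'r, 'a) struct \<Rightarrow> ('s \<times> nat \<Rightarrow> 'a) \<Rightarrow> ('s \<times> nat, 'f, 'a) tm \<Rightarrow> 'a" where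
  "tm_val M e (Var v) = e v"
| "tm_val M e (Par a) = a"
| "tm_val M e (App f ts) = fint M f (map (tm_val M e) ts)"

fun sat :: "('s, 'f, 'r, 'a) struct \<Rightarrow> ('s \<times> nat \<Rightarrow> 'a) \<Rightarrow> ('s, 'f, 'r, 'a) formula \<Rightarrow> bool" where
  "sat M e (Eq t u) \<longleftrightarrow> tm_val M e t = tm_val M e u"
| "sat M e (Rel r ts) \<longleftrightarrow> rint M r (map (tm_val M e) ts)"
| "sat M e (Neg \<phi>) \<longleftrightarrow> \<not> sat M e \<phi>"
| "sat M e (Conj \<phi> \<psi>) \<longleftrightarrow> sat M e \<phi> \<and> sat M e \<psi>"
| "sat M e (Exists v \<phi>) \<longleftrightarrow> (\<exists>a\<in>univ M. sort_of M a = fst v \<and> sat M (e(v := a)) \<phi>)"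

definition assignment ::
  "('s, 'f, 'r, 'a) struct \<Rightarrow> ('s \<times> nat) set \<Rightarrow> ('s \<times> nat \<Rightarrow> 'a) \<Rightarrow> bool" where
  "assignment M X e \<longleftrightarrow> (\<forall>v\<in>X. e v \<in> univ M \<and> sort_of M (e v) = fst v)"

text \<open>\<open>inst Y e \<phi>\<close> replaces every free occurrence of a variable \<open>y \<in> Y\<close> by the parameter
  \<open>e y\<close>: if \<open>Y\<close> enumerates the tuple of variables \<open>y\<close> and \<open>e\<close> the tuple \<open>b\<close>, then it turns
  \<open>\<phi>(x, y)\<close> into \<open>\<phi>(x, b)\<close>.\<close>

fun inst_tm :: "'v set \<Rightarrow> ('v \<Rightarrow> 'a) \<Rightarrow> ('v, 'f, 'a) tm \<Rightarrow> ('v, 'f, 'a) tm" where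
  "inst_tm Y e (Var v) = (if v \<in> Y then Par (e v) else Var v)"
| "inst_tm Y e (Par a) = Par a"
| "inst_tm Y e (App f ts) = App f (map (inst_tm Y e) ts)"

fun inst :: "'v set \<Rightarrow> ('v \<Rightarrow> 'a) \<Rightarrow> ('v, 'f, 'r, 'a) fm \<Rightarrow> ('v, 'f, 'r, 'a) fm" where
  "inst Y e (Eq t u) = Eq (inst_tm Y e t) (inst_tm Y e u)"
| "inst Y e (Rel r ts) = Rel r (map (inst_tm Y e) ts)"
| "inst Y e (Neg \<phi>) = Neg (inst Y e \<phi>)"
| "inst Y e (Conj \<phi> \<psi>) = Conj (inst Y e \<phi>) (inst Y e \<psi>)"
| "inst Y e (Exists v \<phi>) = Exists v (inst (Y - {v}) e \<phi>)"

text \<open>Complete types over \<open>A\<close> in the variables \<open>X\<close>. For \<open>A \<subseteq> univ M\<close>, finite satisfiability in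
  \<open>M\<close> is consistency with the theory of \<open>M\<close> with names for the elements of \<open>A\<close>.\<close>

definition complete_type ::
  "('s, 'f, 'r, 'a) struct \<Rightarrow> 'a set \<Rightarrow> ('s \<times> nat) set \<Rightarrow> ('s, 'f, 'r, 'a) formula set \<Rightarrow> bool" where
  "complete_type M A X p \<longleftrightarrow>
     p \<subseteq> formulas M A X \<and>
     (\<forall>\<Gamma>. finite \<Gamma> \<and> \<Gamma> \<subseteq> p \<longrightarrow> (\<exists>e. assignment M X e \<and> (\<forall>\<phi>\<in>\<Gamma>. sat M e \<phi>))) \<and>
     (\<forall>\<phi>\<in>formulas M A X. \<phi> \<in> p \<or> Neg \<phi> \<in> p)"

text \<open>From here on a one-variable type of sort \<open>s\<close> uses the fixed variable \<open>(s, 0)\<close>. Formulas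
  evaluated at \<open>\<lambda>_. a\<close> have no other free variable.\<close>

definition realizes ::
  "('s, 'f, 'r, 'a) struct \<Rightarrow> 's \<Rightarrow> ('s, 'f, 'r, 'a) formula set \<Rightarrow> 'a \<Rightarrow> bool" where
  "realizes M s \<Gamma> a \<longleftrightarrow> a \<in> univ M \<and> sort_of M a = s \<and> (\<forall>\<phi>\<in>\<Gamma>. sat M (\<lambda>_. a) \<phi>)"

text \<open>Provability of \<open>\<phi>(x)\<close> from \<open>\<Gamma>(x)\<close> modulo the elementary diagram of \<open>M\<close>.\<close>

definition entails ::
  "('s, 'f, 'r, 'a) struct \<Rightarrow> 's \<Rightarrow> ('s, 'f, 'r, 'a) formula set \<Rightarrow> ('s, 'f, 'r, 'a) formula \<Rightarrow> bool" where
  "entails M s \<Gamma> \<phi> \<longleftrightarrow>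
     (\<exists>\<Gamma>0\<subseteq>\<Gamma>. finite \<Gamma>0 \<and> (\<forall>a. realizes M s \<Gamma>0 a \<longrightarrow> sat M (\<lambda>_. a) \<phi>))"


section \<open>Monster models\<close>

text \<open>Theories are taken to be deductively closed, so a complete theory decides each sentence by
  membership. Its consistency is part of having a model.\<close>

definition complete_theory ::
  "('s, 'f, 'r, 'a) struct \<Rightarrow> ('s, 'f, 'r, 'a) formula set \<Rightarrow> bool" where
  "complete_theory M T \<longleftrightarrow>
     T \<subseteq> formulas M {} {} \<and> (\<forall>\<phi>\<in>formulas M {} {}. \<phi> \<in> T \<or> Neg \<phi> \<in> T)"

definition models :: "('s, 'f, 'r, 'a) struct \<Rightarrow> ('s, 'f, 'r, 'a) formula set \<Rightarrow> bool" where
  "models M T \<longleftrightarrow> (\<forall>\<phi>\<in>T. \<forall>e. sat M e \<phi>)"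

definition saturated :: "'k rel \<Rightarrow> ('s, 'f, 'r, 'a) struct \<Rightarrow> bool" where
  "saturated \<kappa> M \<longleftrightarrow>
     (\<forall>A s p. A \<subseteq> univ M \<and> |A| <o \<kappa> \<and> s \<in> sorts M \<and> complete_type M A {(s, 0)} p \<longrightarrow>
        (\<exists>a. realizes M s p a))"

text \<open>\<open>map_fm id id id g \<phi>\<close> replaces each parameter \<open>a\<close> in \<open>\<phi>\<close> by \<open>g a\<close>.\<close>

definition elementary_map :: "('s, 'f, 'r, 'a) struct \<Rightarrow> 'a set \<Rightarrow> ('a \<Rightarrow> 'a) \<Rightarrow> bool" where
  "elementary_map M A g \<longleftrightarrow>
     (\<forall>a\<in>A. g a \<in> univ M \<and> sort_of M (g a) = sort_of M a) \<and>
     (\<forall>\<phi>\<in>formulas M A {}. \<forall>e. sat M e \<phi> \<longleftrightarrow> sat M e (map_fm id id id g \<phi>))"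

definition automorphism :: "('s, 'f, 'r, 'a) struct \<Rightarrow> ('a \<Rightarrow> 'a) \<Rightarrow> bool" where
  "automorphism M g \<longleftrightarrow>
     bij_betw g (univ M) (univ M) \<and> (\<forall>a\<in>univ M. sort_of M (g a) = sort_of M a) \<and>
     (\<forall>f\<in>fsyms M. \<forall>as\<in>tuples M (farg M f). g (fint M f as) = fint M f (map g as)) \<and>
     (\<forall>r\<in>rsyms M. \<forall>as\<in>tuples M (rarg M r). rint M r as \<longleftrightarrow> rint M r (map g as))"

definition strongly_homogeneous :: "'k rel \<Rightarrow> ('s, 'f, 'r, 'a) struct \<Rightarrow> bool" where
  "strongly_homogeneous \<kappa> M \<longleftrightarrow>
     (\<forall>A g. A \<subseteq> univ M \<and> |A| <o \<kappa> \<and> elementary_map M A g \<longrightarrow>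
        (\<exists>h. automorphism M h \<and> (\<forall>a\<in>A. h a = g a)))"

text \<open>The set of formulas is infinite, so \<open>\<kappa>\<close> is in particular uncountable.\<close>

definition monster_model ::
  "('s, 'f, 'r, 'a) formula set \<Rightarrow> 'k rel \<Rightarrow> ('s, 'f, 'r, 'a) struct \<Rightarrow> bool" where
  "monster_model T \<kappa> M \<longleftrightarrow>
     is_structure M \<and> models M T \<and> Card_order \<kappa> \<and> |formulas M {} UNIV| <o \<kappa> \<and>
     saturated \<kappa> M \<and> strongly_homogeneous \<kappa> M"


section \<open>Imaginaries\<close>

definition zero_definable_equiv ::
  "('s, 'f, 'r, 'a) struct \<Rightarrow> 's list \<Rightarrow> ('a list \<times> 'a list) set \<Rightarrow> bool" where
  "zero_definable_equiv M ss E \<longleftrightarrow>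
     set ss \<subseteq> sorts M \<and> equiv (tuples M ss) E \<and>
     (\<exists>xs ys \<phi>. distinct (xs @ ys) \<and> map fst xs = ss \<and> map fst ys = ss \<and>
        \<phi> \<in> formulas M {} (set (xs @ ys)) \<and>
        E = {(map e xs, map e ys) | e. assignment M (set (xs @ ys)) e \<and> sat M e \<phi>})"

datatype ('s, 'a) eq_sort = Home 's | Quot "'s list" "('a list \<times> 'a list) set"

datatype ('s, 'f, 'a) eq_fun = Base 'f | Proj "'s list" "('a list \<times> 'a list) set"

datatype ('s, 'a) eq_elem =
    Real (the_Real: 'a)
  | Class "'s list" "('a list \<times> 'a list) set" "'a list set"

text \<open>The structure \<open>M\<^sup>e\<^sup>q\<close>: the home sorts with the structure of \<open>M\<close> and, for every
  \<open>\<emptyset>\<close>-definable equivalence relation \<open>E\<close> on tuples of sorts \<open>ss\<close>, a sort for the quotient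
  and a function symbol for the projection onto it.\<close>

definition Meq ::
  "('s, 'f, 'r, 'a) struct \<Rightarrow> (('s, 'a) eq_sort, ('s, 'f, 'a) eq_fun, 'r, ('s, 'a) eq_elem) struct" where
  "Meq M =
     \<lparr> sorts = Home ` sorts M \<union> {Quot ss E | ss E. zero_definable_equiv M ss E},
       fsyms = Base ` fsyms M \<union> {Proj ss E | ss E. zero_definable_equiv M ss E},
       farg = (\<lambda>g. case g of Base f \<Rightarrow> map Home (farg M f) | Proj ss E \<Rightarrow> map Home ss),
       fres = (\<lambda>g. case g of Base f \<Rightarrow> Home (fres M f) | Proj ss E \<Rightarrow> Quot ss E),
       rsyms = rsyms M,
       rarg = (\<lambda>r. map Home (rarg M r)),
       univ = Real ` univ M \<union>
         {Class ss E X | ss E X. zero_definable_equiv M ss E \<and> X \<in> tuples M ss // E},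
       sort_of = (\<lambda>c. case c of Real a \<Rightarrow> Home (sort_of M a) | Class ss E X \<Rightarrow> Quot ss E),
       fint = (\<lambda>g cs. case g of
           Base f \<Rightarrow> Real (fint M f (map the_Real cs))
         | Proj ss E \<Rightarrow> Class ss E (E `` {map the_Real cs})),
       rint = (\<lambda>r cs. rint M r (map the_Real cs)) \<rparr>"


section \<open>Global types\<close>

definition global_type ::
  "('s, 'f, 'r, 'a) struct \<Rightarrow> 's \<Rightarrow> ('s, 'f, 'r, 'a) formula set \<Rightarrow> bool" where
  "global_type N s p \<longleftrightarrow> s \<in> sorts N \<and> complete_type N (univ N) {(s, 0)} p"

definition restrict_type ::
  "('s, 'f, 'r, 'a) struct \<Rightarrow> ('s, 'f, 'r, 'a) formula set \<Rightarrow> 'a set \<Rightarrow> ('s, 'f, 'r, 'a) formula set" where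
  "restrict_type N p A = {\<phi> \<in> p. wf_fm N A \<phi>}"

definition non_algebraic ::
  "('s, 'f, 'r, 'a) struct \<Rightarrow> 's \<Rightarrow> ('s, 'f, 'r, 'a) formula set \<Rightarrow> bool" where
  "non_algebraic N s p \<longleftrightarrow> (\<forall>\<phi>\<in>p. infinite {a. realizes N s {\<phi>} a})"

definition small :: "'k rel \<Rightarrow> ('s, 'f, 'r, 'a) struct \<Rightarrow> 'a set \<Rightarrow> bool" where
  "small \<kappa> N A \<longleftrightarrow> A \<subseteq> univ N \<and> |A| <o \<kappa>"

definition equiv_over ::
  "('s, 'f, 'r, 'a) struct \<Rightarrow> 'a set \<Rightarrow> ('s \<times> nat) set \<Rightarrow> ('s \<times> nat \<Rightarrow> 'a) \<Rightarrow> ('s \<times> nat \<Rightarrow> 'a) \<Rightarrow> bool" where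
  "equiv_over N A Y b1 b2 \<longleftrightarrow> (\<forall>\<psi>\<in>formulas N A Y. sat N b1 \<psi> \<longleftrightarrow> sat N b2 \<psi>)"

definition invariant ::
  "('s, 'f, 'r, 'a) struct \<Rightarrow> 's \<Rightarrow> ('s, 'f, 'r, 'a) formula set \<Rightarrow> 'a set \<Rightarrow> bool" where
  "invariant N s p A \<longleftrightarrow>
     (\<forall>Y b1 b2. finite Y \<and> (s, 0) \<notin> Y \<and> assignment N Y b1 \<and> assignment N Y b2 \<and>
        equiv_over N A Y b1 b2 \<longrightarrow>
        (\<forall>\<phi>\<in>formulas N A (insert (s, 0) Y). inst Y b1 \<phi> \<in> p \<longleftrightarrow> inst Y b2 \<phi> \<in> p))"

text \<open>An ordinal \<open>\<alpha>\<close> is represented by a well-order \<open>r\<close> of that order type; \<open>underS r i\<close> is the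
  set of strict predecessors of \<open>i\<close>.\<close>

definition morley_sequence ::
  "('s, 'f, 'r, 'a) struct \<Rightarrow> 's \<Rightarrow> ('s, 'f, 'r, 'a) formula set \<Rightarrow> 'a set \<Rightarrow> 'i rel \<Rightarrow> ('i \<Rightarrow> 'a) \<Rightarrow> bool" where
  "morley_sequence N s p A r a \<longleftrightarrow>
     (\<forall>i\<in>Field r. realizes N s (restrict_type N p (A \<union> a ` underS r i)) (a i))"

text \<open>Well-orders on subsets of the element type represent every relevant ordinal: since \<open>p\<close> is
  non-algebraic, a Morley sequence in \<open>p\<close> has no repetitions, so its index set embeds into
  \<open>univ N\<close>.\<close>

definition generically_stable ::
  "'k rel \<Rightarrow> ('s, 'f, 'r, 'a) struct \<Rightarrow> 's \<Rightarrow> ('s, 'f, 'r, 'a) formula set \<Rightarrow> bool" where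
  "generically_stable \<kappa> N s p \<longleftrightarrow>
     global_type N s p \<and> non_algebraic N s p \<and>
     (\<exists>A. small \<kappa> N A \<and> invariant N s p A \<and>
        (\<forall>(r :: 'a rel) a. Well_order r \<and> infinite (Field r) \<and> morley_sequence N s p A r a \<longrightarrow>
           (\<forall>\<phi>\<in>formulas N (univ N) {(s, 0)}.
              finite {i \<in> Field r. sat N (\<lambda>_. a i) \<phi>} \<or>
              finite {i \<in> Field r. \<not> sat N (\<lambda>_. a i) \<phi>})))"

definition regular_over ::
  "'k rel \<Rightarrow> ('s, 'f, 'r, 'a) struct \<Rightarrow> 's \<Rightarrow> ('s, 'f, 'r, 'a) formula set \<Rightarrow> 'a set \<Rightarrow> bool" where
  "regular_over \<kappa> N s p A \<longleftrightarrow>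
     global_type N s p \<and> non_algebraic N s p \<and> small \<kappa> N A \<and> invariant N s p A \<and>
     (\<forall>B a. small \<kappa> N B \<and> A \<subseteq> B \<and> realizes N s (restrict_type N p A) a \<longrightarrow>
        realizes N s (restrict_type N p B) a \<or>
        (\<forall>\<phi>\<in>restrict_type N p (insert a B). entails N s (restrict_type N p B) \<phi>))"

definition regular ::
  "'k rel \<Rightarrow> ('s, 'f, 'r, 'a) struct \<Rightarrow> 's \<Rightarrow> ('s, 'f, 'r, 'a) formula set \<Rightarrow> bool" where
  "regular \<kappa> N s p \<longleftrightarrow> (\<exists>A. regular_over \<kappa> N s p A)"

text \<open>Shifting the indices of all variables, bound ones included, is capture-free and moves the
  free variable \<open>(s, 0)\<close> to \<open>(s, 1)\<close>.\<close>

definition shift :: "('s, 'f, 'r, 'a) formula \<Rightarrow> ('s, 'f, 'r, 'a) formula" where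
  "shift = map_fm (map_prod id Suc) id id id"

definition weakly_orthogonal ::
  "('s, 'f, 'r, 'a) struct \<Rightarrow> 'a set \<Rightarrow> 's \<Rightarrow> ('s, 'f, 'r, 'a) formula set \<Rightarrow>
     's \<Rightarrow> ('s, 'f, 'r, 'a) formula set \<Rightarrow> bool" where
  "weakly_orthogonal N A s p s' q \<longleftrightarrow>
     (\<exists>!u. complete_type N A {(s, 0), (s', 1)} u \<and> p \<union> shift ` q \<subseteq> u)"

definition orthogonal ::
  "('s, 'f, 'r, 'a) struct \<Rightarrow> 's \<Rightarrow> ('s, 'f, 'r, 'a) formula set \<Rightarrow>
     's \<Rightarrow> ('s, 'f, 'r, 'a) formula set \<Rightarrow> bool" where
  "orthogonal N s p s' q \<longleftrightarrow> weakly_orthogonal N (univ N) s p s' q"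

end

theory Submission
  imports Defs
begin

text \<open>Saturation for one-variable types passes from \<open>M\<close> to \<open>Meq M\<close>, by a translation of formulas that
  replaces a variable for an imaginary by a tuple of variables for a representative. The rest of
  the argument uses nothing else about \<open>Meq M\<close>.

  Let \<open>p\<close>, \<open>q\<close> be regular and non-orthogonal, witnessed by a formula \<open>\<Phi>(x, y)\<close>, and let \<open>p\<close> be generically
  stable. A realization \<open>b\<close> of \<open>q\<close> satisfies \<open>\<Phi>(a\<^sub>i, b)\<close> for at most \<open>k\<close> members of a Morley sequence
  \<open>(a\<^sub>i)\<close> in \<open>p\<close>. Maximality of \<open>k\<close> and regularity of both types imply that, over every base \<open>D\<close>, an
  element \<open>b\<close> that satisfies \<open>q\<close> over \<open>A\<close> but not over \<open>D\<close> does not affect independence of realizations of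
  \<open>p\<close> from \<open>D\<close>, and the same with \<open>p\<close> and \<open>q\<close> exchanged. Hence a Morley sequence in \<open>q\<close> can be accompanied by
  a Morley sequence in \<open>p\<close> that depends on it term by term, and convergence of the latter forces
  convergence of the former. Transitivity of non-orthogonality follows from the same fact.\<close>

section \<open>Formulas, substitution and renaming\<close>

text \<open>In an arbitrary theory invariant types come with no symmetric notion of independence: if
  \<open>b\<close> fails to realize \<open>q\<close> over \<open>a\<close>, nothing general says
  that \<open>a\<close> fails to realize \<open>p\<close> over \<open>b\<close>. The maximal
  \<open>k\<close> takes the place of symmetry, because a failure of what symmetry would give
  produces a family of \<open>k + 1\<close> independent realizations of \<open>p\<close> that depend
  on one realization of \<open>q\<close>. Generic stability of \<open>p\<close> enters at two
  points. It bounds \<open>k\<close>, and it makes the companion sequence in \<open>p\<close>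
  eventually satisfy every single formula of \<open>p\<close>, so that compactness yields a limit
  pair; dependence then carries independence of its first coordinate over to the second. Formulas
  are mostly handled through the relations that they define on tuples (\<open>dfn\<close>). Where
  one would usually move elements by an automorphism, a finite tuple is extended by saturation
  (\<open>EQ_extend\<close>). This is why one-variable saturation of \<open>Meq M\<close> is the
  form in which the monster model is used.\<close>

lemma tm_val_cong:
  "(\<And>v. v \<in> fv_tm t \<Longrightarrow> e v = e' v) \<Longrightarrow> tm_val M e t = tm_val M e' t"
proof (induction t)
  case (App f ts)
  then have "map (tm_val M e) ts = map (tm_val M e') ts" by fastforce
  then show ?case by (simp del: map_eq_conv)
qed auto

lemma sat_cong:
  "(\<And>v. v \<in> fv \<phi> \<Longrightarrow> e v = e' v) \<Longrightarrow> sat M e \<phi> \<longleftrightarrow> sat M e' \<phi>"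
proof (induction \<phi> arbitrary: e e')
  case (Eq t u)
  then show ?case using tm_val_cong[of t e e' M] tm_val_cong[of u e e' M] by auto
next
  case (Rel r ts)
  then have "map (tm_val M e) ts = map (tm_val M e') ts" 
    by (auto intro!: tm_val_cong)
  then show ?case by (simp del: map_eq_conv)
next
  case (Neg \<phi>)
  then show ?case by (metis fv.simps(3) sat.simps(3))
next
  case (Conj \<phi> \<psi>)
  have "sat M e \<phi> \<longleftrightarrow> sat M e' \<phi>" by (rule Conj.IH) (simp add: Conj.prems)
  moreover have "sat M e \<psi> \<longleftrightarrow> sat M e' \<psi>" by (rule Conj.IH) (simp add: Conj.prems)
  ultimately show ?case by simp
next
  case (Exists v \<phi>)
  have "sat M (e(v := a)) \<phi> \<longleftrightarrow> sat M (e'(v := a)) \<phi>" for a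
    by (rule Exists.IH) (use Exists.prems in auto)
  then show ?case by simp
qed

lemma finite_fv_tm: "finite (fv_tm t)"
  by (induction t) auto

lemma finite_fv: "finite (fv \<phi>)"
  by (induction \<phi>) (auto simp: finite_fv_tm)

lemma wf_tm_mono: "wf_tm M A t \<Longrightarrow> A \<subseteq> B \<Longrightarrow> wf_tm M B t"
  by (induction t) auto

lemma wf_fm_mono: "wf_fm M A \<phi> \<Longrightarrow> A \<subseteq> B \<Longrightarrow> wf_fm M B \<phi>"
  by (induction \<phi>) (auto intro: wf_tm_mono)

lemma formulas_mono: "A \<subseteq> B \<Longrightarrow> X \<subseteq> Y \<Longrightarrow> formulas M A X \<subseteq> formulas M B Y"
  by (auto simp: formulas_def intro: wf_fm_mono)


lemma wf_tm_finite_params: "wf_tm M A t \<Longrightarrow> \<exists>F\<subseteq>A. finite F \<and> wf_tm M F t"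
proof (induction t)
  case (Var v)
  then show ?case by (intro exI[of _ "{}"]) auto
next
  case (Par a)
  then show ?case by (intro exI[of _ "{a}"]) auto
next
  case (App f ts)
  then have "\<forall>t\<in>set ts. \<exists>F\<subseteq>A. finite F \<and> wf_tm M F t" by auto
  then obtain F where F: "\<forall>t\<in>set ts. F t \<subseteq> A \<and> finite (F t) \<and> wf_tm M (F t) t"
    by metis
  then show ?case using App.prems
    by (intro exI[of _ "\<Union>t\<in>set ts. F t"]) (auto intro: wf_tm_mono)
qed

lemma wf_fm_finite_params: "wf_fm M A \<phi> \<Longrightarrow> \<exists>F\<subseteq>A. finite F \<and> wf_fm M F \<phi>"
proof (induction \<phi>)
  case (Eq t u)
  then obtain F G where "F \<subseteq> A" "finite F" "wf_tm M F t" "G \<subseteq> A" "finite G" "wf_tm M G u"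
    using wf_tm_finite_params by (metis wf_fm.simps(1))
  then show ?case using Eq by (intro exI[of _ "F \<union> G"]) (auto intro: wf_tm_mono)
next
  case (Rel r ts)
  then have "\<forall>t\<in>set ts. \<exists>F\<subseteq>A. finite F \<and> wf_tm M F t"
    by (auto intro: wf_tm_finite_params)
  then obtain F where F: "\<forall>t\<in>set ts. F t \<subseteq> A \<and> finite (F t) \<and> wf_tm M (F t) t"
    by metis
  then show ?case using Rel.prems
    by (intro exI[of _ "\<Union>t\<in>set ts. F t"]) (auto intro: wf_tm_mono)
next
  case (Conj \<phi> \<psi>)
  then obtain F G where "F \<subseteq> A" "finite F" "wf_fm M F \<phi>" "G \<subseteq> A" "finite G" "wf_fm M G \<psi>"
    by (metis wf_fm.simps(4))
  then show ?case by (intro exI[of _ "F \<union> G"]) (auto intro: wf_fm_mono)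
qed auto

lemma tm_val_inst:
  "tm_val M e (inst_tm Y b t) = tm_val M (\<lambda>v. if v \<in> Y then b v else e v) t"
proof (induction t)
  case (App f ts)
  then have "map (tm_val M e \<circ> inst_tm Y b) ts = map (tm_val M (\<lambda>v. if v \<in> Y then b v else e v)) ts"
    by auto
  then show ?case by (simp del: map_eq_conv)
qed auto

lemma sat_inst: "sat M e (inst Y b \<phi>) \<longleftrightarrow> sat M (\<lambda>v. if v \<in> Y then b v else e v) \<phi>"
proof (induction \<phi> arbitrary: e Y)
  case (Rel r ts)
  have "map (tm_val M e \<circ> inst_tm Y b) ts = map (tm_val M (\<lambda>v. if v \<in> Y then b v else e v)) ts"
    by (auto simp: tm_val_inst)
  then show ?case by (simp del: map_eq_conv)
next
  case (Exists v \<phi>)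
  have "(\<lambda>w. if w \<in> Y - {v} then b w else (e(v := a)) w) =
        (\<lambda>w. if w \<in> Y then b w else e w)(v := a)" for a
    by auto
  then show ?case by (simp add: Exists.IH del: Diff_iff)
qed (auto simp: tm_val_inst)

lemma fv_tm_inst: "fv_tm (inst_tm Y b t) = fv_tm t - Y"
  by (induction t) auto

lemma fv_inst: "fv (inst Y b \<phi>) = fv \<phi> - Y"
  by (induction \<phi> arbitrary: Y) (auto simp: fv_tm_inst)

lemma tm_sort_inst:
  "(\<And>v. v \<in> Y \<Longrightarrow> v \<in> fv_tm t \<Longrightarrow> sort_of M (b v) = fst v) \<Longrightarrow>
     tm_sort M (inst_tm Y b t) = tm_sort M t"
  by (cases t) auto

lemma wf_tm_inst:
  assumes "wf_tm M A t" "A \<subseteq> B"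
    "\<And>v. v \<in> Y \<Longrightarrow> v \<in> fv_tm t \<Longrightarrow> b v \<in> B \<and> sort_of M (b v) = fst v"
  shows "wf_tm M B (inst_tm Y b t)"
  using assms
proof (induction t)
  case (App f ts)
  have "map (tm_sort M \<circ> inst_tm Y b) ts = map (tm_sort M) ts"
    using App.prems(3) by (auto intro!: tm_sort_inst)
  then show ?case using App by (simp del: map_eq_conv) blast
qed auto

lemma wf_fm_inst:
  assumes "wf_fm M A \<phi>" "A \<subseteq> B"
    "\<And>v. v \<in> Y \<Longrightarrow> v \<in> fv \<phi> \<Longrightarrow> b v \<in> B \<and> sort_of M (b v) = fst v"
  shows "wf_fm M B (inst Y b \<phi>)"
  using assms
proof (induction \<phi> arbitrary: Y)
  case (Eq t u)
  then show ?case using tm_sort_inst[of Y t M b] tm_sort_inst[of Y u M b]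
    by (auto intro!: wf_tm_inst)
next
  case (Rel r ts)
  have "map (tm_sort M \<circ> inst_tm Y b) ts = map (tm_sort M) ts"
    using Rel.prems(3) by (auto intro!: tm_sort_inst)
  then show ?case using Rel by (auto simp del: map_eq_conv intro!: wf_tm_inst)
next
  case (Exists v \<phi>)
  have "wf_fm M B (inst (Y - {v}) b \<phi>)"
    by (rule Exists.IH) (use Exists.prems in auto)
  then show ?case using Exists.prems by simp
qed auto

lemma tm_val_rename: "tm_val M e (map_tm h (\<lambda>x. x) (\<lambda>x. x) t) = tm_val M (\<lambda>v. e (h v)) t"
proof (induction t)
  case (App f ts)
  then have "map (tm_val M e \<circ> map_tm h (\<lambda>x. x) (\<lambda>x. x)) ts = map (tm_val M (\<lambda>v. e (h v))) ts"
    by auto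
  then show ?case by (simp del: map_eq_conv)
qed auto

lemma sat_rename:
  "inj h \<Longrightarrow> (\<And>v. fst (h v) = fst v) \<Longrightarrow>
     sat M e (map_fm h (\<lambda>x. x) (\<lambda>x. x) (\<lambda>x. x) \<phi>) \<longleftrightarrow> sat M (\<lambda>v. e (h v)) \<phi>"
proof (induction \<phi> arbitrary: e)
  case (Rel r ts)
  have "map (tm_val M e \<circ> map_tm h (\<lambda>x. x) (\<lambda>x. x)) ts = map (tm_val M (\<lambda>v. e (h v))) ts"
    by (auto simp: tm_val_rename)
  then show ?case by (simp del: map_eq_conv)
next
  case (Exists v \<phi>)
  have "(\<lambda>w. (e(h v := a)) (h w)) = (\<lambda>w. e (h w))(v := a)" for a
    using Exists.prems(1) by (auto simp: fun_eq_iff inj_eq)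
  then show ?case by (simp add: Exists del: fun_upd_apply)
qed (auto simp: tm_val_rename)

lemma fv_tm_rename: "fv_tm (map_tm h (\<lambda>x. x) (\<lambda>x. x) t) = h ` fv_tm t"
  by (induction t) auto

lemma fv_rename: "inj h \<Longrightarrow> fv (map_fm h (\<lambda>x. x) (\<lambda>x. x) (\<lambda>x. x) \<phi>) = h ` fv \<phi>"
  by (induction \<phi>) (auto simp: fv_tm_rename inj_eq)

lemma tm_sort_rename:
  "(\<And>v. fst (h v) = fst v) \<Longrightarrow> tm_sort M (map_tm h (\<lambda>x. x) (\<lambda>x. x) t) = tm_sort M t"
  by (cases t) auto

lemma wf_tm_rename:
  assumes "\<And>v. fst (h v) = fst v"
  shows "wf_tm M A (map_tm h (\<lambda>x. x) (\<lambda>x. x) t) = wf_tm M A t"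
proof (induction t)
  case (App f ts)
  have "map (tm_sort M \<circ> map_tm h (\<lambda>x. x) (\<lambda>x. x)) ts = map (tm_sort M) ts"
    using assms by (auto intro!: tm_sort_rename)
  then show ?case using App by (simp del: map_eq_conv)
qed (use assms in auto)

lemma wf_fm_rename:
  assumes "\<And>v. fst (h v) = fst v"
  shows "wf_fm M A (map_fm h (\<lambda>x. x) (\<lambda>x. x) (\<lambda>x. x) \<phi>) = wf_fm M A \<phi>"
proof (induction \<phi>)
  case (Rel r ts)
  have "map (tm_sort M \<circ> map_tm h (\<lambda>x. x) (\<lambda>x. x)) ts = map (tm_sort M) ts"
    using assms by (auto intro!: tm_sort_rename)
  then show ?case by (simp add: assms wf_tm_rename del: map_eq_conv)
qed (simp_all add: assms wf_tm_rename tm_sort_rename)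

text \<open>\<open>sat_rename\<close> renames bound variables too, so it asks for an injection on
  all variables and not just on the free ones. A finite renaming is extended to such a map one
  variable at a time.\<close>

lemma extend_inj_to_bij:
  fixes f :: "'s \<times> 'i \<Rightarrow> 's \<times> 'i"
  assumes "finite X" "inj_on f X" "\<And>v. v \<in> X \<Longrightarrow> fst (f v) = fst v"
  shows "\<exists>h. bij h \<and> (\<forall>v\<in>X. h v = f v) \<and> (\<forall>v. fst (h v) = fst v)"
  using assms
proof (induction X rule: finite_induct)
  case empty
  show ?case by (intro exI[of _ "\<lambda>x. x"]) (auto simp: bij_def)
next
  case (insert x X)
  then obtain h where h: "bij h" "\<forall>v\<in>X. h v = f v" "\<forall>v. fst (h v) = fst v"
    by (auto simp: inj_on_insert)
  \<comment> \<open>The transposition of \<open>h x\<close> and \<open>f x\<close>. It fixes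
    \<open>f v\<close> for \<open>v\<close> in \<open>X\<close>, so composing with it corrects the
    value at \<open>x\<close> and keeps those on \<open>X\<close>.\<close>
  define t where "t = (\<lambda>w. if w = h x then f x else if w = f x then h x else w)"
  have "t \<circ> t = id" by (auto simp: t_def fun_eq_iff)
  then have "bij t" by (rule o_bij) (rule \<open>t \<circ> t = id\<close>)
  have "f v \<noteq> h x \<and> f v \<noteq> f x" if "v \<in> X" for v
    using that insert h by (metis bij_is_inj inj_eq inj_on_contraD insertCI)
  then have "\<forall>v\<in>insert x X. (t \<circ> h) v = f v"
    using h by (auto simp: t_def)
  moreover have "\<forall>v. fst ((t \<circ> h) v) = fst v"
  proof
    have "fst (t w) = fst w" for w
      using spec[OF h(3), of x] insert.prems(2)[of x] by (simp add: t_def)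
    then show "fst ((t \<circ> h) v) = fst v" for v using h(3)[rule_format, of v] by simp
  qed
  moreover have "bij (t \<circ> h)" using h \<open>bij t\<close> by (metis bij_comp)
  ultimately show ?case by blast
qed

section \<open>Replacing parameters by variables\<close>

primrec params_to_vars_tm :: "('a \<Rightarrow> 'v option) \<Rightarrow> ('v, 'f, 'a) tm \<Rightarrow> ('v, 'f, 'a) tm" where
  "params_to_vars_tm g (Var v) = Var v"
| "params_to_vars_tm g (Par a) = (case g a of Some v \<Rightarrow> Var v | None \<Rightarrow> Par a)"
| "params_to_vars_tm g (App f ts) = App f (map (params_to_vars_tm g) ts)"

text \<open>Inverse to \<open>inst\<close>. Bound variables are left alone, so capture has to be
  excluded by the choice of the new variables, which must avoid \<open>bvars\<close>.\<close>

primrec params_to_vars :: "('a \<Rightarrow> 'v option) \<Rightarrow> ('v, 'f, 'r, 'a) fm \<Rightarrow> ('v, 'f, 'r, 'a) fm" where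
  "params_to_vars g (Eq t u) = Eq (params_to_vars_tm g t) (params_to_vars_tm g u)"
| "params_to_vars g (Rel r ts) = Rel r (map (params_to_vars_tm g) ts)"
| "params_to_vars g (Neg \<phi>) = Neg (params_to_vars g \<phi>)"
| "params_to_vars g (Conj \<phi> \<psi>) = Conj (params_to_vars g \<phi>) (params_to_vars g \<psi>)"
| "params_to_vars g (Exists v \<phi>) = Exists v (params_to_vars g \<phi>)"

fun bvars :: "('v, 'f, 'r, 'a) fm \<Rightarrow> 'v set" where
  "bvars (Neg \<phi>) = bvars \<phi>"
| "bvars (Conj \<phi> \<psi>) = bvars \<phi> \<union> bvars \<psi>"
| "bvars (Exists v \<phi>) = insert v (bvars \<phi>)"
| "bvars _ = {}"

lemma finite_bvars: "finite (bvars \<phi>)"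
  by (induction \<phi>) auto

lemma tm_val_params_to_vars:
  assumes "\<And>a v. g a = Some v \<Longrightarrow> e v = a"
  shows "tm_val M e (params_to_vars_tm g t) = tm_val M e t"
proof (induction t)
  case (App f ts)
  then have "map (tm_val M e \<circ> params_to_vars_tm g) ts = map (tm_val M e) ts"
    by auto
  then show ?case by (simp del: map_eq_conv)
qed (use assms in \<open>auto split: option.split\<close>)

lemma sat_params_to_vars:
  assumes "\<And>a v. g a = Some v \<Longrightarrow> e v = a" "\<And>a v. g a = Some v \<Longrightarrow> v \<notin> bvars \<phi>"
  shows "sat M e (params_to_vars g \<phi>) \<longleftrightarrow> sat M e \<phi>"
  using assms
proof (induction \<phi> arbitrary: e)
  case (Rel r ts)
  then have "map (tm_val M e \<circ> params_to_vars_tm g) ts = map (tm_val M e) ts"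
    by (auto intro!: tm_val_params_to_vars)
  then show ?case by (simp del: map_eq_conv)
next
  case (Exists v \<phi>)
  have "sat M (e(v := a)) (params_to_vars g \<phi>) \<longleftrightarrow> sat M (e(v := a)) \<phi>" for a
    by (rule Exists.IH) (use Exists.prems in auto)
  then show ?case by simp
qed (auto simp: tm_val_params_to_vars)

lemma fv_tm_params_to_vars: "fv_tm (params_to_vars_tm g t) \<subseteq> fv_tm t \<union> {v. \<exists>a. g a = Some v}"
  by (induction t) (auto split: option.splits)

lemma fv_params_to_vars: "fv (params_to_vars g \<phi>) \<subseteq> fv \<phi> \<union> {v. \<exists>a. g a = Some v}"
  using fv_tm_params_to_vars by (induction \<phi>) fastforce+

lemma tm_sort_params_to_vars:
  assumes "\<And>a v. g a = Some v \<Longrightarrow> fst v = sort_of M a"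
  shows "tm_sort M (params_to_vars_tm g t) = tm_sort M t"
  using assms by (cases t) (auto split: option.split)

lemma wf_tm_params_to_vars:
  assumes "\<And>a v. g a = Some v \<Longrightarrow> fst v = sort_of M a \<and> fst v \<in> sorts M"
    and "\<And>a. a \<in> B \<Longrightarrow> g a = None \<Longrightarrow> a \<in> A"
  shows "wf_tm M B t \<Longrightarrow> wf_tm M A (params_to_vars_tm g t)"
proof (induction t)
  case (App f ts)
  have "map (tm_sort M \<circ> params_to_vars_tm g) ts = map (tm_sort M) ts"
    using assms by (auto intro!: tm_sort_params_to_vars)
  then show ?case using App by (simp del: map_eq_conv)
qed (use assms in \<open>auto split: option.splits\<close>)

lemma wf_fm_params_to_vars:
  assumes "\<And>a v. g a = Some v \<Longrightarrow> fst v = sort_of M a \<and> fst v \<in> sorts M"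
    and "\<And>a. a \<in> B \<Longrightarrow> g a = None \<Longrightarrow> a \<in> A"
  shows "wf_fm M B \<phi> \<Longrightarrow> wf_fm M A (params_to_vars g \<phi>)"
proof (induction \<phi>)
  case (Eq t u)
  have "tm_sort M (params_to_vars_tm g t) = tm_sort M t" for t
    using assms by (intro tm_sort_params_to_vars) auto
  then show ?case using Eq wf_tm_params_to_vars[OF assms] by auto
next
  case (Rel r ts)
  have "map (tm_sort M \<circ> params_to_vars_tm g) ts = map (tm_sort M) ts"
    using assms by (auto intro!: tm_sort_params_to_vars)
  then show ?case using Rel wf_tm_params_to_vars[OF assms] by (simp del: map_eq_conv)
qed auto

section \<open>Definable relations on tuples\<close>

text \<open>Outside \<open>vs\<close> the result is the unspecified \<open>the None\<close>, so
  \<open>val\<close> is meant for formulas whose free variables lie in \<open>vs\<close>.\<close>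

definition val :: "'v list \<Rightarrow> 'a list \<Rightarrow> 'v \<Rightarrow> 'a" where
  "val vs as = (\<lambda>v. the (map_of (zip vs as) v))"

lemma val_Cons [simp]: "val (v # vs) (a # as) = (val vs as)(v := a)"
  by (auto simp: val_def)

lemma val_nth: "distinct vs \<Longrightarrow> length vs = length as \<Longrightarrow> i < length vs \<Longrightarrow> val vs as (vs ! i) = as ! i"
  by (simp add: val_def map_of_zip_nth)

lemma map_val: "distinct vs \<Longrightarrow> length vs = length as \<Longrightarrow> map (val vs as) vs = as"
  by (simp add: list_eq_iff_nth_eq val_nth)

lemma val_map: "v \<in> set vs \<Longrightarrow> val vs (map e vs) v = e v"
  by (induction vs) auto

lemma val_append:
  "length vs = length as \<Longrightarrow>
     val (vs @ ws) (as @ bs) v = (if v \<in> set vs then val vs as v else val ws bs v)"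
  by (induction vs as rule: list_induct2) auto

lemma tuples_Nil [simp]: "as \<in> tuples M [] \<longleftrightarrow> as = []"
  by (auto simp: tuples_def)

lemma tuples_Cons:
  "as \<in> tuples M (s # ss) \<longleftrightarrow>
     (\<exists>a bs. as = a # bs \<and> a \<in> univ M \<and> sort_of M a = s \<and> bs \<in> tuples M ss)"
  by (cases as) (auto simp: tuples_def)

lemma Cons_in_tuples [simp]:
  "a # bs \<in> tuples M (s # ss) \<longleftrightarrow> a \<in> univ M \<and> sort_of M a = s \<and> bs \<in> tuples M ss"
  by (auto simp: tuples_Cons)

lemma append_in_tuples [intro]:
  "as \<in> tuples M ss \<Longrightarrow> bs \<in> tuples M ts \<Longrightarrow> as @ bs \<in> tuples M (ss @ ts)"
  by (auto simp: tuples_def)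

lemma tuples_length: "as \<in> tuples M ss \<Longrightarrow> length as = length ss"
  by (auto simp: tuples_def)

lemma tuples_set: "as \<in> tuples M ss \<Longrightarrow> set as \<subseteq> univ M"
  by (auto simp: tuples_def)

lemma tuples_self: "as \<in> tuples M (map (sort_of M) as) \<longleftrightarrow> set as \<subseteq> univ M"
  by (auto simp: tuples_def)

lemma tuples_sorts: "as \<in> tuples M ss \<Longrightarrow> map (sort_of M) as = ss"
  by (auto simp: tuples_def)

lemma val_assignment:
  assumes "distinct vs" "as \<in> tuples M (map fst vs)"
  shows "assignment M (set vs) (val vs as)"
  unfolding assignment_def
proof
  fix v assume "v \<in> set vs"
  then obtain i where i: "i < length vs" "v = vs ! i" by (auto simp: in_set_conv_nth)
  have l: "length vs = length as" using tuples_length[OF assms(2)] by simp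
  then have "val vs as v = as ! i" using i assms(1) by (simp add: val_nth)
  moreover have "sort_of M (as ! i) = fst v"
    using assms(2) i l by (metis nth_map tuples_sorts)
  moreover have "as ! i \<in> univ M" using assms(2) i l tuples_set by fastforce
  ultimately show "val vs as v \<in> univ M \<and> sort_of M (val vs as v) = fst v" by simp
qed

lemma assignment_tuple:
  "assignment M (set vs) e \<Longrightarrow> map e vs \<in> tuples M (map fst vs)"
  by (auto simp: assignment_def tuples_def)

lemma ex_fresh_vars:
  fixes X :: "('s \<times> nat) set"
  assumes "finite X"
  shows "\<exists>vs. distinct vs \<and> map fst vs = ss \<and> set vs \<inter> X = {}"
proof -
  obtain n where n: "\<forall>v\<in>X. snd v < n"
    using assms finite_imageI[of X snd] by (metis finite_nat_set_iff_bounded imageI)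
  show ?thesis
  proof (intro exI conjI)
    show "distinct (zip ss [n..<n + length ss])" by (simp add: distinct_zipI2)
    show "map fst (zip ss [n..<n + length ss]) = ss" by simp
    show "set (zip ss [n..<n + length ss]) \<inter> X = {}"
      using n by (fastforce dest: set_zip_rightD)
  qed
qed

text \<open>The existential quantifier hides the variables, and only the values of \<open>R\<close>
  on \<open>tuples M ss\<close> count. Most later arguments can thus speak of relations without
  choosing variable names.\<close>

definition dfn :: "('s, 'f, 'r, 'a) struct \<Rightarrow> 'a set \<Rightarrow> 's list \<Rightarrow> ('a list \<Rightarrow> bool) \<Rightarrow> bool" where
  "dfn M A ss R \<longleftrightarrow>
     (\<exists>vs \<phi>. distinct vs \<and> map fst vs = ss \<and> \<phi> \<in> formulas M A (set vs) \<and>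
        (\<forall>as\<in>tuples M ss. R as \<longleftrightarrow> sat M (val vs as) \<phi>))"

lemma dfnI:
  assumes "distinct vs" "map fst vs = ss" "\<phi> \<in> formulas M A (set vs)"
    "\<And>as. as \<in> tuples M ss \<Longrightarrow> R as \<longleftrightarrow> sat M (val vs as) \<phi>"
  shows "dfn M A ss R"
  using assms unfolding dfn_def by blast

text \<open>The positionwise map from \<open>vs\<close> to \<open>ws\<close> is injective and keeps
  sorts. Extended to a permutation of all variables it cannot cause capture.\<close>

lemma rename_formula:
  fixes \<phi> :: "('s, 'f, 'r, 'a) formula"
  assumes "distinct vs" "distinct ws" "map fst vs = map fst ws" "\<phi> \<in> formulas M A (set vs)"
  shows "\<exists>\<psi>\<in>formulas M A (set ws). \<forall>as. length as = length vs \<longrightarrow>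
           (sat M (val ws as) \<psi> \<longleftrightarrow> sat M (val vs as) \<phi>)"
proof -
  have l: "length vs = length ws" using assms(3) map_eq_imp_length_eq by blast
  have f: "val vs ws (vs ! i) = ws ! i" if "i < length vs" for i
    using that l assms by (simp add: val_nth)
  have "inj_on (val vs ws) (set vs)"
    by (rule inj_onI) (metis f assms(2) in_set_conv_nth l nth_eq_iff_index_eq)
  moreover have "fst (val vs ws v) = fst v" if "v \<in> set vs" for v
    using that f assms(3) l by (metis in_set_conv_nth nth_map)
  ultimately obtain h where h: "bij h" "\<forall>v\<in>set vs. h v = val vs ws v" "\<forall>v. fst (h v) = fst v"
    using extend_inj_to_bij[of "set vs" "val vs ws"] by auto
  have hi: "inj h" using h(1) by (rule bij_is_inj)
  have hn: "h (vs ! i) = ws ! i" if "i < length vs" for i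
    using that h f by simp
  let ?\<psi> = "map_fm h (\<lambda>x. x) (\<lambda>x. x) (\<lambda>x. x) \<phi>"
  have "map h vs = ws" by (rule nth_equalityI) (simp_all add: hn l)
  then have "h ` set vs = set ws" by (metis list.set_map)
  then have "?\<psi> \<in> formulas M A (set ws)"
    using assms(4) wf_fm_rename[OF spec[OF h(3)], of M A \<phi>] fv_rename[OF hi, of \<phi>]
    by (auto simp: formulas_def)
  moreover have "sat M (val ws as) ?\<psi> \<longleftrightarrow> sat M (val vs as) \<phi>" if "length as = length vs" for as
  proof -
    have "sat M (val ws as) ?\<psi> \<longleftrightarrow> sat M (\<lambda>v. val ws as (h v)) \<phi>"
      using sat_rename[OF hi] h(3) by metis
    also have "\<dots> \<longleftrightarrow> sat M (val vs as) \<phi>"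
    proof (rule sat_cong)
      fix v assume "v \<in> fv \<phi>"
      then have "v \<in> set vs" using assms(4) by (auto simp: formulas_def)
      then obtain i where "i < length vs" "v = vs ! i" by (metis in_set_conv_nth)
      then show "val ws as (h v) = val vs as v"
        using that l assms by (simp add: hn val_nth)
    qed
    finally show ?thesis .
  qed
  ultimately show ?thesis by blast
qed

lemma dfnE:
  assumes "dfn M A ss R" "distinct vs" "map fst vs = ss"
  obtains \<phi> where "\<phi> \<in> formulas M A (set vs)"
    "\<And>as. as \<in> tuples M ss \<Longrightarrow> R as \<longleftrightarrow> sat M (val vs as) \<phi>"
proof -
  obtain ws \<phi> where w: "distinct ws" "map fst ws = ss" "\<phi> \<in> formulas M A (set ws)"
    "\<forall>as\<in>tuples M ss. R as \<longleftrightarrow> sat M (val ws as) \<phi>"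
    using assms(1) unfolding dfn_def by blast
  obtain \<psi> where "\<psi> \<in> formulas M A (set vs)"
    "\<forall>as. length as = length ws \<longrightarrow> (sat M (val vs as) \<psi> \<longleftrightarrow> sat M (val ws as) \<phi>)"
    using rename_formula[OF w(1) assms(2) _ w(3)] assms(3) w(2) by auto
  then show ?thesis using that w by (metis length_map tuples_length)
qed

lemma ex_vars: "\<exists>vs :: ('s \<times> nat) list. distinct vs \<and> map fst vs = ss"
  using ex_fresh_vars[of "{}" ss] by blast

lemma dfn_cong:
  "(\<And>as. as \<in> tuples M ss \<Longrightarrow> R as \<longleftrightarrow> S as) \<Longrightarrow> dfn M A ss R \<longleftrightarrow> dfn M A ss S"
  unfolding dfn_def by (simp cong: ball_cong)

lemma dfn_mono: "dfn M A ss R \<Longrightarrow> A \<subseteq> B \<Longrightarrow> dfn M B ss R"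
  unfolding dfn_def using formulas_mono by blast

lemma dfn_neg: "dfn M A ss R \<Longrightarrow> dfn M A ss (\<lambda>as. \<not> R as)"
proof -
  assume "dfn M A ss R"
  then obtain vs \<phi> where "distinct vs" "map fst vs = ss" "\<phi> \<in> formulas M A (set vs)"
    "\<forall>as\<in>tuples M ss. R as \<longleftrightarrow> sat M (val vs as) \<phi>"
    unfolding dfn_def by blast
  then show ?thesis by (intro dfnI[of vs _ "Neg \<phi>"]) (auto simp: formulas_def)
qed

lemma dfn_conj:
  assumes "dfn M A ss R" "dfn M A ss S"
  shows "dfn M A ss (\<lambda>as. R as \<and> S as)"
proof -
  obtain vs \<phi> where v: "distinct vs" "map fst vs = ss" "\<phi> \<in> formulas M A (set vs)"
    "\<forall>as\<in>tuples M ss. R as \<longleftrightarrow> sat M (val vs as) \<phi>"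
    using assms(1) unfolding dfn_def by blast
  obtain \<psi> where "\<psi> \<in> formulas M A (set vs)"
    "\<And>as. as \<in> tuples M ss \<Longrightarrow> S as \<longleftrightarrow> sat M (val vs as) \<psi>"
    by (rule dfnE[OF assms(2) v(1,2)]) (rule that)
  then show ?thesis using v by (intro dfnI[of vs _ "Conj \<phi> \<psi>"]) (auto simp: formulas_def)
qed

lemma dfn_True:
  assumes "sorts M \<noteq> {}"
  shows "dfn M A ss (\<lambda>_. True)"
proof -
  obtain s where s: "s \<in> sorts M" using assms by blast
  obtain vs :: "('a \<times> nat) list" where "distinct vs" "map fst vs = ss" using ex_vars by blast
  \<comment> \<open>The tautology must have no free variables, since \<open>vs\<close> may be empty.
    Its quantifier is what requires a sort.\<close>
  let ?e = "Exists (s, 0) (Eq (Var (s, 0)) (Var (s, 0)))"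
  show ?thesis
    by (rule dfnI[of vs _ "Neg (Conj ?e (Neg ?e))"]) (use s in \<open>auto simp: formulas_def \<open>distinct vs\<close> \<open>map fst vs = ss\<close>\<close>)
qed

lemma dfn_ball_finite:
  assumes "sorts M \<noteq> {}" "finite F" "\<And>R. R \<in> F \<Longrightarrow> dfn M A ss (f R)"
  shows "dfn M A ss (\<lambda>as. \<forall>R\<in>F. f R as)"
  using assms(2,3)
proof (induction F rule: finite_induct)
  case empty
  then show ?case by (simp add: dfn_True assms(1))
next
  case (insert R F)
  then have "dfn M A ss (\<lambda>as. f R as \<and> (\<forall>R\<in>F. f R as))" by (intro dfn_conj) auto
  then show ?case by simp
qed

lemma dfn_ex:
  assumes "dfn M A (s # ss) R" "s \<in> sorts M"
  shows "dfn M A ss (\<lambda>as. \<exists>a\<in>univ M. sort_of M a = s \<and> R (a # as))"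
proof -
  obtain v vs \<phi> where v: "distinct (v # vs)" "fst v = s" "map fst vs = ss" "\<phi> \<in> formulas M A (set (v # vs))"
    "\<forall>as\<in>tuples M (s # ss). R as \<longleftrightarrow> sat M (val (v # vs) as) \<phi>"
  proof -
    obtain ws \<phi> where w: "distinct ws" "map fst ws = s # ss" "\<phi> \<in> formulas M A (set ws)"
      "\<forall>as\<in>tuples M (s # ss). R as \<longleftrightarrow> sat M (val ws as) \<phi>"
      using assms(1) unfolding dfn_def by metis
    then obtain v vs where "ws = v # vs" "fst v = s" "map fst vs = ss" by (cases ws) auto
    then show ?thesis using that w by blast
  qed
  show ?thesis
  proof (rule dfnI[of vs _ "Exists v \<phi>"])
    show "Exists v \<phi> \<in> formulas M A (set vs)" using v assms(2) by (auto simp: formulas_def)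
    fix as assume "as \<in> tuples M ss"
    then show "(\<exists>a\<in>univ M. sort_of M a = s \<and> R (a # as)) \<longleftrightarrow> sat M (val vs as) (Exists v \<phi>)"
      using v by auto
  qed (use v in auto)
qed

lemma dfn_inst:
  assumes "dfn M A (ss @ ts) R" "bs \<in> tuples M ts"
  shows "dfn M (A \<union> set bs) ss (\<lambda>as. R (as @ bs))"
proof -
  obtain xs \<phi> where x: "distinct xs" "map fst xs = ss @ ts" "\<phi> \<in> formulas M A (set xs)"
    "\<forall>as\<in>tuples M (ss @ ts). R as \<longleftrightarrow> sat M (val xs as) \<phi>"
    using assms(1) unfolding dfn_def by blast
  then obtain vs ws where xs: "xs = vs @ ws" "map fst vs = ss" "map fst ws = ts"
    by (metis map_eq_append_conv)
  have l: "length ws = length bs" using assms(2) xs tuples_length by (metis length_map)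
  have b: "val ws bs v \<in> set bs \<and> sort_of M (val ws bs v) = fst v" if v: "v \<in> set ws" for v
  proof -
    obtain i where i: "i < length ws" "v = ws ! i" using v by (auto simp: in_set_conv_nth)
    then have "val ws bs v = bs ! i" using x(1) xs l by (simp add: val_nth)
    then show ?thesis using i l assms(2) xs(3) by (metis nth_map nth_mem tuples_sorts)
  qed
  show ?thesis
  proof (rule dfnI[of vs _ "inst (set ws) (val ws bs) \<phi>"])
    show "inst (set ws) (val ws bs) \<phi> \<in> formulas M (A \<union> set bs) (set vs)"
      using x(3) xs b by (auto simp: formulas_def fv_inst intro!: wf_fm_inst)
    fix as assume as: "as \<in> tuples M ss"
    then have "R (as @ bs) \<longleftrightarrow> sat M (val (vs @ ws) (as @ bs)) \<phi>"
      using x(4) assms(2) xs(1) by auto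
    also have "\<dots> \<longleftrightarrow> sat M (val vs as) (inst (set ws) (val ws bs) \<phi>)"
      unfolding sat_inst
    proof (rule sat_cong)
      fix v
      have "length vs = length as" using as xs tuples_length by (metis length_map)
      then show "val (vs @ ws) (as @ bs) v = (if v \<in> set ws then val ws bs v else val vs as v)"
        if "v \<in> fv \<phi>"
        using that x(1,3) xs by (auto simp: val_append formulas_def)
    qed
    finally show "R (as @ bs) \<longleftrightarrow> sat M (val vs as) (inst (set ws) (val ws bs) \<phi>)" .
  qed (use x xs in auto)
qed

text \<open>Converse of \<open>dfn_inst\<close>: the parameters \<open>bs\<close> move into extra
  coordinates, whose variables occur in the formula neither free nor bound.\<close>

lemma dfn_abs:
  assumes "dfn M (A \<union> set bs) ss R" "bs \<in> tuples M ts" "set ts \<subseteq> sorts M"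
  shows "\<exists>S. dfn M A (ss @ ts) S \<and> (\<forall>as\<in>tuples M ss. R as \<longleftrightarrow> S (as @ bs))"
proof -
  obtain vs \<phi> where v: "distinct vs" "map fst vs = ss" "\<phi> \<in> formulas M (A \<union> set bs) (set vs)"
    "\<forall>as\<in>tuples M ss. R as \<longleftrightarrow> sat M (val vs as) \<phi>"
    using assms(1) unfolding dfn_def by blast
  obtain ws where w: "distinct ws" "map fst ws = ts" "set ws \<inter> (set vs \<union> fv \<phi> \<union> bvars \<phi>) = {}"
    using ex_fresh_vars[of "set vs \<union> fv \<phi> \<union> bvars \<phi>" ts] by (auto simp: finite_fv finite_bvars)
  \<comment> \<open>An element repeated in \<open>bs\<close> receives the variable of its first
    position; the variables of its other positions become dummies.\<close>
  define g where "g = (\<lambda>a. map_of (zip bs ws) a)"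
  have l: "length ws = length bs" using assms(2) w(2) tuples_length by (metis length_map)
  have g: "\<exists>i<length bs. a = bs ! i \<and> v = ws ! i" if "g a = Some v" for a v
    using that l unfolding g_def by (metis (no_types, lifting) Pair_inject in_set_zip map_of_SomeD fst_conv snd_conv)
  have gn: "a \<notin> set bs" if "g a = None" for a
    using that l by (simp add: g_def map_of_zip_is_None)
  let ?\<psi> = "params_to_vars g \<phi>"
  show ?thesis
  proof (intro exI[of _ "\<lambda>as. sat M (val (vs @ ws) as) ?\<psi>"] conjI ballI)
    have "wf_fm M A ?\<psi>"
    proof (rule wf_fm_params_to_vars)
      show "wf_fm M (A \<union> set bs) \<phi>" using v(3) by (simp add: formulas_def)
      show "a \<in> A" if "a \<in> A \<union> set bs" "g a = None" for a using that gn by blast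
      show "fst v = sort_of M a \<and> fst v \<in> sorts M" if gv: "g a = Some v" for a v
      proof -
        obtain i where i: "i < length bs" "a = bs ! i" "v = ws ! i" using g[OF gv] by blast
        then have "fst v = ts ! i" using l w(2) by auto
        moreover have "sort_of M a = ts ! i" using i assms(2) tuples_sorts by fastforce
        moreover have "i < length ts" using i l w(2) by auto
        ultimately show ?thesis using assms(3) by auto
      qed
    qed
    moreover have "fv ?\<psi> \<subseteq> set vs \<union> set ws"
    proof -
      have "v \<in> set ws" if "g a = Some v" for a v using g[OF that] l by auto
      moreover have "fv \<phi> \<subseteq> set vs" using v(3) by (simp add: formulas_def)
      ultimately show ?thesis using fv_params_to_vars[of g \<phi>] by blast
    qed
    ultimately show "dfn M A (ss @ ts) (\<lambda>as. sat M (val (vs @ ws) as) ?\<psi>)"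
      using v w by (intro dfnI[of "vs @ ws" _ ?\<psi>]) (auto simp: formulas_def)
    fix as assume as: "as \<in> tuples M ss"
    then have lv: "length vs = length as" using v(2) tuples_length by (metis length_map)
    have "sat M (val (vs @ ws) (as @ bs)) ?\<psi> \<longleftrightarrow> sat M (val (vs @ ws) (as @ bs)) \<phi>"
    proof (rule sat_params_to_vars)
      fix a v assume "g a = Some v"
      then obtain i where i: "i < length bs" "a = bs ! i" "v = ws ! i" using g by blast
      then have "v \<in> set ws" using l by simp
      then have "v \<notin> set vs" and "v \<notin> bvars \<phi>" using w(3) by blast+
      then show "val (vs @ ws) (as @ bs) v = a" "v \<notin> bvars \<phi>"
        using i l w(1) lv by (simp_all add: val_append val_nth)
    qed
    also have "\<dots> \<longleftrightarrow> sat M (val vs as) \<phi>"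
      by (rule sat_cong) (use v(3) lv in \<open>auto simp: val_append formulas_def\<close>)
    finally show "R as \<longleftrightarrow> sat M (val (vs @ ws) (as @ bs)) ?\<psi>" using v(4) as by simp
  qed
qed

text \<open>The formula itself does not change: it is written in \<open>?ws\<close>, a selection
  without repetition from the variables \<open>vs\<close> of the long tuple, and then read as a
  formula in \<open>vs\<close>. This covers permutations of coordinates and dummy
  coordinates.\<close>

lemma dfn_reindex:
  assumes "dfn M A ss R" "distinct is" "set is \<subseteq> {..<length ts}" "map ((!) ts) is = ss"
  shows "dfn M A ts (\<lambda>as. R (map ((!) as) is))"
proof -
  obtain vs :: "('a \<times> nat) list" where v: "distinct vs" "map fst vs = ts"
    using ex_vars by blast
  have l: "length vs = length ts" using v by auto
  let ?ws = "map ((!) vs) is"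
  have "inj_on ((!) vs) (set is)"
    by (rule inj_onI) (metis assms(3) l lessThan_iff nth_eq_iff_index_eq subsetD v(1))
  then have dw: "distinct ?ws" using assms(2) by (simp add: distinct_map)
  have "fst (vs ! i) = ts ! i" if "i \<in> set is" for i
    using that assms(3) l v(2) by (metis lessThan_iff nth_map subsetD)
  then have "map fst ?ws = map ((!) ts) is" by simp
  then have fw: "map fst ?ws = ss" using assms(4) by (rule trans)
  obtain \<phi> where p: "\<phi> \<in> formulas M A (set ?ws)"
    "\<And>as. as \<in> tuples M ss \<Longrightarrow> R as \<longleftrightarrow> sat M (val ?ws as) \<phi>"
    by (rule dfnE[OF assms(1) dw fw]) (rule that)
  show ?thesis
  proof (rule dfnI[of vs _ \<phi>])
    have "set ?ws \<subseteq> set vs" using assms(3) l by auto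
    then show "\<phi> \<in> formulas M A (set vs)" using p(1) formulas_mono by blast
    fix as assume as: "as \<in> tuples M ts"
    then have la: "length as = length ts" by (rule tuples_length)
    have n: "sort_of M (as ! i) = ts ! i \<and> as ! i \<in> univ M" if "i < length ts" for i
      using as that la by (metis nth_map nth_mem subsetD tuples_set tuples_sorts)
    have "map ((!) as) is \<in> tuples M ss"
      using n assms(3) unfolding assms(4)[symmetric] by (auto simp: tuples_def subset_iff)
    then have "R (map ((!) as) is) \<longleftrightarrow> sat M (val ?ws (map ((!) as) is)) \<phi>" by (rule p(2))
    also have "\<dots> \<longleftrightarrow> sat M (val vs as) \<phi>"
    proof (rule sat_cong)
      fix v assume "v \<in> fv \<phi>"
      then have "v \<in> set ?ws" using p(1) unfolding formulas_def by blast
      then obtain j where j: "j < length is" "v = ?ws ! j" by (metis in_set_conv_nth length_map)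
      have "val ?ws (map ((!) as) is) v = as ! (is ! j)"
        using val_nth[OF dw, of "map ((!) as) is" j] j by simp
      moreover have "is ! j < length vs" using j(1) assms(3) l by (metis lessThan_iff nth_mem subsetD)
      ultimately show "val ?ws (map ((!) as) is) v = val vs as v"
        using j v(1) l la by (simp add: val_nth)
    qed
    finally show "R (map ((!) as) is) \<longleftrightarrow> sat M (val vs as) \<phi>" .
  qed (use v in auto)
qed

lemma dfn_finite_params: "dfn M A ss R \<Longrightarrow> \<exists>F\<subseteq>A. finite F \<and> dfn M F ss R"
proof -
  assume "dfn M A ss R"
  then obtain vs \<phi> where v: "distinct vs" "map fst vs = ss" "\<phi> \<in> formulas M A (set vs)"
    "\<forall>as\<in>tuples M ss. R as \<longleftrightarrow> sat M (val vs as) \<phi>"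
    unfolding dfn_def by blast
  moreover obtain F where "F \<subseteq> A" "finite F" "wf_fm M F \<phi>"
    using v(3) wf_fm_finite_params[of M A \<phi>] by (auto simp: formulas_def)
  ultimately have "dfn M F ss R" by (intro dfnI[of vs _ \<phi>]) (auto simp: formulas_def)
  then show ?thesis using \<open>F \<subseteq> A\<close> \<open>finite F\<close> by blast
qed

lemma dfn_eq:
  assumes "s \<in> sorts M"
  shows "dfn M A [s, s] (\<lambda>as. as ! 0 = as ! 1)"
proof (rule dfnI[of "[(s, 0), (s, 1)]" _ "Eq (Var (s, 0)) (Var (s, 1))"])
  fix as assume "as \<in> tuples M [s, s]"
  then obtain a b where "as = [a, b]" unfolding tuples_Cons tuples_Nil by blast
  then show "as ! 0 = as ! 1 \<longleftrightarrow> sat M (val [(s, 0), (s, 1)] as) (Eq (Var (s, 0)) (Var (s, 1)))"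
    by simp
qed (use assms in \<open>simp_all add: formulas_def\<close>)

lemma dfn_eq_param:
  assumes "s \<in> sorts M" "a \<in> A" "sort_of M a = s"
  shows "dfn M A [s] (\<lambda>as. as ! 0 = a)"
proof (rule dfnI[of "[(s, 0)]" _ "Eq (Var (s, 0)) (Par a)"])
  fix as assume "as \<in> tuples M [s]"
  then obtain b where "as = [b]" unfolding tuples_Cons tuples_Nil by blast
  then show "as ! 0 = a \<longleftrightarrow> sat M (val [(s, 0)] as) (Eq (Var (s, 0)) (Par a))" by simp
qed (use assms in \<open>simp_all add: formulas_def\<close>)

section \<open>Saturation\<close>

definition fin_sat :: "('s, 'f, 'r, 'a) struct \<Rightarrow> ('s \<times> nat) set \<Rightarrow> ('s, 'f, 'r, 'a) formula set \<Rightarrow> bool" where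
  "fin_sat M X \<Gamma> \<longleftrightarrow>
     (\<forall>\<Delta>. finite \<Delta> \<and> \<Delta> \<subseteq> \<Gamma> \<longrightarrow> (\<exists>e. assignment M X e \<and> (\<forall>\<phi>\<in>\<Delta>. sat M e \<phi>)))"

lemma fin_satD:
  "fin_sat M X \<Gamma> \<Longrightarrow> finite \<Delta> \<Longrightarrow> \<Delta> \<subseteq> \<Gamma> \<Longrightarrow> \<exists>e. assignment M X e \<and> (\<forall>\<phi>\<in>\<Delta>. sat M e \<phi>)"
  by (simp add: fin_sat_def)

lemma extend_to_complete_type:
  assumes "\<Gamma> \<subseteq> formulas M A X" "fin_sat M X \<Gamma>"
  shows "\<exists>u. complete_type M A X u \<and> \<Gamma> \<subseteq> u"
proof -
  \<comment> \<open>\<open>\<Gamma>\<close> is kept apart from the varying part so that the union of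
    the empty chain qualifies as well.\<close>
  let ?S = "{\<Delta>. \<Delta> \<subseteq> formulas M A X \<and> fin_sat M X (\<Gamma> \<union> \<Delta>)}"
  have "\<Union>C \<in> ?S" if C: "subset.chain ?S C" for C
  proof -
    have sub: "\<Union>C \<subseteq> formulas M A X" using C by (auto simp: subset_chain_def)
    have "\<exists>e. assignment M X e \<and> (\<forall>\<phi>\<in>F. sat M e \<phi>)" if F: "finite F" "F \<subseteq> \<Gamma> \<union> \<Union>C" for F
    proof (cases "C = {}")
      case True
      then show ?thesis using fin_satD[OF assms(2) F(1)] F(2) by simp
    next
      case False
      obtain B where "B \<in> C" "F - \<Gamma> \<subseteq> B"
        by (rule finite_subset_Union_chain[of "F - \<Gamma>" C ?S]) (use F False C in auto)
      moreover from this have "fin_sat M X (\<Gamma> \<union> B)" using C by (auto simp: subset_chain_def)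
      ultimately show ?thesis using fin_satD[of M X "\<Gamma> \<union> B" F] F(1) by blast
    qed
    then show ?thesis using sub by (simp add: fin_sat_def)
  qed
  then obtain \<Delta> where D: "\<Delta> \<in> ?S" "\<forall>\<Theta>\<in>?S. \<Delta> \<subseteq> \<Theta> \<longrightarrow> \<Theta> = \<Delta>"
    using subset_Zorn'[of ?S] by blast
  let ?u = "\<Gamma> \<union> \<Delta>"
  have fsu: "fin_sat M X ?u" using D(1) by simp
  have add: "\<phi> \<in> ?u" if "\<phi> \<in> formulas M A X" "fin_sat M X (insert \<phi> ?u)" for \<phi>
  proof -
    have "insert \<phi> \<Delta> \<in> ?S" using that D(1) by simp
    then show ?thesis using D(2) by blast
  qed
  have "\<phi> \<in> ?u \<or> Neg \<phi> \<in> ?u" if f: "\<phi> \<in> formulas M A X" for \<phi>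
  proof (rule ccontr)
    assume n: "\<not> (\<phi> \<in> ?u \<or> Neg \<phi> \<in> ?u)"
    have "Neg \<phi> \<in> formulas M A X" using f by (simp add: formulas_def)
    then have "\<not> fin_sat M X (insert \<phi> ?u)" "\<not> fin_sat M X (insert (Neg \<phi>) ?u)"
      using n f add by blast+
    then obtain F G where FG: "finite F" "F \<subseteq> insert \<phi> ?u" "finite G" "G \<subseteq> insert (Neg \<phi>) ?u"
      "\<forall>e. assignment M X e \<longrightarrow> \<not> (\<forall>\<psi>\<in>F. sat M e \<psi>)"
      "\<forall>e. assignment M X e \<longrightarrow> \<not> (\<forall>\<psi>\<in>G. sat M e \<psi>)"
      unfolding fin_sat_def by metis
    obtain e where e: "assignment M X e" "\<forall>\<psi>\<in>(F - {\<phi>}) \<union> (G - {Neg \<phi>}). sat M e \<psi>"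
      using fin_satD[OF fsu, of "(F - {\<phi>}) \<union> (G - {Neg \<phi>})"] FG by blast
    show False
    proof (cases "sat M e \<phi>")
      case True
      then have "\<forall>\<psi>\<in>F. sat M e \<psi>" using e(2) by blast
      then show False using FG(5) e(1) by blast
    next
      case False
      then have "\<forall>\<psi>\<in>G. sat M e \<psi>" using e(2) by (metis DiffI UnI2 sat.simps(3) singletonD)
      then show False using FG(6) e(1) by blast
    qed
  qed
  moreover have "?u \<subseteq> formulas M A X" using assms(1) D(1) by simp
  ultimately have "complete_type M A X ?u"
    using fsu unfolding complete_type_def fin_sat_def by simp
  then show ?thesis by blast
qed

lemma sat_single:
  "\<phi> \<in> formulas M A {v} \<Longrightarrow> e v = a \<Longrightarrow> sat M (\<lambda>_. a) \<phi> \<longleftrightarrow> sat M e \<phi>"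
  by (rule sat_cong) (auto simp: formulas_def)

section \<open>Equality of types of finite tuples, and saturation in several variables\<close>

definition EQ :: "('s, 'f, 'r, 'a) struct \<Rightarrow> 'a set \<Rightarrow> 'a list \<Rightarrow> 'a list \<Rightarrow> bool" where
  "EQ N A as bs \<longleftrightarrow>
     (\<exists>ss. as \<in> tuples N ss \<and> bs \<in> tuples N ss \<and> (\<forall>R. dfn N A ss R \<longrightarrow> (R as \<longleftrightarrow> R bs)))"

locale saturated_structure =
  fixes N :: "('s, 'f, 'r, 'a) struct" and \<kappa> :: "'k rel"
  assumes saturated: "saturated \<kappa> N" and card: "Card_order \<kappa>"
    and uncountable: "|UNIV :: nat set| <o \<kappa>"
    and sort_of_sorts: "\<And>a. a \<in> univ N \<Longrightarrow> sort_of N a \<in> sorts N"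
    and sorts_nonempty: "sorts N \<noteq> {}"
begin

lemma infinite_Field: "infinite (Field \<kappa>)"
proof
  assume "finite (Field \<kappa>)"
  moreover have "|UNIV :: nat set| <o |Field \<kappa>|"
    using uncountable card card_of_Field_ordIso ordIso_symmetric ordLess_ordIso_trans by blast
  ultimately show False
    using card_of_ordLess infinite_UNIV_nat card_of_ordLeq_finite ordLess_imp_ordLeq by metis
qed

abbreviation sm :: "'a set \<Rightarrow> bool" where "sm \<equiv> small \<kappa> N"

lemma sm_Un: "sm D \<Longrightarrow> sm E \<Longrightarrow> sm (D \<union> E)"
  unfolding small_def using card_of_Un_ordLess_infinite_Field[OF infinite_Field card] by blast

text \<open>Uncountability of \<open>\<kappa>\<close> is what turns a sequence indexed by the
  naturals into a small set of parameters.\<close>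

lemma sm_range: "range f \<subseteq> univ N \<Longrightarrow> sm (range f)" for f :: "nat \<Rightarrow> 'a"
  unfolding small_def using card_of_image[of f UNIV] uncountable ordLeq_ordLess_trans by blast

lemma sm_finite: "finite D \<Longrightarrow> D \<subseteq> univ N \<Longrightarrow> sm D"
proof -
  assume D: "finite D" "D \<subseteq> univ N"
  have "|D| \<le>o |UNIV :: nat set|"
    using D(1) by (meson card_of_nat finite_iff_ordLess_natLeq ordIso_symmetric ordLess_imp_ordLeq ordLess_ordIso_trans)
  then show ?thesis unfolding small_def using D(2) uncountable ordLeq_ordLess_trans by blast
qed

lemma sm_univ: "sm D \<Longrightarrow> D \<subseteq> univ N" by (simp add: small_def)

lemma tuples_sorts_subset: "as \<in> tuples N ss \<Longrightarrow> set ss \<subseteq> sorts N"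
  using sort_of_sorts by (fastforce simp: tuples_def)

lemma realize_one:
  assumes "sm A" "s \<in> sorts N" "\<And>R. R \<in> \<R> \<Longrightarrow> dfn N A [s] R"
    and fs: "\<And>F. finite F \<Longrightarrow> F \<subseteq> \<R> \<Longrightarrow> \<exists>as\<in>tuples N [s]. \<forall>R\<in>F. R as"
  shows "\<exists>as\<in>tuples N [s]. \<forall>R\<in>\<R>. R as"
proof -
  let ?v = "(s, 0::nat)"
  have "\<exists>\<phi>. \<phi> \<in> formulas N A {?v} \<and> (\<forall>as\<in>tuples N [s]. R as \<longleftrightarrow> sat N (val [?v] as) \<phi>)" if R: "R \<in> \<R>" for R
  proof -
    obtain \<phi> where "\<phi> \<in> formulas N A (set [?v])"
      "\<And>as. as \<in> tuples N [s] \<Longrightarrow> R as \<longleftrightarrow> sat N (val [?v] as) \<phi>"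
      by (rule dfnE[OF assms(3)[OF R], of "[?v]"]) (simp, simp, rule that)
    then show ?thesis by auto
  qed
  then obtain f where f: "\<And>R. R \<in> \<R> \<Longrightarrow> f R \<in> formulas N A {?v}"
    "\<And>R as. R \<in> \<R> \<Longrightarrow> as \<in> tuples N [s] \<Longrightarrow> R as \<longleftrightarrow> sat N (val [?v] as) (f R)"
    by metis
  have "fin_sat N {?v} (f ` \<R>)"
    unfolding fin_sat_def
  proof (intro allI impI)
    fix \<Delta> assume "finite \<Delta> \<and> \<Delta> \<subseteq> f ` \<R>"
    then obtain F where F: "F \<subseteq> \<R>" "finite F" "\<Delta> = f ` F" by (metis finite_subset_image)
    then obtain as where as: "as \<in> tuples N [s]" "\<forall>R\<in>F. R as" using fs by blast
    have "assignment N {?v} (val [?v] as)" using val_assignment[of "[?v]" as N] as(1) by simp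
    moreover have "\<forall>\<phi>\<in>\<Delta>. sat N (val [?v] as) \<phi>" using F as f(2) by auto
    ultimately show "\<exists>e. assignment N {?v} e \<and> (\<forall>\<phi>\<in>\<Delta>. sat N e \<phi>)" by blast
  qed
  then obtain u where u: "complete_type N A {?v} u" "f ` \<R> \<subseteq> u"
    using extend_to_complete_type[of "f ` \<R>" N A "{?v}"] f(1) by blast
  have "A \<subseteq> univ N" "|A| <o \<kappa>" using assms(1) by (auto simp: small_def)
  then obtain a where a: "realizes N s u a"
    using saturated u(1) assms(2) unfolding saturated_def by blast
  then have t: "[a] \<in> tuples N [s]" by (simp add: realizes_def)
  have "R [a]" if R: "R \<in> \<R>" for R
  proof -
    have "sat N (\<lambda>_. a) (f R)" using a u(2) R by (auto simp: realizes_def)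
    then have "sat N (val [?v] [a]) (f R)" using sat_single[OF f(1)[OF R], of "val [?v] [a]" a] by simp
    then show ?thesis using f(2)[OF R t] by simp
  qed
  then show ?thesis using t by blast
qed

text \<open>Saturation in several variables from saturation in one: first realize the projection to
  the tail coordinates, then find the head over the tail just found.\<close>

lemma realize_family:
  assumes "sm A" "set ss \<subseteq> sorts N" "\<And>R. R \<in> \<R> \<Longrightarrow> dfn N A ss R"
    and "\<And>F. finite F \<Longrightarrow> F \<subseteq> \<R> \<Longrightarrow> \<exists>as\<in>tuples N ss. \<forall>R\<in>F. R as"
  shows "\<exists>as\<in>tuples N ss. \<forall>R\<in>\<R>. R as"
  using assms
proof (induction ss arbitrary: \<R>)
  case Nil
  have "R []" if "R \<in> \<R>" for R
    using Nil.prems(4)[of "{R}"] that by (metis finite.emptyI finite.insertI insertI1 empty_subsetI insert_subset tuples_Nil)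
  then show ?case by (intro bexI[of _ "[]"]) auto
next
  case (Cons s ss)
  \<comment> \<open>The projection of \<open>\<R>\<close> is generated by the projections of its
    finite parts, and these are definable by \<open>dfn_ex\<close>.\<close>
  define S where "S = (\<lambda>F as. \<exists>a\<in>univ N. sort_of N a = s \<and> (\<forall>R\<in>F. R (a # as)))"
  define \<S> where "\<S> = S ` {F. finite F \<and> F \<subseteq> \<R>}"
  have "\<exists>as\<in>tuples N ss. \<forall>T\<in>\<S>. T as"
  proof (rule Cons.IH)
    show "sm A" "set ss \<subseteq> sorts N" using Cons.prems by auto
    show "dfn N A ss T" if T: "T \<in> \<S>" for T
    proof -
      obtain F where F: "finite F" "F \<subseteq> \<R>" "T = S F" using T by (auto simp: \<S>_def)
      have "dfn N A (s # ss) (\<lambda>as. \<forall>R\<in>F. R as)"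
        by (rule dfn_ball_finite[OF sorts_nonempty F(1)]) (use F Cons.prems(3) in blast)
      then show ?thesis unfolding F(3) S_def by (rule dfn_ex) (use Cons.prems(2) in simp)
    qed
    fix G assume G: "finite G" "G \<subseteq> \<S>"
    then obtain H where H: "H \<subseteq> {F. finite F \<and> F \<subseteq> \<R>}" "finite H" "G = S ` H"
      using finite_subset_image[OF G(1) G(2)[unfolded \<S>_def]] by blast
    have "finite (\<Union>H)" "\<Union>H \<subseteq> \<R>" using H by auto
    then obtain as where "as \<in> tuples N (s # ss)" "\<forall>R\<in>\<Union>H. R as" using Cons.prems(4) by blast
    then obtain a bs where ab: "a \<in> univ N" "sort_of N a = s" "bs \<in> tuples N ss" "\<forall>R\<in>\<Union>H. R (a # bs)"
      by (metis tuples_Cons)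
    then have "S F bs" if "F \<in> H" for F using that unfolding S_def by blast
    then show "\<exists>as\<in>tuples N ss. \<forall>T\<in>G. T as" using ab(3) unfolding H(3) by blast
  qed
  then obtain bs where bs: "bs \<in> tuples N ss" "\<And>F. finite F \<Longrightarrow> F \<subseteq> \<R> \<Longrightarrow> S F bs"
    unfolding \<S>_def by blast
  define I where "I = (\<lambda>R as. R (as @ bs :: 'a list) :: bool)"
  have "\<exists>as\<in>tuples N [s]. \<forall>T\<in>I ` \<R>. T as"
  proof (rule realize_one)
    have "set bs \<subseteq> univ N" using bs(1) by (rule tuples_set)
    then show "sm (A \<union> set bs)" using Cons.prems(1) by (simp add: sm_Un sm_finite)
    show "s \<in> sorts N" using Cons.prems(2) by simp
    show "dfn N (A \<union> set bs) [s] T" if T: "T \<in> I ` \<R>" for T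
    proof -
      obtain R where R: "R \<in> \<R>" "T = I R" using T by blast
      have "dfn N A ([s] @ ss) R" using Cons.prems(3)[OF R(1)] by simp
      from dfn_inst[OF this bs(1)] show ?thesis unfolding R(2) I_def .
    qed
    fix G assume G: "finite G" "G \<subseteq> I ` \<R>"
    obtain F where F: "F \<subseteq> \<R>" "finite F" "G = I ` F" using finite_subset_image[OF G] by blast
    then obtain a where "a \<in> univ N" "sort_of N a = s" "\<forall>R\<in>F. R (a # bs)"
      using bs(2)[of F] unfolding S_def by blast
    then show "\<exists>as\<in>tuples N [s]. \<forall>T\<in>G. T as"
      unfolding F(3) I_def by (intro bexI[of _ "[a]"]) simp_all
  qed
  then obtain as where as: "as \<in> tuples N [s]" "\<forall>T\<in>I ` \<R>. T as" by (rule bexE)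
  then have "\<forall>R\<in>\<R>. R (as @ bs)" by (simp add: I_def)
  moreover have "as @ bs \<in> tuples N (s # ss)" using append_in_tuples[OF as(1) bs(1)] by simp
  ultimately show ?case by blast
qed

lemma EQ_refl: "set as \<subseteq> univ N \<Longrightarrow> EQ N A as as"
  unfolding EQ_def using tuples_self by blast

lemma EQ_mono: "EQ N B as bs \<Longrightarrow> A \<subseteq> B \<Longrightarrow> EQ N A as bs"
  unfolding EQ_def using dfn_mono by meson

lemma EQ_D:
  "EQ N A as bs \<Longrightarrow> as \<in> tuples N ss \<Longrightarrow> dfn N A ss R \<Longrightarrow> R as \<longleftrightarrow> R bs"
  unfolding EQ_def using tuples_sorts by metis

lemma EQ_tuples: "EQ N A as bs \<Longrightarrow> as \<in> tuples N ss \<longleftrightarrow> bs \<in> tuples N ss"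
  unfolding EQ_def using tuples_sorts by metis

lemma EQ_length: "EQ N A as bs \<Longrightarrow> length as = length bs"
  unfolding EQ_def using tuples_length by metis

lemma EQ_I:
  assumes "as \<in> tuples N ss" "bs \<in> tuples N ss" "\<And>R. dfn N A ss R \<Longrightarrow> R as \<Longrightarrow> R bs"
  shows "EQ N A as bs"
  unfolding EQ_def using assms dfn_neg by blast

lemma EQ_from_params:
  assumes "EQ N (D \<union> set cs) as bs" "set cs \<subseteq> univ N"
  shows "EQ N D (as @ cs) (bs @ cs)"
proof -
  obtain ss where s: "as \<in> tuples N ss" "bs \<in> tuples N ss" using assms(1) EQ_def by blast
  define ts where "ts = map (sort_of N) cs"
  have c: "cs \<in> tuples N ts" using assms(2) by (simp add: ts_def tuples_def)
  show ?thesis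
  proof (rule EQ_I)
    show "as @ cs \<in> tuples N (ss @ ts)" "bs @ cs \<in> tuples N (ss @ ts)" using s c by auto
    fix R assume "dfn N D (ss @ ts) R" "R (as @ cs)"
    then show "R (bs @ cs)" using EQ_D[OF assms(1) s(1) dfn_inst[OF _ c]] by blast
  qed
qed

lemma EQ_reindex:
  assumes "EQ N A as bs" "distinct is" "set is \<subseteq> {..<length as}"
  shows "EQ N A (map ((!) as) is) (map ((!) bs) is)"
proof -
  obtain ss where s: "as \<in> tuples N ss" "bs \<in> tuples N ss" using assms(1) EQ_def by blast
  have l: "length as = length ss" using s(1) by (rule tuples_length)
  have t: "map ((!) cs) is \<in> tuples N (map ((!) ss) is)" if c: "cs \<in> tuples N ss" for cs
  proof -
    have "sort_of N (cs ! i) = ss ! i \<and> cs ! i \<in> univ N" if "i \<in> set is" for i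
    proof -
      have i: "i < length cs" using that assms(3) l tuples_length[OF c] by auto
      then show ?thesis using c tuples_set[OF c] by (metis nth_map nth_mem subsetD tuples_sorts)
    qed
    then show ?thesis by (auto simp: tuples_def)
  qed
  show ?thesis
  proof (rule EQ_I[OF t[OF s(1)] t[OF s(2)]])
    fix R assume R: "dfn N A (map ((!) ss) is) R" "R (map ((!) as) is)"
    have "dfn N A ss (\<lambda>as. R (map ((!) as) is))"
      by (rule dfn_reindex[OF R(1)]) (use assms(2,3) l in auto)
    from EQ_D[OF assms(1) s(1) this] show "R (map ((!) bs) is)" using R(2) by simp
  qed
qed

lemma EQ_take: 
  assumes "EQ N A (as @ cs) (bs @ ds)" "length as = length bs"
  shows "EQ N A as bs"
proof -
  have "EQ N A (map ((!) (as @ cs)) [0..<length as]) (map ((!) (bs @ ds)) [0..<length as])"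
    by (rule EQ_reindex[OF assms(1)]) auto
  moreover have "map ((!) (as @ cs)) [0..<length as] = as"
    by (rule nth_equalityI) (auto simp: nth_append)
  moreover have "map ((!) (bs @ ds)) [0..<length as] = bs"
    by (rule nth_equalityI) (auto simp: nth_append assms(2))
  ultimately show ?thesis by simp
qed

lemma EQ_drop:
  assumes "EQ N A (as @ cs) (bs @ ds)" "length as = length bs"
  shows "EQ N A cs ds"
proof -
  have l: "length cs = length ds" using EQ_length[OF assms(1)] assms(2) by simp
  have "EQ N A (map ((!) (as @ cs)) [length as..<length as + length cs])
               (map ((!) (bs @ ds)) [length as..<length as + length cs])"
    by (rule EQ_reindex[OF assms(1)]) auto
  moreover have "map ((!) (as @ cs)) [length as..<length as + length cs] = cs"
    by (rule nth_equalityI) (auto simp: nth_append)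
  moreover have "map ((!) (bs @ ds)) [length as..<length as + length cs] = ds"
    by (rule nth_equalityI) (auto simp: nth_append assms(2) l)
  ultimately show ?thesis by simp
qed

lemma EQ_pair: 
  assumes "EQ N A as bs" "i < length as" "j < length as" "i \<noteq> j"
  shows "EQ N A [as ! i, as ! j] [bs ! i, bs ! j]"
  using EQ_reindex[OF assms(1), of "[i, j]"] assms(2-4) by simp

text \<open>One step of a back-and-forth, in place of an automorphism that takes \<open>as\<close>
  to \<open>bs\<close>. Each finite part of the type of \<open>c\<close> over \<open>D\<close> and
  \<open>as\<close> can be satisfied over \<open>bs\<close>, because its satisfiability is a
  definable property of \<open>as\<close>.\<close>

lemma EQ_extend:
  assumes "sm D" "EQ N D as bs" "c \<in> univ N"
  shows "\<exists>d. EQ N D (c # as) (d # bs)"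
proof -
  obtain ss where s: "as \<in> tuples N ss" "bs \<in> tuples N ss" using assms(2) EQ_def by blast
  let ?s = "sort_of N c"
  have c: "c # as \<in> tuples N (?s # ss)" using s assms(3) by simp
  let ?R = "{R. dfn N D (?s # ss) R \<and> R (c # as)}"
  define I where "I = (\<lambda>R as. R (as @ bs :: 'a list) :: bool)"
  have "\<exists>as\<in>tuples N [?s]. \<forall>T\<in>I ` ?R. T as"
  proof (rule realize_one)
    show "sm (D \<union> set bs)" using assms(1) tuples_set[OF s(2)] by (simp add: sm_Un sm_finite)
    show "?s \<in> sorts N" using assms(3) by (rule sort_of_sorts)
    show "dfn N (D \<union> set bs) [?s] T" if T: "T \<in> I ` ?R" for T
    proof -
      obtain R where R: "dfn N D ([?s] @ ss) R" "T = I R" using T by auto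
      from dfn_inst[OF R(1) s(2)] show ?thesis unfolding R(2) I_def .
    qed
    fix G assume G: "finite G" "G \<subseteq> I ` ?R"
    obtain F where F: "F \<subseteq> ?R" "finite F" "G = I ` F" using finite_subset_image[OF G] by blast
    have "dfn N D (?s # ss) (\<lambda>as. \<forall>R\<in>F. R as)"
      by (rule dfn_ball_finite[OF sorts_nonempty F(2)]) (use F in blast)
    from dfn_ex[OF this sort_of_sorts[OF assms(3)]]
    have "dfn N D ss (\<lambda>as. \<exists>a\<in>univ N. sort_of N a = ?s \<and> (\<forall>R\<in>F. R (a # as)))" .
    from EQ_D[OF assms(2) s(1) this]
    have "\<exists>a\<in>univ N. sort_of N a = ?s \<and> (\<forall>R\<in>F. R (a # bs))" using assms(3) F(1) by blast
    then obtain d where "d \<in> univ N" "sort_of N d = ?s" "\<forall>R\<in>F. R (d # bs)" by blast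
    then show "\<exists>as\<in>tuples N [?s]. \<forall>T\<in>G. T as"
      unfolding F(3) I_def by (intro bexI[of _ "[d]"]) simp_all
  qed
  then obtain ds where ds: "ds \<in> tuples N [?s]" "\<forall>T\<in>I ` ?R. T ds" by (rule bexE)
  have dR: "R (ds @ bs)" if "dfn N D (?s # ss) R" "R (c # as)" for R
  proof -
    have "I R \<in> I ` ?R" using that by (intro imageI) simp
    then have "I R ds" using ds(2) by (rule bspec[rotated])
    then show ?thesis by (simp add: I_def)
  qed
  from ds(1) obtain d where d: "ds = [d]" "d \<in> univ N" "sort_of N d = ?s"
    by (auto simp: tuples_Cons)
  have "EQ N D (c # as) (d # bs)"
  proof (rule EQ_I[OF c])
    show "d # bs \<in> tuples N (?s # ss)" using d s by simp
    show "R (d # bs)" if "dfn N D (?s # ss) R" "R (c # as)" for R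
      using dR[OF that] d(1) by simp
  qed
  then show ?thesis by blast
qed

lemma EQ_extend_list:
  assumes "sm D" "EQ N D as bs" "set cs \<subseteq> univ N"
  shows "\<exists>ds. length ds = length cs \<and> EQ N D (cs @ as) (ds @ bs)"
  using assms(3)
proof (induction cs)
  case Nil
  then show ?case using assms(2) by (intro exI[of _ "[]"]) simp
next
  case (Cons c cs)
  then obtain ds where "length ds = length cs" "EQ N D (cs @ as) (ds @ bs)" by auto
  moreover from EQ_extend[OF assms(1) this(2), of c] Cons.prems
  obtain d where "EQ N D (c # cs @ as) (d # ds @ bs)" by auto
  ultimately show ?case by (intro exI[of _ "d # ds"]) simp
qed

end

section \<open>Invariant types\<close>

lemma inst_tm_cong: "(\<And>v. v \<in> Y \<Longrightarrow> b v = b' v) \<Longrightarrow> inst_tm Y b t = inst_tm Y b' t"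
  by (induction t) auto

lemma inst_cong: "(\<And>v. v \<in> Y \<Longrightarrow> b v = b' v) \<Longrightarrow> inst Y b \<phi> = inst Y b' \<phi>"
proof (induction \<phi> arbitrary: Y)
  case (Eq t u)
  then show ?case using inst_tm_cong[of Y b b' t] inst_tm_cong[of Y b b' u] by simp
next
  case (Rel r ts)
  then show ?case by (simp add: inst_tm_cong[of Y b b'])
next
  case (Exists v \<phi>)
  have "inst (Y - {v}) b \<phi> = inst (Y - {v}) b' \<phi>"
    by (rule Exists.IH) (simp add: Exists.prems)
  then show ?case by simp
qed simp_all

lemma val_in_tuple:
  assumes "v \<in> set vs" "bs \<in> tuples N (map fst vs)"
  shows "val vs bs v \<in> set bs \<and> sort_of N (val vs bs v) = fst v"
  using assms
proof (induction vs arbitrary: bs)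
  case (Cons w vs)
  then obtain b cs where b: "bs = b # cs" "sort_of N b = fst w" "cs \<in> tuples N (map fst vs)"
    unfolding list.map tuples_Cons by blast
  show ?case
  proof (cases "v = w")
    case False
    then show ?thesis using Cons.IH[OF _ b(3)] Cons.prems(1) b(1) by simp
  qed (use b in simp)
qed simp

lemma inst_formula:
  assumes "\<phi> \<in> formulas N A (insert x (set ys))" "x \<notin> set ys" "bs \<in> tuples N (map fst ys)"
  shows "inst (set ys) (val ys bs) \<phi> \<in> formulas N (A \<union> set bs) {x}"
    and "sat N (\<lambda>_. a) (inst (set ys) (val ys bs) \<phi>) \<longleftrightarrow> sat N (val (x # ys) (a # bs)) \<phi>"
proof -
  have wf: "wf_fm N A \<phi>" and f: "fv \<phi> \<subseteq> insert x (set ys)"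
    using assms(1) by (simp_all add: formulas_def)
  have "wf_fm N (A \<union> set bs) (inst (set ys) (val ys bs) \<phi>)"
  proof (rule wf_fm_inst[OF wf])
    fix v assume "v \<in> set ys"
    then show "val ys bs v \<in> A \<union> set bs \<and> sort_of N (val ys bs v) = fst v"
      using val_in_tuple[OF _ assms(3)] by simp
  qed simp
  moreover have "fv (inst (set ys) (val ys bs) \<phi>) \<subseteq> {x}" using f by (auto simp: fv_inst)
  ultimately show "inst (set ys) (val ys bs) \<phi> \<in> formulas N (A \<union> set bs) {x}"
    by (simp add: formulas_def)
  show "sat N (\<lambda>_. a) (inst (set ys) (val ys bs) \<phi>) \<longleftrightarrow> sat N (val (x # ys) (a # bs)) \<phi>"
    unfolding sat_inst
  proof (rule sat_cong)
    fix v assume "v \<in> fv \<phi>"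
    then show "(if v \<in> set ys then val ys bs v else a) = val (x # ys) (a # bs) v"
      using f assms(2) by (cases "v = x") auto
  qed
qed

lemma dfn_single:
  "dfn N A [s] R \<longleftrightarrow>
     (\<exists>\<phi>\<in>formulas N A {(s, 0)}. \<forall>a. a \<in> univ N \<and> sort_of N a = s \<longrightarrow> (R [a] \<longleftrightarrow> sat N (\<lambda>_. a) \<phi>))"
proof
  assume "dfn N A [s] R"
  then obtain \<phi> where p: "\<phi> \<in> formulas N A (set [(s, 0)])"
    "\<And>as. as \<in> tuples N [s] \<Longrightarrow> R as \<longleftrightarrow> sat N (val [(s, 0)] as) \<phi>"
    by (rule dfnE[of _ _ _ _ "[(s, 0)]"]) simp_all
  have "R [a] \<longleftrightarrow> sat N (\<lambda>_. a) \<phi>" if "a \<in> univ N" "sort_of N a = s" for a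
    using p(2)[of "[a]"] sat_single[of \<phi> N A "(s, 0)" "val [(s, 0)] [a]" a] p(1) that by simp
  then show "\<exists>\<phi>\<in>formulas N A {(s, 0)}. \<forall>a. a \<in> univ N \<and> sort_of N a = s \<longrightarrow> (R [a] \<longleftrightarrow> sat N (\<lambda>_. a) \<phi>)"
    using p(1) by (intro bexI[of _ \<phi>]) simp_all
next
  assume "\<exists>\<phi>\<in>formulas N A {(s, 0)}. \<forall>a. a \<in> univ N \<and> sort_of N a = s \<longrightarrow> (R [a] \<longleftrightarrow> sat N (\<lambda>_. a) \<phi>)"
  then obtain \<phi> where p: "\<phi> \<in> formulas N A {(s, 0)}"
    "\<And>a. a \<in> univ N \<Longrightarrow> sort_of N a = s \<Longrightarrow> R [a] \<longleftrightarrow> sat N (\<lambda>_. a) \<phi>" by blast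
  show "dfn N A [s] R"
  proof (rule dfnI[of "[(s, 0)]" _ \<phi>])
    fix as assume "as \<in> tuples N [s]"
    then obtain a where "as = [a]" "a \<in> univ N" "sort_of N a = s"
      unfolding tuples_Cons tuples_Nil by blast
    then show "R as \<longleftrightarrow> sat N (val [(s, 0)] as) \<phi>"
      using p(2) sat_single[OF p(1), of "val [(s, 0)] [a]" a] by simp
  qed (use p(1) in simp_all)
qed

text \<open>Membership in the type of a definable set rather than of a formula. For a global type it
  does not matter which defining formula is tested, by \<open>in_type_formula\<close>.\<close>

definition in_type ::
  "('s, 'f, 'r, 'a) struct \<Rightarrow> 's \<Rightarrow> ('s, 'f, 'r, 'a) formula set \<Rightarrow> ('a list \<Rightarrow> bool) \<Rightarrow> bool" where
  "in_type N s p R \<longleftrightarrow>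
     (\<exists>\<phi>\<in>p. \<forall>a. a \<in> univ N \<and> sort_of N a = s \<longrightarrow> (R [a] \<longleftrightarrow> sat N (\<lambda>_. a) \<phi>))"

locale invariant_type = saturated_structure N \<kappa>
  for N :: "('s, 'f, 'r, 'a) struct" and \<kappa> :: "'k rel" +
  fixes s :: 's and p :: "('s, 'f, 'r, 'a) formula set" and A :: "'a set"
  assumes gt: "global_type N s p" and na: "non_algebraic N s p"
    and sm_A: "sm A" and inv: "invariant N s p A"
begin

abbreviation inp :: "('a list \<Rightarrow> bool) \<Rightarrow> bool" where "inp \<equiv> in_type N s p"

definition rl :: "'a set \<Rightarrow> 'a \<Rightarrow> bool" where
  "rl D a \<longleftrightarrow> realizes N s (restrict_type N p D) a"

lemma s_sort: "s \<in> sorts N" using gt by (simp add: global_type_def)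

lemma p_formulas: "p \<subseteq> formulas N (univ N) {(s, 0)}"
  using gt by (simp add: global_type_def complete_type_def)

lemma p_decides: "\<phi> \<in> formulas N (univ N) {(s, 0)} \<Longrightarrow> \<phi> \<in> p \<or> Neg \<phi> \<in> p"
  using gt by (simp add: global_type_def complete_type_def)

lemma p_fin_sat:
  assumes "finite \<Delta>" "\<Delta> \<subseteq> p"
  shows "\<exists>a. a \<in> univ N \<and> sort_of N a = s \<and> (\<forall>\<phi>\<in>\<Delta>. sat N (\<lambda>_. a) \<phi>)"
proof -
  obtain e where e: "assignment N {(s, 0)} e" "\<forall>\<phi>\<in>\<Delta>. sat N e \<phi>"
    using gt assms unfolding global_type_def complete_type_def by blast
  have "\<forall>\<phi>\<in>\<Delta>. sat N (\<lambda>_. e (s, 0)) \<phi>"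
    using e(2) assms(2) p_formulas sat_single[of _ N "univ N" "(s, 0)" e] by blast
  then show ?thesis using e(1) unfolding assignment_def by (intro exI[of _ "e (s, 0)"]) simp
qed

lemma in_type_formula:
  assumes "\<phi> \<in> formulas N (univ N) {(s, 0)}"
    "\<And>a. a \<in> univ N \<Longrightarrow> sort_of N a = s \<Longrightarrow> R [a] \<longleftrightarrow> sat N (\<lambda>_. a) \<phi>"
  shows "inp R \<longleftrightarrow> \<phi> \<in> p"
proof
  assume "inp R"
  then obtain \<psi> where q: "\<psi> \<in> p" "\<And>a. a \<in> univ N \<Longrightarrow> sort_of N a = s \<Longrightarrow> R [a] \<longleftrightarrow> sat N (\<lambda>_. a) \<psi>"
    unfolding in_type_def by blast
  show "\<phi> \<in> p"
  proof (rule ccontr)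
    assume "\<phi> \<notin> p"
    then have "Neg \<phi> \<in> p" using p_decides[OF assms(1)] by simp
    then obtain a where "a \<in> univ N" "sort_of N a = s" "\<forall>\<theta>\<in>{\<psi>, Neg \<phi>}. sat N (\<lambda>_. a) \<theta>"
      using p_fin_sat[of "{\<psi>, Neg \<phi>}"] q(1) by auto
    then show False using q(2) assms(2) by simp
  qed
next
  assume "\<phi> \<in> p"
  then show "inp R" unfolding in_type_def using assms(2) by blast
qed

lemma in_type_neg:
  assumes "dfn N (univ N) [s] R"
  shows "inp (\<lambda>as. \<not> R as) \<longleftrightarrow> \<not> inp R"
proof -
  obtain \<phi> where p: "\<phi> \<in> formulas N (univ N) {(s, 0)}"
    "\<And>a. a \<in> univ N \<Longrightarrow> sort_of N a = s \<Longrightarrow> R [a] \<longleftrightarrow> sat N (\<lambda>_. a) \<phi>"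
    using assms unfolding dfn_single by blast
  have n: "Neg \<phi> \<in> formulas N (univ N) {(s, 0)}" using p(1) by (simp add: formulas_def)
  have "inp R \<longleftrightarrow> \<phi> \<in> p" by (rule in_type_formula[OF p])
  moreover have "inp (\<lambda>as. \<not> R as) \<longleftrightarrow> Neg \<phi> \<in> p"
    by (rule in_type_formula[OF n]) (simp add: p(2))
  moreover have "\<not> (\<phi> \<in> p \<and> Neg \<phi> \<in> p)"
    using p_fin_sat[of "{\<phi>, Neg \<phi>}"] by auto
  ultimately show ?thesis using p_decides[OF p(1)] by blast
qed

lemma in_type_cong:
  "(\<And>a. a \<in> univ N \<Longrightarrow> sort_of N a = s \<Longrightarrow> R [a] \<longleftrightarrow> S [a]) \<Longrightarrow> inp R \<longleftrightarrow> inp S"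
  unfolding in_type_def by (simp cong: conj_cong)

lemma in_type_finite:
  assumes "finite F" "\<And>R. R \<in> F \<Longrightarrow> inp R"
  shows "\<exists>as\<in>tuples N [s]. \<forall>R\<in>F. R as"
proof -
  have "\<forall>R\<in>F. \<exists>\<phi>. \<phi> \<in> p \<and> (\<forall>a. a \<in> univ N \<and> sort_of N a = s \<longrightarrow> (R [a] \<longleftrightarrow> sat N (\<lambda>_. a) \<phi>))"
    using assms(2) unfolding in_type_def by blast
  then obtain f where f: "\<forall>R\<in>F. f R \<in> p \<and>
    (\<forall>a. a \<in> univ N \<and> sort_of N a = s \<longrightarrow> (R [a] \<longleftrightarrow> sat N (\<lambda>_. a) (f R)))"
    by (rule bchoice[THEN exE])
  then have "f ` F \<subseteq> p" by blast
  then obtain a where a: "a \<in> univ N" "sort_of N a = s" "\<forall>\<phi>\<in>f ` F. sat N (\<lambda>_. a) \<phi>"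
    using p_fin_sat[of "f ` F"] assms(1) by blast
  then have "\<forall>R\<in>F. R [a]" using f by blast
  then show ?thesis using a by (intro bexI[of _ "[a]"]) simp_all
qed

lemma rl_iff:
  assumes "D \<subseteq> univ N"
  shows "rl D a \<longleftrightarrow> a \<in> univ N \<and> sort_of N a = s \<and> (\<forall>R. dfn N D [s] R \<longrightarrow> inp R \<longrightarrow> R [a])"
proof
  assume a: "rl D a"
  then have a': "a \<in> univ N" "sort_of N a = s" by (simp_all add: rl_def realizes_def)
  have "R [a]" if R: "dfn N D [s] R" "inp R" for R
  proof -
    obtain \<phi> where p: "\<phi> \<in> formulas N D {(s, 0)}"
      "\<And>a. a \<in> univ N \<Longrightarrow> sort_of N a = s \<Longrightarrow> R [a] \<longleftrightarrow> sat N (\<lambda>_. a) \<phi>"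
      using R(1) unfolding dfn_single by blast
    have "\<phi> \<in> formulas N (univ N) {(s, 0)}" using p(1) formulas_mono[OF assms subset_refl] by blast
    then have "\<phi> \<in> p" using in_type_formula[of \<phi> R] p(2) R(2) by blast
    then have "\<phi> \<in> restrict_type N p D" using p(1) by (simp add: restrict_type_def formulas_def)
    then have "sat N (\<lambda>_. a) \<phi>" using a by (simp add: rl_def realizes_def)
    then show ?thesis using p(2) a' by blast
  qed
  then show "a \<in> univ N \<and> sort_of N a = s \<and> (\<forall>R. dfn N D [s] R \<longrightarrow> inp R \<longrightarrow> R [a])"
    using a' by blast
next
  assume a: "a \<in> univ N \<and> sort_of N a = s \<and> (\<forall>R. dfn N D [s] R \<longrightarrow> inp R \<longrightarrow> R [a])"
  have "sat N (\<lambda>_. a) \<phi>" if f: "\<phi> \<in> restrict_type N p D" for \<phi>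
  proof -
    have p: "\<phi> \<in> p" "wf_fm N D \<phi>" using f by (simp_all add: restrict_type_def)
    then have "\<phi> \<in> formulas N D {(s, 0)}" using p_formulas by (auto simp: formulas_def)
    then have "dfn N D [s] (\<lambda>as. sat N (\<lambda>_. hd as) \<phi>)" unfolding dfn_single by (intro bexI[of _ \<phi>]) simp_all
    moreover have "inp (\<lambda>as. sat N (\<lambda>_. hd as) \<phi>)"
      unfolding in_type_def using p(1) by (intro bexI[of _ \<phi>]) simp_all
    ultimately have "(\<lambda>as. sat N (\<lambda>_. hd as) \<phi>) [a]" using a by blast
    then show ?thesis by simp
  qed
  then show "rl D a" using a by (simp add: rl_def realizes_def)
qed

lemma rl_univ: "rl D a \<Longrightarrow> a \<in> univ N" by (simp add: rl_def realizes_def)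

lemma rl_sort: "rl D a \<Longrightarrow> sort_of N a = s" by (simp add: rl_def realizes_def)

lemma rl_tuple: "rl D a \<Longrightarrow> [a] \<in> tuples N [s]" by (simp add: rl_univ rl_sort)

lemma rl_mono: "rl D a \<Longrightarrow> E \<subseteq> D \<Longrightarrow> rl E a"
  unfolding rl_def realizes_def restrict_type_def using wf_fm_mono by blast

lemma rl_D:
  assumes "rl D a" "dfn N D [s] R" "D \<subseteq> univ N"
  shows "R [a] \<longleftrightarrow> inp R"
proof (cases "inp R")
  case True
  then show ?thesis using assms rl_iff[OF assms(3), of a] by blast
next
  case False
  then have "inp (\<lambda>as. \<not> R as)" using in_type_neg[OF dfn_mono[OF assms(2,3)]] by simp
  then have "(\<lambda>as. \<not> R as) [a]" using assms(1) dfn_neg[OF assms(2)] rl_iff[OF assms(3), of a] by blast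
  then show ?thesis using False by simp
qed

lemma rl_ex: "sm D \<Longrightarrow> \<exists>a. rl D a"
proof -
  assume D: "sm D"
  let ?R = "{R. dfn N D [s] R \<and> inp R}"
  have "\<exists>as\<in>tuples N [s]. \<forall>R\<in>?R. R as"
  proof (rule realize_one[OF D s_sort])
    show "dfn N D [s] R" if "R \<in> ?R" for R using that by simp
    show "\<exists>as\<in>tuples N [s]. \<forall>R\<in>F. R as" if "finite F" "F \<subseteq> ?R" for F
      by (rule in_type_finite) (use that in blast)+
  qed
  then obtain as where as: "as \<in> tuples N [s]" "\<forall>R\<in>?R. R as" by (rule bexE)
  from as(1) obtain a where a: "as = [a]" "a \<in> univ N" "sort_of N a = s" 
    unfolding tuples_Cons tuples_Nil by blast
  have "R [a]" if "dfn N D [s] R" "inp R" for R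
    using bspec[OF as(2), of R] that a(1) by simp
  then have "rl D a" unfolding rl_iff[OF sm_univ[OF D]] using a by blast
  then show ?thesis by blast
qed

text \<open>Translates \<open>invariant\<close> into the language of \<open>EQ\<close>. The
  variables \<open>ys\<close> that stand for the parameters are chosen different from
  \<open>(s, 0)\<close>, as \<open>invariant\<close> demands.\<close>

lemma inv_EQ_base:
  assumes "EQ N A bs bs'" "bs \<in> tuples N ss" "dfn N A (s # ss) R"
  shows "inp (\<lambda>xs. R (xs @ bs)) \<longleftrightarrow> inp (\<lambda>xs. R (xs @ bs'))"
proof -
  have b': "bs' \<in> tuples N ss" using EQ_tuples[OF assms(1)] assms(2) by simp
  obtain ys :: "('s \<times> nat) list" where y: "distinct ys" "map fst ys = ss" "set ys \<inter> {(s, 0)} = {}"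
    using ex_fresh_vars[of "{(s, 0)}" ss] by auto
  then have d: "distinct ((s, 0) # ys)" and n: "(s, 0) \<notin> set ys" by auto
  obtain \<phi> where p: "\<phi> \<in> formulas N A (set ((s, 0) # ys))"
    "\<And>as. as \<in> tuples N (s # ss) \<Longrightarrow> R as \<longleftrightarrow> sat N (val ((s, 0) # ys) as) \<phi>"
    by (rule dfnE[OF assms(3) d]) (simp add: y, rule that)
  have p1: "\<phi> \<in> formulas N A (insert (s, 0) (set ys))" using p(1) by simp
  have A: "A \<subseteq> univ N" using sm_A by (rule sm_univ)
  have inst: "inp (\<lambda>xs. R (xs @ cs)) \<longleftrightarrow> inst (set ys) (val ys cs) \<phi> \<in> p" if c: "cs \<in> tuples N ss" for cs
  proof (rule in_type_formula)
    have c': "cs \<in> tuples N (map fst ys)" using c y(2) by simp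
    show "inst (set ys) (val ys cs) \<phi> \<in> formulas N (univ N) {(s, 0)}"
      using inst_formula(1)[OF p1 n c'] formulas_mono[of "A \<union> set cs" "univ N"] A tuples_set[OF c] by blast
    fix a assume "a \<in> univ N" "sort_of N a = s"
    then have "[a] @ cs \<in> tuples N (s # ss)" using c by simp
    then have "R ([a] @ cs) \<longleftrightarrow> sat N (val ((s, 0) # ys) ([a] @ cs)) \<phi>" by (rule p(2))
    then show "R ([a] @ cs) \<longleftrightarrow> sat N (\<lambda>_. a) (inst (set ys) (val ys cs) \<phi>)"
      using inst_formula(2)[OF p1 n c', of a] by (simp only: append_Cons append_Nil)
  qed
  have e: "equiv_over N A (set ys) (val ys bs) (val ys bs')"
    unfolding equiv_over_def
  proof
    fix \<psi> assume "\<psi> \<in> formulas N A (set ys)"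
    then have "dfn N A ss (\<lambda>as. sat N (val ys as) \<psi>)" by (intro dfnI[OF y(1,2)]) simp_all
    from EQ_D[OF assms(1,2) this] show "sat N (val ys bs) \<psi> \<longleftrightarrow> sat N (val ys bs') \<psi>" .
  qed
  have "assignment N (set ys) (val ys bs)" "assignment N (set ys) (val ys bs')"
    using val_assignment[OF y(1)] assms(2) b' y(2) by blast+
  then have "inst (set ys) (val ys bs) \<phi> \<in> p \<longleftrightarrow> inst (set ys) (val ys bs') \<phi> \<in> p"
    using inv e n p1 unfolding invariant_def by blast
  then show ?thesis using inst[OF assms(2)] inst[OF b'] by simp
qed

text \<open>Passage from the base \<open>A\<close> to a larger base: the finitely many parameters of
  \<open>R\<close> from \<open>D\<close> are listed as \<open>cs\<close> and appended to both
  tuples, which remain equivalent over \<open>A\<close>.\<close>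

lemma inv_EQ:
  assumes "A \<subseteq> D" "D \<subseteq> univ N" "EQ N D bs bs'" "bs \<in> tuples N ss" "dfn N D (s # ss) R"
  shows "inp (\<lambda>xs. R (xs @ bs)) \<longleftrightarrow> inp (\<lambda>xs. R (xs @ bs'))"
proof -
  have b': "bs' \<in> tuples N ss" using EQ_tuples[OF assms(3)] assms(4) by simp
  obtain F where F: "F \<subseteq> D" "finite F" "dfn N F (s # ss) R"
    using dfn_finite_params[OF assms(5)] by blast
  obtain cs where cs: "set cs = F" using finite_list[OF F(2)] by blast
  have cu: "set cs \<subseteq> univ N" using cs F(1) assms(2) by simp
  define ts where "ts = map (sort_of N) cs"
  have ct: "cs \<in> tuples N ts" using cu by (simp add: ts_def tuples_def)
  have "dfn N (A \<union> set cs) (s # ss) R" by (rule dfn_mono[OF F(3)]) (simp add: cs)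
  then obtain S where S: "dfn N A ((s # ss) @ ts) S" "\<forall>as\<in>tuples N (s # ss). R as \<longleftrightarrow> S (as @ cs)"
    using dfn_abs[OF _ ct tuples_sorts_subset[OF ct]] by blast
  have e: "EQ N A (bs @ cs) (bs' @ cs)"
    by (rule EQ_from_params[OF EQ_mono[OF assms(3)] cu]) (use cs F(1) assms(1) in simp)
  have "inp (\<lambda>xs. S (xs @ bs @ cs)) \<longleftrightarrow> inp (\<lambda>xs. S (xs @ bs' @ cs))"
    by (rule inv_EQ_base[OF e append_in_tuples[OF assms(4) ct]]) (use S(1) in simp)
  moreover have "inp (\<lambda>xs. R (xs @ ds)) \<longleftrightarrow> inp (\<lambda>xs. S (xs @ ds @ cs))" if d: "ds \<in> tuples N ss" for ds
  proof (rule in_type_cong)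
    fix a assume "a \<in> univ N" "sort_of N a = s"
    then have "[a] @ ds \<in> tuples N (s # ss)" using d by simp
    with S(2) have "R ([a] @ ds) \<longleftrightarrow> S (([a] @ ds) @ cs)" by (rule bspec)
    then show "R ([a] @ ds) \<longleftrightarrow> S ([a] @ ds @ cs)" by simp
  qed
  ultimately show ?thesis using assms(4) b' by simp
qed

text \<open>By invariance the type of \<open>a\<close> over \<open>D\<close> and \<open>bs\<close>
  is determined by the type of \<open>bs\<close> over \<open>D\<close>, and hence so is the type of
  the longer tuple.\<close>

lemma EQ_Cons_rl:
  assumes "A \<subseteq> D" "D \<subseteq> univ N" "EQ N D bs bs'" "rl (D \<union> set bs) a" "rl (D \<union> set bs') a'"
  shows "EQ N D (a # bs) (a' # bs')"
proof -
  obtain ss where s: "bs \<in> tuples N ss" "bs' \<in> tuples N ss" using assms(3) EQ_def by blast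
  show ?thesis
  proof (rule EQ_I)
    show "a # bs \<in> tuples N (s # ss)" "a' # bs' \<in> tuples N (s # ss)"
      using s rl_univ[OF assms(4)] rl_univ[OF assms(5)] rl_sort[OF assms(4)] rl_sort[OF assms(5)] by simp_all
    fix R assume R: "dfn N D (s # ss) R" "R (a # bs)"
    then have R': "dfn N D ([s] @ ss) R" by simp
    have "R ([a] @ bs) \<longleftrightarrow> inp (\<lambda>xs. R (xs @ bs))"
      by (rule rl_D[OF assms(4) dfn_inst[OF R' s(1)]]) (use assms(2) tuples_set[OF s(1)] in simp)
    moreover have "R ([a'] @ bs') \<longleftrightarrow> inp (\<lambda>xs. R (xs @ bs'))"
      by (rule rl_D[OF assms(5) dfn_inst[OF R' s(2)]]) (use assms(2) tuples_set[OF s(2)] in simp)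
    ultimately show "R (a' # bs')" using inv_EQ[OF assms(1-3) s(1) R(1)] R(2) by simp
  qed
qed

text \<open>Whether \<open>a\<close> realizes the type over \<open>D\<close> and \<open>bs\<close>
  can be read off from the type of \<open>a # bs\<close> over \<open>D\<close>: a relation with
  parameters \<open>bs'\<close> is abstracted by \<open>dfn_abs\<close>, and invariance lets
  \<open>bs\<close> be inserted instead.\<close>

lemma rl_EQ:
  assumes "A \<subseteq> D" "D \<subseteq> univ N" "EQ N D (a # bs) (a' # bs')" "rl (D \<union> set bs) a"
  shows "rl (D \<union> set bs') a'"
proof -
  obtain ts where t: "a # bs \<in> tuples N ts" "a' # bs' \<in> tuples N ts" using assms(3) EQ_def by blast
  have sa: "sort_of N a = s" using assms(4) by (rule rl_sort)
  obtain ss where s: "ts = s # ss" "bs \<in> tuples N ss" "bs' \<in> tuples N ss" "a' \<in> univ N" "sort_of N a' = s"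
    using t sa by (cases ts) (auto simp: tuples_def)
  have e: "EQ N D bs bs'" using EQ_drop[of D "[a]" bs "[a']" bs'] assms(3) by simp
  have u: "D \<union> set bs \<subseteq> univ N" "D \<union> set bs' \<subseteq> univ N"
    using assms(2) tuples_set[OF s(2)] tuples_set[OF s(3)] by simp_all
  show ?thesis
    unfolding rl_iff[OF u(2)]
  proof (intro conjI allI impI s(4,5))
    fix R assume R: "dfn N (D \<union> set bs') [s] R" "inp R"
    obtain S where S: "dfn N D ([s] @ ss) S" "\<forall>as\<in>tuples N [s]. R as \<longleftrightarrow> S (as @ bs')"
      using dfn_abs[OF R(1) s(3) tuples_sorts_subset[OF s(3)]] by blast
    have S': "dfn N D (s # ss) S" using S(1) by simp
    have "inp R \<longleftrightarrow> inp (\<lambda>xs. S (xs @ bs'))" by (rule in_type_cong) (use S(2) in simp)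
    then have "inp (\<lambda>xs. S (xs @ bs))" using R(2) inv_EQ[OF assms(1,2) e s(2) S'] by simp
    then have "S ([a] @ bs)" using rl_D[OF assms(4) dfn_inst[OF S(1) s(2)] u(1)] by simp
    then have "S (a' # bs')" using EQ_D[OF assms(3) _ S'] t(1) s(1) by simp
    then show "R [a']" using S(2) s(4,5) by simp
  qed
qed

text \<open>The formula \<open>x = b\<close> has only one solution, so a non-algebraic type omits
  it.\<close>

lemma rl_neq:
  assumes "rl D a" "b \<in> D" "D \<subseteq> univ N"
  shows "a \<noteq> b"
proof
  assume ab: "a = b"
  have d: "dfn N D [s] (\<lambda>as. as ! 0 = b)"
    by (rule dfn_eq_param[OF s_sort assms(2)]) (use ab rl_sort[OF assms(1)] in simp)
  have "(\<lambda>as. as ! 0 = b) [a]" using ab by simp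
  then have "inp (\<lambda>as. as ! 0 = b)" using rl_D[OF assms(1) d assms(3)] by simp
  then obtain \<phi> where p: "\<phi> \<in> p" "\<And>c. c \<in> univ N \<Longrightarrow> sort_of N c = s \<Longrightarrow> c = b \<longleftrightarrow> sat N (\<lambda>_. c) \<phi>"
    unfolding in_type_def by auto
  have "{c. realizes N s {\<phi>} c} \<subseteq> {b}" using p(2) by (auto simp: realizes_def)
  then show False using na p(1) finite_subset unfolding non_algebraic_def by blast
qed

text \<open>Serves to place several types over one common base; the reason is
  \<open>inv_EQ\<close>.\<close>

lemma invariant_mono:
  assumes "A \<subseteq> C" "sm C"
  shows "invariant_type N \<kappa> s p C"
proof unfold_locales
  show "invariant N s p C"
    unfolding invariant_def
  proof (intro allI impI ballI, elim conjE)
    fix Y b1 b2 \<phi>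
    assume Y: "finite Y" "(s, 0) \<notin> Y" and b: "assignment N Y b1" "assignment N Y b2"
      and e: "equiv_over N C Y b1 b2" and f: "\<phi> \<in> formulas N C (insert (s, 0) Y)"
    obtain ys where y: "set ys = Y" "distinct ys" using finite_distinct_list[OF Y(1)] by blast
    let ?ss = "map fst ys"
    have n: "(s, 0) \<notin> set ys" using Y(2) y(1) by simp
    have t: "map b1 ys \<in> tuples N ?ss" "map b2 ys \<in> tuples N ?ss"
      using assignment_tuple b y(1) by blast+
    have E: "EQ N C (map b1 ys) (map b2 ys)"
    proof (rule EQ_I[OF t])
      fix R assume R: "dfn N C ?ss R" "R (map b1 ys)"
      obtain \<psi> where q: "\<psi> \<in> formulas N C (set ys)"
        "\<And>as. as \<in> tuples N ?ss \<Longrightarrow> R as \<longleftrightarrow> sat N (val ys as) \<psi>"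
        by (rule dfnE[OF R(1) y(2) refl]) (rule that)
      have "R (map b ys) \<longleftrightarrow> sat N b \<psi>" if "map b ys \<in> tuples N ?ss" for b
      proof -
        have "sat N (val ys (map b ys)) \<psi> \<longleftrightarrow> sat N b \<psi>"
          by (rule sat_cong, rule val_map) (use q(1) in \<open>auto simp: formulas_def\<close>)
        then show ?thesis using q(2)[OF that] by simp
      qed
      then show "R (map b2 ys)" using t e R(2) q(1) y(1) unfolding equiv_over_def by blast
    qed
    let ?R = "\<lambda>as. sat N (val ((s, 0) # ys) as) \<phi>"
    have f': "\<phi> \<in> formulas N C (insert (s, 0) (set ys))" using f y(1) by simp
    have C: "C \<subseteq> univ N" using assms(2) by (rule sm_univ)
    have d: "dfn N C (s # ?ss) ?R"
      by (rule dfnI[of "(s, 0) # ys" _ \<phi>]) (use f' n y(2) in simp_all)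
    have "inp (\<lambda>xs. ?R (xs @ map b ys)) \<longleftrightarrow> inst Y b \<phi> \<in> p" if "map b ys \<in> tuples N ?ss" for b
    proof (rule in_type_formula)
      have i: "inst (set ys) (val ys (map b ys)) \<phi> = inst Y b \<phi>"
        unfolding y(1) by (rule inst_cong, rule val_map) (simp add: y(1))
      show "inst Y b \<phi> \<in> formulas N (univ N) {(s, 0)}"
        using inst_formula(1)[OF f' n that] formulas_mono[of "C \<union> set (map b ys)" "univ N"] C
          tuples_set[OF that] unfolding i by blast
      show "?R ([a] @ map b ys) \<longleftrightarrow> sat N (\<lambda>_. a) (inst Y b \<phi>)" for a
        using inst_formula(2)[OF f' n that, of a] unfolding i by (simp only: append_Cons append_Nil)
    qed
    then show "inst Y b1 \<phi> \<in> p \<longleftrightarrow> inst Y b2 \<phi> \<in> p"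
      using inv_EQ[OF assms(1) C E t(1) d] t by simp
  qed
qed (use gt na assms in simp_all)

text \<open>A finite Morley sequence, listed with the last element first.\<close>

primrec mor :: "'a set \<Rightarrow> 'a list \<Rightarrow> bool" where
  "mor D [] \<longleftrightarrow> True"
| "mor D (a # as) \<longleftrightarrow> mor D as \<and> rl (D \<union> set as) a"

lemma mor_rl: "mor D as \<Longrightarrow> a \<in> set as \<Longrightarrow> rl D a"
  by (induction as) (auto intro: rl_mono)

lemma mor_univ: "mor D as \<Longrightarrow> set as \<subseteq> univ N"
  using mor_rl rl_univ by blast

lemma mor_mono: "mor D as \<Longrightarrow> E \<subseteq> D \<Longrightarrow> mor E as"
  by (induction as) (auto intro: rl_mono)

lemma mor_append: "mor D bs \<Longrightarrow> mor (D \<union> set bs) as \<Longrightarrow> mor D (as @ bs)"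
  by (induction as) (simp_all add: Un_ac)

text \<open>Iterates \<open>EQ_Cons_rl\<close>: the type of each new term over the base and the
  earlier terms is determined by the type of the earlier ones.\<close>

lemma mor_EQ:
  assumes "A \<subseteq> D" "D \<subseteq> univ N" "mor D as" "mor D bs" "length as = length bs"
  shows "EQ N D as bs"
  using assms(5,3,4)
proof (induction as bs rule: list_induct2)
  case Nil
  then show ?case by (simp add: EQ_refl)
next
  case (Cons a as b bs)
  then show ?case using EQ_Cons_rl[OF assms(1,2), of as bs a b] by simp
qed

lemma mor_cong:
  assumes "A \<subseteq> D" "D \<subseteq> univ N" "mor D as" "EQ N D as bs"
  shows "mor D bs"
proof -
  have "length as = length bs" using assms(4) by (rule EQ_length)
  then show ?thesis using assms(3,4)
  proof (induction as bs rule: list_induct2)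
    case (Cons a as b bs)
    have "EQ N D as bs" using EQ_drop[of D "[a]" as "[b]" bs] Cons.prems(2) by simp
    then show ?case using Cons.IH Cons.prems rl_EQ[OF assms(1,2) Cons.prems(2)] by simp
  qed simp
qed

end

text \<open>The entailment in \<open>regular_over\<close> is kept in its consequence for
  realizations: a realization \<open>c\<close> of \<open>p\<close> over \<open>B\<close> remains one
  over \<open>B\<close> and \<open>a\<close>.\<close>

locale regular_type = invariant_type N \<kappa> s p A
  for N :: "('s, 'f, 'r, 'a) struct" and \<kappa> :: "'k rel" and s p A +
  assumes regularity: "sm B \<Longrightarrow> A \<subseteq> B \<Longrightarrow> rl A a \<Longrightarrow> \<not> rl B a \<Longrightarrow> rl B c \<Longrightarrow> rl (insert a B) c"
begin

text \<open>Failure to realize \<open>p\<close> persists when the base grows. Regularity therefore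
  applies at every term, with the preceding terms added to \<open>B\<close>.\<close>

lemma mor_regular:
  assumes "sm B" "A \<subseteq> B" "rl A a" "\<not> rl B a" "mor B as"
  shows "mor (insert a B) as"
  using assms(5)
proof (induction as)
  case (Cons c as)
  have u: "sm (B \<union> set as)" using assms(1) mor_univ[of B as] Cons.prems by (simp add: sm_Un sm_finite)
  have "\<not> rl (B \<union> set as) a" using assms(4) rl_mono by blast
  then have "rl (insert a (B \<union> set as)) c"
    using regularity[OF u _ assms(3)] assms(2) Cons.prems by auto
  then show ?case using Cons by simp
qed simp

lemma regular_mono:
  assumes "A \<subseteq> C" "sm C"
  shows "regular_type N \<kappa> s p C"
proof -
  interpret C: invariant_type N \<kappa> s p C by (rule invariant_mono[OF assms])
  show ?thesis
  proof unfold_locales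
    fix B a c assume h: "sm B" "C \<subseteq> B" "rl C a" "\<not> rl B a" "rl B c"
    have "A \<subseteq> B" using h(2) assms(1) by simp
    then show "rl (insert a B) c"
      by (rule regularity[OF h(1) _ rl_mono[OF h(3) assms(1)] h(4,5)])
  qed
qed

end

lemma (in saturated_structure) regular_over_locale:
  assumes "regular_over \<kappa> N s p A"
  shows "regular_type N \<kappa> s p A"
proof -
  interpret invariant_type N \<kappa> s p A
    by unfold_locales (use assms in \<open>simp_all add: regular_over_def\<close>)
  show ?thesis
  proof unfold_locales
    fix B a c assume h: "sm B" "A \<subseteq> B" "rl A a" "\<not> rl B a" "rl B c"
    then have e: "\<forall>\<phi>\<in>restrict_type N p (insert a B). entails N s (restrict_type N p B) \<phi>"
      using assms unfolding regular_over_def rl_def by blast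
    show "rl (insert a B) c"
      using e h(5) unfolding rl_def realizes_def entails_def by blast
  qed
qed

section \<open>Generic stability\<close>

definition gs_over ::
  "('s, 'f, 'r, 'a) struct \<Rightarrow> 's \<Rightarrow> ('s, 'f, 'r, 'a) formula set \<Rightarrow> 'a set \<Rightarrow> bool" where
  "gs_over N s p A \<longleftrightarrow>
     (\<forall>(r :: 'a rel) a. Well_order r \<and> infinite (Field r) \<and> morley_sequence N s p A r a \<longrightarrow>
        (\<forall>\<phi>\<in>formulas N (univ N) {(s, 0)}.
           finite {i \<in> Field r. sat N (\<lambda>_. a i) \<phi>} \<or>
           finite {i \<in> Field r. \<not> sat N (\<lambda>_. a i) \<phi>}))"

lemma realizes_restrict_mono:
  "realizes N s (restrict_type N p D) a \<Longrightarrow> E \<subseteq> D \<Longrightarrow> realizes N s (restrict_type N p E) a"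
  unfolding realizes_def restrict_type_def using wf_fm_mono by blast

text \<open>A Morley sequence over \<open>C\<close> is also one over \<open>A\<close>, so over
  \<open>C\<close> there are fewer sequences to test.\<close>

lemma gs_over_mono:
  assumes "gs_over N s p A" "A \<subseteq> C"
  shows "gs_over N s p C"
proof -
  have "morley_sequence N s p A r a" if "morley_sequence N s p C r a" for r :: "'d rel" and a
    using that realizes_restrict_mono assms(2) unfolding morley_sequence_def by (metis Un_mono subset_refl)
  then show ?thesis using assms(1) unfolding gs_over_def by blast
qed

definition omega_plus_omega :: "(bool \<times> nat) rel" where
  "omega_plus_omega = {(x, y). fst x < fst y \<or> fst x = fst y \<and> snd x \<le> snd y}"

lemma Field_omega_plus_omega: "Field omega_plus_omega = UNIV"
  unfolding omega_plus_omega_def Field_def by auto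

lemma Well_order_omega_plus_omega: "Well_order omega_plus_omega"
proof -
  have "omega_plus_omega - Id \<subseteq> inv_image (less_than <*lex*> less_than) (\<lambda>x. (if fst x then 1 else 0, snd x))"
    unfolding omega_plus_omega_def by auto
  then have "wf (omega_plus_omega - Id)"
    by (rule wf_subset[rotated]) (intro wf_inv_image wf_lex_prod wf_less_than)
  moreover have "refl_on UNIV omega_plus_omega" "trans omega_plus_omega" "antisym omega_plus_omega"
    "total_on UNIV omega_plus_omega"
    unfolding omega_plus_omega_def refl_on_def trans_def antisym_def total_on_def by auto
  ultimately show ?thesis
    by (simp add: Field_omega_plus_omega well_order_on_def linear_order_on_def partial_order_on_def preorder_on_def)
qed

text \<open>\<open>e i\<close> is the least element of \<open>S\<close> not chosen before. This
  reduces Morley sequences of arbitrary order type to sequences indexed by the naturals.\<close>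

lemma ex_increasing_sequence:
  fixes r :: "'i rel"
  assumes "Well_order r" "infinite S" "S \<subseteq> Field r"
  shows "\<exists>e :: nat \<Rightarrow> 'i. (\<forall>i. e i \<in> S) \<and> (\<forall>i j. j < i \<longrightarrow> e j \<in> underS r (e i))"
proof -
  have wf: "wf (r - Id)" and tot: "total_on (Field r) r" and re: "refl_on (Field r) r"
    using assms(1) unfolding well_order_on_def linear_order_on_def partial_order_on_def preorder_on_def
    by auto
  let ?P = "\<lambda>f (i::nat) x. x \<in> S - f ` {..<i} \<and> (\<forall>y\<in>S - f ` {..<i}. (x, y) \<in> r)"
  have "\<exists>e. \<forall>i. ?P e i (e i)"
  proof (rule dependent_wellorder_choice)
    fix x and f g :: "nat \<Rightarrow> 'i" and i :: nat assume "\<And>j. j < i \<Longrightarrow> f j = g j"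
    then have "f ` {..<i} = g ` {..<i}" by auto
    then show "?P f i x \<longleftrightarrow> ?P g i x" by simp
  next
    fix i :: nat and f :: "nat \<Rightarrow> 'i"
    have "infinite (S - f ` {..<i})" using assms(2) by simp
    then have "S - f ` {..<i} \<noteq> {}" by (metis finite.emptyI)
    then obtain y where "y \<in> S - f ` {..<i}" by blast
    from wfE_min[OF wf this] obtain x where x: "x \<in> S - f ` {..<i}"
      "\<And>y. (y, x) \<in> r - Id \<Longrightarrow> y \<notin> S - f ` {..<i}" by blast
    have "(x, y) \<in> r" if y: "y \<in> S - f ` {..<i}" for y
    proof (cases "x = y")
      case True
      then show ?thesis using re y assms(3) by (auto simp: refl_on_def)
    next
      case False
      then have "(y, x) \<notin> r" using x(2)[of y] y by blast
      then show ?thesis using tot False x(1) y assms(3) unfolding total_on_def by blast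
    qed
    then show "\<exists>x. ?P f i x" using x(1) by blast
  qed
  then obtain e where e: "\<And>i. ?P e i (e i)" by blast
  have "e j \<in> underS r (e i)" if "j < i" for i j
  proof -
    have "e i \<in> S - e ` {..<j}" "e i \<noteq> e j" using e[of i] that by auto
    then show ?thesis using e[of j] by (auto simp: underS_def)
  qed
  then show ?thesis using e by blast
qed

context invariant_type
begin

lemma ex_morley_nat:
  assumes "sm D"
  shows "\<exists>a. \<forall>i::nat. rl (D \<union> a ` {..<i}) (a i)"
proof (rule dependent_wellorder_choice)
  fix x and f g :: "nat \<Rightarrow> 'a" and i :: nat assume "\<And>j. j < i \<Longrightarrow> f j = g j"
  then have "f ` {..<i} = g ` {..<i}" by auto
  then show "rl (D \<union> f ` {..<i}) x \<longleftrightarrow> rl (D \<union> g ` {..<i}) x" by simp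
next
  fix i :: nat and f :: "nat \<Rightarrow> 'a" assume "\<And>j. j < i \<Longrightarrow> rl (D \<union> f ` {..<j}) (f j)"
  then have "f ` {..<i} \<subseteq> univ N" using rl_univ by blast
  then show "\<exists>x. rl (D \<union> f ` {..<i}) x" by (intro rl_ex sm_Un[OF assms] sm_finite) simp_all
qed

lemma morley_nat_inj:
  assumes "\<And>i::nat. rl (D \<union> a ` {..<i}) (a i)" "D \<subseteq> univ N"
  shows "inj a"
proof -
  have "a i \<noteq> a j" if "j < i" for i j
  proof (rule rl_neq[OF assms(1)])
    show "a j \<in> D \<union> a ` {..<i}" using that by simp
    show "D \<union> a ` {..<i} \<subseteq> univ N" using assms rl_univ by blast
  qed
  then show ?thesis by (metis injI linorder_neqE_nat)
qed

text \<open>If infinitely many terms failed \<open>\<chi>\<close>, then continuing the sequence by realizations of the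
  type over a set that contains the parameters of \<open>\<chi>\<close> would give a sequence of order type
  \<open>\<omega> + \<omega>\<close> on which \<open>\<chi>\<close> is neither finite nor co-finite.\<close>

lemma gs_cofinite:
  assumes "gs_over N s p A" "\<And>i::nat. rl (A \<union> a ` {..<i}) (a i)"
    and "dfn N (univ N) [s] \<chi>" "inp \<chi>"
  shows "finite {i. \<not> \<chi> [a i]}"
proof (rule ccontr)
  assume inf: "infinite {i. \<not> \<chi> [a i]}"
  have uA: "A \<subseteq> univ N" using sm_A by (rule sm_univ)
  have ua: "range a \<subseteq> univ N" using assms(2) rl_univ by blast
  obtain F where F: "F \<subseteq> univ N" "finite F" "dfn N F [s] \<chi>"
    using dfn_finite_params[OF assms(3)] by blast
  \<comment> \<open>\<open>D\<close> contains the sequence \<open>a\<close>, so a Morley sequence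
    over \<open>D\<close> continues \<open>a\<close>; it contains the parameters of
    \<open>\<chi>\<close>, so every term of the continuation satisfies
    \<open>\<chi>\<close>.\<close>
  define D where "D = A \<union> F \<union> range a"
  have D: "sm D" unfolding D_def by (intro sm_Un[OF sm_Un[OF sm_A sm_finite[OF F(2,1)]] sm_range[OF ua]])
  then obtain b where b: "\<And>i::nat. rl (D \<union> b ` {..<i}) (b i)" using ex_morley_nat by blast
  define f where "f = (\<lambda>x. if fst x then b (snd x) else a (snd x))"
  have ia: "inj a" by (rule morley_nat_inj[OF assms(2) uA])
  have ib: "inj b" by (rule morley_nat_inj[OF b sm_univ[OF D]])
  have ub: "range b \<subseteq> univ N" using b rl_univ by blast
  have ab: "b j \<noteq> a i" for i j
  proof (rule rl_neq[OF b])
    show "a i \<in> D \<union> b ` {..<j}" by (simp add: D_def)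
    show "D \<union> b ` {..<j} \<subseteq> univ N" using sm_univ[OF D] ub by blast
  qed
  have inj: "inj f"
  proof (rule injI)
    fix x y assume "f x = f y"
    then show "x = y" using ab ia ib ab[symmetric]
      by (cases x; cases y) (auto simp: f_def inj_eq split: if_splits)
  qed
  \<comment> \<open>Generic stability is formulated for well-orders on elements. The order is
    therefore carried along the injection \<open>f\<close> to its range, and the sequence becomes
    the identity.\<close>
  define r where "r = dir_image omega_plus_omega f"
  have wo: "Well_order r"
    unfolding r_def by (rule Well_order_dir_image[OF Well_order_omega_plus_omega])
      (use inj in \<open>simp add: Field_omega_plus_omega\<close>)
  have Fr: "Field r = range f" unfolding r_def dir_image_Field Field_omega_plus_omega by simp
  have "infinite (Field r)" unfolding Fr using inj
    by (simp add: finite_image_iff finite_prod)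
  moreover have "morley_sequence N s p A r (\<lambda>x. x)"
    unfolding morley_sequence_def rl_def[symmetric]
  proof
    fix y assume "y \<in> Field r"
    then obtain x where y: "y = f x" unfolding Fr by blast
    have us: "underS r y \<subseteq> f ` {z. (z, x) \<in> omega_plus_omega \<and> z \<noteq> x}"
    proof
      fix w assume "w \<in> underS r y"
      then obtain z x' where z: "w = f z" "f x = f x'" "(z, x') \<in> omega_plus_omega" "w \<noteq> f x"
        unfolding underS_def r_def dir_image_def y by auto
      have "x' = x" using z(2) injD[OF inj] by simp
      moreover have "z \<noteq> x" using z(1,4) by auto
      ultimately have "z \<in> {z. (z, x) \<in> omega_plus_omega \<and> z \<noteq> x}" using z(3) by simp
      then show "w \<in> f ` {z. (z, x) \<in> omega_plus_omega \<and> z \<noteq> x}" unfolding z(1) by (rule imageI)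
    qed
    obtain u i where x: "x = (u, i)" by (cases x)
    show "rl (A \<union> (\<lambda>x. x) ` underS r y) y"
    proof (cases u)
      case True
      have "f ` {z. (z, x) \<in> omega_plus_omega \<and> z \<noteq> x} \<subseteq> range a \<union> b ` {..<i}"
        unfolding x f_def omega_plus_omega_def using True by auto
      then have "A \<union> (\<lambda>x. x) ` underS r y \<subseteq> D \<union> b ` {..<i}" using us unfolding D_def by blast
      moreover have "y = b i" using y x True by (simp add: f_def)
      ultimately show ?thesis using rl_mono[OF b[of i]] by simp
    next
      case False
      have "f ` {z. (z, x) \<in> omega_plus_omega \<and> z \<noteq> x} \<subseteq> a ` {..<i}"
        unfolding x f_def omega_plus_omega_def using False by auto
      then have "A \<union> (\<lambda>x. x) ` underS r y \<subseteq> A \<union> a ` {..<i}" using us by blast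
      moreover have "y = a i" using y x False by (simp add: f_def)
      ultimately show ?thesis using rl_mono[OF assms(2)[of i]] by simp
    qed
  qed
  moreover obtain \<phi> where p: "\<phi> \<in> formulas N (univ N) {(s, 0)}"
    "\<And>c. c \<in> univ N \<Longrightarrow> sort_of N c = s \<Longrightarrow> \<chi> [c] \<longleftrightarrow> sat N (\<lambda>_. c) \<phi>"
    using assms(3) unfolding dfn_single by blast
  ultimately have "finite {x \<in> Field r. sat N (\<lambda>_. x) \<phi>} \<or> finite {x \<in> Field r. \<not> sat N (\<lambda>_. x) \<phi>}"
    using assms(1) wo unfolding gs_over_def by blast
  moreover have "range b \<subseteq> {x \<in> Field r. sat N (\<lambda>_. x) \<phi>}"
  proof (intro subsetI CollectI conjI)
    fix x assume "x \<in> range b"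
    then obtain j where j: "x = b j" by blast
    have "b j = f (True, j)" by (simp add: f_def)
    then show "x \<in> Field r" unfolding Fr j by blast
    have "dfn N (D \<union> b ` {..<j}) [s] \<chi>" by (rule dfn_mono[OF F(3)]) (auto simp: D_def)
    moreover have "D \<union> b ` {..<j} \<subseteq> univ N" using sm_univ[OF D] ub by blast
    ultimately have "\<chi> [b j]" using rl_D[OF b] assms(4) by blast
    then show "sat N (\<lambda>_. x) \<phi>" using p(2) rl_univ[OF b] rl_sort[OF b] unfolding j by blast
  qed
  moreover have "a ` {i. \<not> \<chi> [a i]} \<subseteq> {x \<in> Field r. \<not> sat N (\<lambda>_. x) \<phi>}"
  proof (intro subsetI CollectI conjI)
    fix x assume "x \<in> a ` {i. \<not> \<chi> [a i]}"
    then obtain i where i: "x = a i" "\<not> \<chi> [a i]" by blast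
    have "a i = f (False, i)" by (simp add: f_def)
    then show "x \<in> Field r" unfolding Fr i(1) by blast
    show "\<not> sat N (\<lambda>_. x) \<phi>" using p(2) rl_univ[OF assms(2)] rl_sort[OF assms(2)] i by blast
  qed
  moreover have "infinite (range b)" using ib by (simp add: finite_image_iff)
  moreover have "infinite (a ` {i. \<not> \<chi> [a i]})"
    using inf ia by (simp add: finite_image_iff inj_on_def)
  ultimately show False using finite_subset by blast
qed

end

section \<open>Non-orthogonal regular types\<close>

locale regular_pair = P: regular_type N \<kappa> s p A + Q: regular_type N \<kappa> s' q A
  for N :: "('s, 'f, 'r, 'a) struct" and \<kappa> :: "'k rel" and s p s' q A

text \<open>\<open>P.rl (insert b A) a\<close> plays the role of independence of \<open>a\<close>
  from \<open>b\<close>. The relation \<open>\<Phi>\<close> is compatible with both types over every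
  small base, yet it can hold only between dependent elements.\<close>

locale dependent_pair = regular_pair N \<kappa> s p s' q A
  for N :: "('s, 'f, 'r, 'a) struct" and \<kappa> :: "'k rel" and s p s' q A +
  fixes \<Phi> :: "'a list \<Rightarrow> bool"
  assumes dfn_\<Phi>: "dfn N A [s, s'] \<Phi>"
    and cofinal: "P.sm D \<Longrightarrow> A \<subseteq> D \<Longrightarrow> \<exists>a b. P.rl D a \<and> Q.rl D b \<and> \<Phi> [a, b]"
    and dependent: "P.rl (insert b A) a \<Longrightarrow> Q.rl A b \<Longrightarrow> \<not> \<Phi> [a, b]"
begin

lemma A_univ: "A \<subseteq> univ N" using P.sm_A by (rule P.sm_univ)

lemma \<Phi>_cong:
  assumes "EQ N D [a, b] [a', b']" "A \<subseteq> D" "P.rl E a" "Q.rl E' b"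
  shows "\<Phi> [a, b] \<longleftrightarrow> \<Phi> [a', b']"
proof (rule P.EQ_D[OF P.EQ_mono[OF assms(1,2)] _ dfn_\<Phi>])
  show "[a, b] \<in> tuples N [s, s']"
    using P.rl_univ[OF assms(3)] P.rl_sort[OF assms(3)] Q.rl_univ[OF assms(4)] Q.rl_sort[OF assms(4)] by simp
qed

section \<open>How many independent realizations of \<open>p\<close> can depend on one realization
  of \<open>q\<close>\<close>

definition good :: "'a set \<Rightarrow> nat \<Rightarrow> bool" where
  "good D n \<longleftrightarrow> (\<exists>b as. Q.rl D b \<and> P.mor D as \<and> length as = n \<and> (\<forall>a\<in>set as. \<Phi> [a, b]))"

lemma sm_insert: "P.sm D \<Longrightarrow> b \<in> univ N \<Longrightarrow> P.sm (insert b D)"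
  using P.sm_Un[of D "{b}"] P.sm_finite[of "{b}"] by simp

text \<open>Any two realizations of \<open>q\<close> over \<open>D\<close> have the same type over
  \<open>D\<close>, so a family found for one of them is transported to the other by
  \<open>EQ_extend_list\<close>.\<close>

lemma good_at:
  assumes "P.sm D" "A \<subseteq> D" "good D n" "Q.rl D b"
  shows "\<exists>as. P.mor D as \<and> length as = n \<and> (\<forall>a\<in>set as. \<Phi> [a, b])"
proof -
  have uD: "D \<subseteq> univ N" using assms(1) by (rule P.sm_univ)
  obtain b1 as where b1: "Q.rl D b1" "P.mor D as" "length as = n" "\<forall>a\<in>set as. \<Phi> [a, b1]"
    using assms(3) unfolding good_def by blast
  have "EQ N D [b1] [b]"
    using Q.EQ_Cons_rl[OF assms(2) uD P.EQ_refl[of "[]"], of b1 b] b1(1) assms(4) by simp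
  then obtain ds where ds: "length ds = length as" "EQ N D (as @ [b1]) (ds @ [b])"
    using P.EQ_extend_list[OF assms(1) _ P.mor_univ[OF b1(2)]] by blast
  have "P.mor D ds"
    by (rule P.mor_cong[OF assms(2) uD b1(2) P.EQ_take[OF ds(2)]]) (simp add: ds(1))
  moreover have "\<Phi> [x, b]" if x: "x \<in> set ds" for x
  proof -
    obtain i where i: "i < length ds" "x = ds ! i" using x by (metis in_set_conv_nth)
    have "EQ N D [(as @ [b1]) ! i, (as @ [b1]) ! length as] [(ds @ [b]) ! i, (ds @ [b]) ! length as]"
      by (rule P.EQ_pair[OF ds(2)]) (use i(1) ds(1) in auto)
    then have e: "EQ N D [as ! i, b1] [x, b]" using i ds(1) by (simp add: nth_append)
    have m: "as ! i \<in> set as" using i(1) ds(1) by simp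
    then show ?thesis using \<Phi>_cong[OF e assms(2) P.mor_rl[OF b1(2) m] b1(1)] b1(4) by blast
  qed
  ultimately show ?thesis using ds(1) b1(3) by metis
qed

lemma cofinal_at:
  assumes "P.sm D" "A \<subseteq> D" "Q.rl D b"
  shows "\<exists>a. P.rl D a \<and> \<Phi> [a, b]"
proof -
  obtain a0 b0 where "P.rl D a0" "Q.rl D b0" "\<Phi> [a0, b0]" using cofinal[OF assms(1,2)] by blast
  then have "good D 1" unfolding good_def by (intro exI[of _ b0] exI[of _ "[a0]"]) simp
  from good_at[OF assms(1,2) this assms(3)]
  obtain as where as: "P.mor D as" "length as = 1" "\<forall>a\<in>set as. \<Phi> [a, b]" by blast
  then obtain a where "as = [a]" by (metis One_nat_def length_0_conv length_Suc_conv)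
  then show ?thesis using as by auto
qed

lemma cofinal_at_left:
  assumes "P.sm D" "A \<subseteq> D" "P.rl D a"
  shows "\<exists>b. Q.rl D b \<and> \<Phi> [a, b]"
proof -
  have uD: "D \<subseteq> univ N" using assms(1) by (rule P.sm_univ)
  obtain a0 b0 where ab: "P.rl D a0" "Q.rl D b0" "\<Phi> [a0, b0]" using cofinal[OF assms(1,2)] by blast
  have "EQ N D [a0] [a]"
    using P.EQ_Cons_rl[OF assms(2) uD P.EQ_refl[of "[]"], of a0 a] ab(1) assms(3) by simp
  then obtain b where b: "EQ N D [b0, a0] [b, a]"
    using P.EQ_extend[OF assms(1) _ Q.rl_univ[OF ab(2)]] by blast
  have e: "EQ N D [a0, b0] [a, b]" using P.EQ_pair[OF b, of 1 0] by simp
  have "EQ N D [b0] [b]" using P.EQ_take[of D "[b0]" "[a0]" "[b]" "[a]"] b by simp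
  then have "Q.rl D b" using Q.rl_EQ[OF assms(2) uD, of b0 "[]" b "[]"] ab(2) by simp
  moreover have "\<Phi> [a, b]" using \<Phi>_cong[OF e assms(2) ab(1,2)] ab(3) by simp
  ultimately show ?thesis by blast
qed

lemma fibre_left:
  assumes "b \<in> univ N" "sort_of N b = s'"
  shows "dfn N (insert b A) [s] (\<lambda>xs. \<Phi> (xs @ [b]))"
proof -
  have "dfn N (A \<union> set [b]) [s] (\<lambda>xs. \<Phi> (xs @ [b]))"
    by (rule dfn_inst[where ts = "[s']"]) (use dfn_\<Phi> assms in simp_all)
  then show ?thesis by simp
qed

lemma fibre_right:
  assumes "a \<in> univ N" "sort_of N a = s"
  shows "dfn N (insert a A) [s'] (\<lambda>xs. \<Phi> [a, xs ! 0])"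
proof -
  have "dfn N A [s', s] (\<lambda>as. \<Phi> (map ((!) as) [1, 0]))"
    by (rule dfn_reindex[OF dfn_\<Phi>]) auto
  then have "dfn N (A \<union> set [a]) [s'] (\<lambda>xs. \<Phi> (map ((!) (xs @ [a])) [1, 0]))"
    by (intro dfn_inst[where ts = "[s]"]) (use assms in simp_all)
  then have "dfn N (insert a A) [s'] (\<lambda>xs. \<Phi> (map ((!) (xs @ [a])) [1, 0]))" by simp
  moreover have "\<Phi> (map ((!) (xs @ [a])) [1, 0]) \<longleftrightarrow> \<Phi> [a, xs ! 0]" if "xs \<in> tuples N [s']" for xs
    using that unfolding tuples_Cons tuples_Nil by auto
  ultimately show ?thesis by (subst dfn_cong[of N "[s']"]) auto
qed

text \<open>If every number were good over \<open>A\<close>, compactness would give a whole Morley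
  sequence in \<open>p\<close> and one realization \<open>b\<close> of \<open>q\<close> with
  \<open>\<Phi>\<close> between \<open>b\<close> and each term. But \<open>\<Phi>(x, b)\<close> is
  not in \<open>p\<close>, so by generic stability it holds at finitely many terms only.\<close>

lemma not_good:
  assumes "gs_over N s p A"
  shows "\<exists>n D. P.sm D \<and> A \<subseteq> D \<and> \<not> good D n"
proof (rule ccontr)
  assume "\<not> ?thesis"
  then have g: "good A n" for n using P.sm_A by blast
  obtain a where a: "\<And>i::nat. P.rl (A \<union> a ` {..<i}) (a i)" using P.ex_morley_nat[OF P.sm_A] by blast
  have ua: "range a \<subseteq> univ N" using a P.rl_univ by blast
  have mora: "P.mor A (rev (map a [0..<n]))" for n
  proof (induction n)
    case (Suc n)
    have "A \<union> set (rev (map a [0..<n])) = A \<union> a ` {..<n}" by (auto simp: atLeast0LessThan)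
    then have "P.rl (A \<union> set (rev (map a [0..<n]))) (a n)" using a[of n] by simp
    then show ?case using Suc by simp
  qed simp
  have ex: "\<exists>b. Q.rl A b \<and> (\<forall>i<n. \<Phi> [a i, b])" for n
  proof -
    obtain b0 as where b0: "Q.rl A b0" "P.mor A as" "length as = n" "\<forall>x\<in>set as. \<Phi> [x, b0]"
      using g[of n] unfolding good_def by blast
    let ?bs = "rev (map a [0..<n])"
    have "EQ N A as ?bs" by (rule P.mor_EQ[OF subset_refl A_univ b0(2) mora]) (simp add: b0(3))
    then obtain b where b: "EQ N A (b0 # as) (b # ?bs)"
      using P.EQ_extend[OF P.sm_A _ Q.rl_univ[OF b0(1)]] by blast
    have "EQ N A [b0] [b]" using P.EQ_take[of A "[b0]" as "[b]" ?bs] b by simp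
    then have "Q.rl A b" using Q.rl_EQ[OF subset_refl A_univ, of b0 "[]" b "[]"] b0(1) by simp
    moreover have "\<Phi> [a i, b]" if i: "i < n" for i
    proof -
      \<comment> \<open>\<open>mor\<close> lists the last term first, so \<open>a i\<close> has
        position \<open>n - i - 1\<close> in \<open>?bs\<close>, and \<open>n - i\<close> once
        \<open>b\<close> is put in front.\<close>
      have "EQ N A [(b0 # as) ! (n - i), (b0 # as) ! 0] [(b # ?bs) ! (n - i), (b # ?bs) ! 0]"
        by (rule P.EQ_pair[OF b]) (use i b0(3) in auto)
      moreover have "(b # ?bs) ! (n - i) = a i" using i by (simp add: nth_Cons' rev_nth)
      moreover have "(b0 # as) ! (n - i) = as ! (n - i - 1)" using i by (simp add: nth_Cons')
      ultimately have e: "EQ N A [as ! (n - i - 1), b0] [a i, b]" by simp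
      have m: "as ! (n - i - 1) \<in> set as" using i b0(3) by simp
      show ?thesis using \<Phi>_cong[OF e subset_refl P.mor_rl[OF b0(2) m] b0(1)] b0(4) m by blast
    qed
    ultimately show ?thesis by blast
  qed
  \<comment> \<open>Says of \<open>xs ! 0\<close> that it realizes \<open>q\<close> over
    \<open>A\<close> and is related by \<open>\<Phi>\<close> to all terms of the sequence at
    once.\<close>
  define \<R> where "\<R> = {R. dfn N A [s'] R \<and> Q.inp R} \<union> range (\<lambda>i xs. \<Phi> [a i, xs ! 0])"
  have sA: "P.sm (A \<union> range a)" by (intro P.sm_Un P.sm_A P.sm_range ua)
  have "\<exists>xs\<in>tuples N [s']. \<forall>R\<in>\<R>. R xs"
  proof (rule P.realize_one[OF sA Q.s_sort])
    fix R assume "R \<in> \<R>"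
    then consider "dfn N A [s'] R" | i where "R = (\<lambda>xs. \<Phi> [a i, xs ! 0])" unfolding \<R>_def by blast
    then show "dfn N (A \<union> range a) [s'] R"
    proof cases
      case 1
      then show ?thesis by (rule dfn_mono) simp
    next
      case (2 i)
      show ?thesis unfolding 2
        by (rule dfn_mono[OF fibre_right[OF P.rl_univ[OF a] P.rl_sort[OF a]]]) auto
    qed
  next
    fix F assume F: "finite F" "F \<subseteq> \<R>"
    have "finite (F \<inter> range (\<lambda>i xs. \<Phi> [a i, xs ! 0]))" using F(1) by simp
    then obtain I where I: "finite I" "F \<inter> range (\<lambda>i xs. \<Phi> [a i, xs ! 0]) = (\<lambda>i xs. \<Phi> [a i, xs ! 0]) ` I"
      using finite_subset_image[of "F \<inter> range (\<lambda>i xs. \<Phi> [a i, xs ! 0])" "\<lambda>i xs. \<Phi> [a i, xs ! 0]" UNIV] by blast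
    obtain n where n: "\<forall>i\<in>I. i < n" using I(1) finite_nat_set_iff_bounded by blast
    obtain b where b: "Q.rl A b" "\<forall>i<n. \<Phi> [a i, b]" using ex by blast
    have "R [b]" if "R \<in> F" for R
    proof (cases "R \<in> range (\<lambda>i xs. \<Phi> [a i, xs ! 0])")
      case True
      then have "R \<in> (\<lambda>i xs. \<Phi> [a i, xs ! 0]) ` I" using I(2) that by blast
      then obtain i where "i \<in> I" "R = (\<lambda>xs. \<Phi> [a i, xs ! 0])" by blast
      then show ?thesis using b(2) n by simp
    next
      case False
      then have "dfn N A [s'] R" "Q.inp R" using F(2) that unfolding \<R>_def by blast+
      then show ?thesis using Q.rl_D[OF b(1) _ A_univ] by blast
    qed
    then show "\<exists>xs\<in>tuples N [s']. \<forall>R\<in>F. R xs" using Q.rl_tuple[OF b(1)] by blast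
  qed
  then obtain xs where xs: "xs \<in> tuples N [s']" "\<forall>R\<in>\<R>. R xs" by (rule bexE)
  from xs(1) obtain b where b: "xs = [b]" "b \<in> univ N" "sort_of N b = s'"
    unfolding tuples_Cons tuples_Nil by blast
  have "R [b]" if "dfn N A [s'] R" "Q.inp R" for R
    using bspec[OF xs(2), of R] that b(1) unfolding \<R>_def by simp
  then have Qb: "Q.rl A b" unfolding Q.rl_iff[OF A_univ] using b by blast
  have all: "\<Phi> [a i, b]" for i
  proof -
    have "(\<lambda>xs. \<Phi> [a i, xs ! 0]) \<in> \<R>" unfolding \<R>_def by blast
    from bspec[OF xs(2) this] show ?thesis using b(1) by simp
  qed
  \<comment> \<open>A realization \<open>a'\<close> of \<open>p\<close> over \<open>A\<close> and
    \<open>b\<close> cannot be related to \<open>b\<close> by \<open>\<Phi>\<close>; it shows that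
    \<open>p\<close> contains the negation of \<open>\<Phi>(x, b)\<close>.\<close>
  have sb: "P.sm (insert b A)" using sm_insert[OF P.sm_A b(2)] .
  then obtain a' where a': "P.rl (insert b A) a'" using P.rl_ex by blast
  have d: "dfn N (univ N) [s] (\<lambda>xs. \<Phi> (xs @ [b]))"
    by (rule dfn_mono[OF fibre_left[OF b(2,3)]]) (rule P.sm_univ[OF sb])
  have "\<not> P.inp (\<lambda>xs. \<Phi> (xs @ [b]))"
    using P.rl_D[OF a' fibre_left[OF b(2,3)] P.sm_univ[OF sb]] dependent[OF a' Qb] by simp
  then have "P.inp (\<lambda>xs. \<not> \<Phi> (xs @ [b]))" using P.in_type_neg[OF d] by simp
  from P.gs_cofinite[OF assms a dfn_neg[OF d] this]
  show False using all by simp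
qed

lemma dependent_pair_mono:
  assumes "A \<subseteq> C" "P.sm C"
  shows "dependent_pair N \<kappa> s p s' q C \<Phi>"
proof -
  interpret PC: regular_type N \<kappa> s p C by (rule P.regular_mono[OF assms])
  interpret QC: regular_type N \<kappa> s' q C by (rule Q.regular_mono[OF assms])
  show ?thesis
  proof unfold_locales
    show "dfn N C [s, s'] \<Phi>" by (rule dfn_mono[OF dfn_\<Phi> assms(1)])
    show "\<exists>a b. P.rl D a \<and> Q.rl D b \<and> \<Phi> [a, b]" if "P.sm D" "C \<subseteq> D" for D
      using cofinal[OF that(1)] that(2) assms(1) by blast
    show "\<not> \<Phi> [a, b]" if "P.rl (insert b C) a" "Q.rl C b" for a b
      using dependent P.rl_mono[OF that(1), of "insert b A"] Q.rl_mono[OF that(2) assms(1)] assms(1) by blast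
  qed
qed

end

text \<open>By generic stability of \<open>p\<close> the number \<open>k\<close> of independent realizations of \<open>p\<close> that depend
  through \<open>\<Phi>\<close> on one realization of \<open>q\<close> is bounded; \<open>k\<close> is taken maximal.\<close>

locale maximal_dependent_pair = dependent_pair N \<kappa> s p s' q A \<Phi>
  for N :: "('s, 'f, 'r, 'a) struct" and \<kappa> :: "'k rel" and s p s' q A \<Phi> +
  fixes k :: nat
  assumes k_pos: "k > 0"
    and good_k: "P.sm D \<Longrightarrow> A \<subseteq> D \<Longrightarrow> good D k"
    and not_good_Suc_k: "\<not> good A (Suc k)"

text \<open>\<open>n\<close> is the least number that is bad over some small set, and that set
  becomes the new base. So \<open>n = Suc k\<close> fails over the base itself, while
  \<open>k\<close> is good over every small set above it.\<close>

lemma (in dependent_pair) ex_maximal: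
  assumes "gs_over N s p A"
  shows "\<exists>k C. A \<subseteq> C \<and> P.sm C \<and> maximal_dependent_pair N \<kappa> s p s' q C \<Phi> k"
proof -
  let ?B = "\<lambda>n. \<exists>D. P.sm D \<and> A \<subseteq> D \<and> \<not> good D n"
  define n where "n = (LEAST n. ?B n)"
  have "?B n" unfolding n_def by (rule LeastI_ex) (rule not_good[OF assms])
  then obtain C where C: "P.sm C" "A \<subseteq> C" "\<not> good C n" by blast
  have le: "good D m" if "m < n" "P.sm D" "A \<subseteq> D" for m D
    using not_less_Least[of m ?B] that unfolding n_def by blast
  have "n \<noteq> 0"
  proof
    assume "n = 0"
    obtain b where "Q.rl C b" using Q.rl_ex[OF C(1)] by blast
    then have "good C n" unfolding good_def \<open>n = 0\<close> by (intro exI[of _ b] exI[of _ "[]"]) simp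
    then show False using C(3) by simp
  qed
  \<comment> \<open>The number 1 is good over every small set above \<open>A\<close> because
    \<open>\<Phi>\<close> is cofinal; hence \<open>k\<close> is positive.\<close>
  moreover have "n \<noteq> 1"
  proof
    assume "n = 1"
    obtain a0 b0 where "P.rl C a0" "Q.rl C b0" "\<Phi> [a0, b0]" using cofinal[OF C(1,2)] by blast
    then have "good C n" unfolding good_def \<open>n = 1\<close> by (intro exI[of _ b0] exI[of _ "[a0]"]) simp
    then show False using C(3) by simp
  qed
  ultimately obtain k where k: "n = Suc k" "k > 0" by (cases n) auto
  interpret C: dependent_pair N \<kappa> s p s' q C \<Phi> by (rule dependent_pair_mono[OF C(2,1)])
  have "maximal_dependent_pair N \<kappa> s p s' q C \<Phi> k"
  proof unfold_locales
    show "0 < k" by (rule k(2))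
    show "C.good D k" if "P.sm D" "C \<subseteq> D" for D
      using le[of k D] that k(1) C(2) unfolding good_def C.good_def by auto
    show "\<not> C.good C (Suc k)" using C(3) unfolding good_def C.good_def k(1) by auto
  qed
  then show ?thesis using C by blast
qed

section \<open>Elements that depend on the base preserve independence, for either type\<close>

context maximal_dependent_pair
begin

text \<open>Otherwise choose \<open>b1\<close> realizing \<open>q\<close> over \<open>D\<close> with
  \<open>\<Phi>(a, b1)\<close>. By regularity of \<open>q\<close> it still realizes \<open>q\<close>
  over \<open>D\<close> and \<open>b\<close>, so over that base there are \<open>k\<close>
  independent realizations of \<open>p\<close> related to \<open>b1\<close>. Since \<open>a\<close>
  has stopped realizing \<open>p\<close> there, regularity of \<open>p\<close> keeps them
  independent when \<open>a\<close> joins the base, and together with \<open>a\<close> they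
  contradict the maximality of \<open>k\<close>.\<close>

lemma dependent_preserves_P:
  assumes "P.sm D" "A \<subseteq> D" "Q.rl A b" "\<not> Q.rl D b" "P.rl D a"
  shows "P.rl (insert b D) a"
proof (rule ccontr)
  assume n: "\<not> P.rl (insert b D) a"
  obtain b1 where b1: "Q.rl D b1" "\<Phi> [a, b1]" using cofinal_at_left[OF assms(1,2,5)] by blast
  let ?E = "insert b D"
  have E: "P.sm ?E" "A \<subseteq> ?E" using sm_insert[OF assms(1) Q.rl_univ[OF assms(3)]] assms(2) by auto
  have "Q.rl ?E b1" by (rule Q.regularity[OF assms(1-4) b1(1)])
  from good_at[OF E good_k[OF E] this] 
  obtain as where as: "P.mor ?E as" "length as = k" "\<forall>x\<in>set as. \<Phi> [x, b1]" by blast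
  have "P.mor (insert a ?E) as"
    by (rule P.mor_regular[OF E P.rl_mono[OF assms(5,2)] n as(1)])
  then have "P.mor (D \<union> set [a]) as" by (rule P.mor_mono) auto
  moreover have "P.mor D [a]" using assms(5) by simp
  \<comment> \<open>Lists are read from the end: in \<open>as @ [a]\<close> the element
    \<open>a\<close> is the first term of the sequence.\<close>
  ultimately have "P.mor D (as @ [a])" by (intro P.mor_append)
  then have "P.mor A (as @ [a])" using assms(2) by (rule P.mor_mono)
  moreover have "\<forall>x\<in>set (as @ [a]). \<Phi> [x, b1]" using as(3) b1(2) by simp
  ultimately have "good A (Suc k)"
    unfolding good_def using Q.rl_mono[OF b1(1) assms(2)] as(2) by (intro exI[of _ b1] exI[of _ "as @ [a]"]) simp
  then show False using not_good_Suc_k by simp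
qed

text \<open>Choose \<open>a1\<close> realizing \<open>p\<close> over \<open>D\<close> with
  \<open>\<Phi>(a1, b)\<close>; by regularity of \<open>p\<close> it still realizes \<open>p\<close>
  over \<open>D\<close> and \<open>a\<close>. If \<open>b\<close> did not realize \<open>q\<close>
  over this larger base, \<open>dependent_preserves_P\<close> would make \<open>a1\<close>
  independent from \<open>b\<close>, contrary to \<open>\<Phi>(a1, b)\<close>.\<close>

lemma dependent_preserves_Q:
  assumes "P.sm D" "A \<subseteq> D" "P.rl A a" "\<not> P.rl D a" "Q.rl D b"
  shows "Q.rl (insert a D) b"
proof (rule ccontr)
  assume n: "\<not> Q.rl (insert a D) b"
  obtain a1 where a1: "P.rl D a1" "\<Phi> [a1, b]" using cofinal_at[OF assms(1,2,5)] by blast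
  let ?E = "insert a D"
  have E: "P.sm ?E" "A \<subseteq> ?E" using sm_insert[OF assms(1) P.rl_univ[OF assms(3)]] assms(2) by auto
  have Qb: "Q.rl A b" using assms(5,2) by (rule Q.rl_mono)
  have "P.rl ?E a1" by (rule P.regularity[OF assms(1-4) a1(1)])
  then have "P.rl (insert b ?E) a1" by (rule dependent_preserves_P[OF E Qb n])
  then have "P.rl (insert b A) a1" by (rule P.rl_mono) (use assms(2) in blast)
  then show False using dependent[OF _ Qb] a1(2) by blast
qed

text \<open>Independence from \<open>D\<close> passes from \<open>a\<close> to \<open>b\<close>: if
  \<open>b\<close> did not realize \<open>q\<close> over \<open>D\<close>, then it could not disturb
  \<open>a\<close>, which would realize \<open>p\<close> over \<open>D\<close> and \<open>b\<close>
  in spite of \<open>\<Phi>(a, b)\<close>.\<close>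

lemma dependent_over:
  assumes "P.sm D" "A \<subseteq> D" "P.rl D a" "Q.rl A b" "\<Phi> [a, b]"
  shows "Q.rl D b"
proof (rule ccontr)
  assume "\<not> Q.rl D b"
  then have "P.rl (insert b D) a" by (rule dependent_preserves_P[OF assms(1,2,4) _ assms(3)])
  then have "P.rl (insert b A) a" by (rule P.rl_mono) (use assms(2) in blast)
  then show False using dependent[OF _ assms(4)] assms(5) by blast
qed

text \<open>Each \<open>a i\<close> is chosen by \<open>cofinal_at\<close> over all earlier terms of
  both sequences. This requires that \<open>c i\<close> realizes \<open>q\<close> not only over the
  earlier \<open>c\<close> terms but over the earlier \<open>a\<close> terms as well.\<close>

lemma ex_dependent_sequence:
  assumes "\<And>i::nat. Q.rl (A \<union> c ` {..<i}) (c i)"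
  shows "\<exists>a. \<forall>i. P.rl (A \<union> a ` {..<i}) (a i) \<and> \<Phi> [a i, c i]"
proof -
  have uc: "range c \<subseteq> univ N" using assms Q.rl_univ by blast
  have "\<exists>a. \<forall>i. P.rl (A \<union> c ` {..<i} \<union> a ` {..<i}) (a i) \<and> \<Phi> [a i, c i]"
  proof (rule dependent_wellorder_choice)
    fix x and f g :: "nat \<Rightarrow> 'a" and i :: nat assume "\<And>j. j < i \<Longrightarrow> f j = g j"
    then have "f ` {..<i} = g ` {..<i}" by auto
    then show "P.rl (A \<union> c ` {..<i} \<union> f ` {..<i}) x \<and> \<Phi> [x, c i] \<longleftrightarrow>
               P.rl (A \<union> c ` {..<i} \<union> g ` {..<i}) x \<and> \<Phi> [x, c i]" by simp
  next
    fix i :: nat and f :: "nat \<Rightarrow> 'a"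
    assume f: "\<And>j. j < i \<Longrightarrow> P.rl (A \<union> c ` {..<j} \<union> f ` {..<j}) (f j) \<and> \<Phi> [f j, c j]"
    have uf: "f ` {..<i} \<subseteq> univ N" using f P.rl_univ by blast
    have sm: "P.sm (A \<union> c ` {..<i} \<union> f ` {..<m})" if "m \<le> i" for m
      using uc uf that by (intro P.sm_Un P.sm_A P.sm_finite) (auto simp: image_subset_iff)
    \<comment> \<open>The terms of \<open>f\<close> join the base one at a time. Each
      \<open>f m\<close> depends on \<open>c m\<close>, which is already in the base, so
      \<open>f m\<close> does not realize \<open>p\<close> there and
      \<open>dependent_preserves_Q\<close> leaves \<open>c i\<close> undisturbed.\<close>
    have "Q.rl (A \<union> c ` {..<i} \<union> f ` {..<m}) (c i)" if "m \<le> i" for m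
      using that
    proof (induction m)
      case 0
      then show ?case using assms[of i] by simp
    next
      case (Suc m)
      let ?D = "A \<union> c ` {..<i} \<union> f ` {..<m}"
      have m: "m < i" "m \<le> i" using Suc.prems by auto
      have "\<not> P.rl ?D (f m)"
      proof
        assume "P.rl ?D (f m)"
        then have "P.rl (insert (c m) A) (f m)" by (rule P.rl_mono) (use m in auto)
        moreover have "Q.rl A (c m)" using assms[of m] by (rule Q.rl_mono) simp
        ultimately show False using dependent f[OF m(1)] by blast
      qed
      moreover have "P.rl A (f m)" using f[OF m(1)] P.rl_mono[of _ "f m" A] by blast
      ultimately have "Q.rl (insert (f m) ?D) (c i)"
        using dependent_preserves_Q[OF sm[OF m(2)] _ _ _ Suc.IH[OF m(2)]] by blast
      moreover have "insert (f m) ?D = A \<union> c ` {..<i} \<union> f ` {..<Suc m}" by (auto simp: lessThan_Suc)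
      ultimately show ?case by simp
    qed
    from cofinal_at[OF sm[OF order_refl] _ this[OF order_refl]]
    show "\<exists>x. P.rl (A \<union> c ` {..<i} \<union> f ` {..<i}) x \<and> \<Phi> [x, c i]" by blast
  qed
  then obtain a where a: "\<And>i. P.rl (A \<union> c ` {..<i} \<union> a ` {..<i}) (a i) \<and> \<Phi> [a i, c i]" by blast
  have "P.rl (A \<union> a ` {..<i}) (a i)" for i
    by (rule P.rl_mono[OF conjunct1[OF a]]) auto
  then show ?thesis using a by blast
qed

text \<open>Pair the \<open>c i\<close> with a dependent Morley sequence in \<open>p\<close>. By
  generic stability each formula of \<open>p\<close> over a base \<open>D\<close> that contains the
  parameters of \<open>\<psi>\<close> holds at almost all \<open>a i\<close>, so compactness gives a
  limit pair \<open>(x, y)\<close> with \<open>\<Phi>(x, y)\<close>, \<open>\<psi>(y)\<close> and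
  \<open>x\<close> realizing \<open>p\<close> over \<open>D\<close>. Then \<open>y\<close> realizes
  \<open>q\<close> over \<open>D\<close>, which excludes \<open>\<psi>(y)\<close>.\<close>

lemma no_constant_sequence:
  assumes gs: "gs_over N s p A" and c: "\<And>i::nat. Q.rl (A \<union> c ` {..<i}) (c i)"
    and \<psi>: "dfn N (univ N) [s'] \<psi>" "\<not> Q.inp \<psi>"
  shows "\<exists>i. \<not> \<psi> [c i]"
proof (rule ccontr)
  assume "\<not> ?thesis"
  then have all: "\<psi> [c i]" for i by blast
  obtain a where a: "\<And>i. P.rl (A \<union> a ` {..<i}) (a i)" "\<And>i. \<Phi> [a i, c i]"
    using ex_dependent_sequence[of c] c by blast
  obtain F where F: "F \<subseteq> univ N" "finite F" "dfn N F [s'] \<psi>"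
    using dfn_finite_params[OF \<psi>(1)] by blast
  define D where "D = A \<union> F"
  have D: "P.sm D" "A \<subseteq> D" unfolding D_def using P.sm_Un[OF P.sm_A P.sm_finite[OF F(2,1)]] by simp_all
  have uD: "D \<subseteq> univ N" using D(1) by (rule P.sm_univ)
  have dpsi: "dfn N D [s'] \<psi>" by (rule dfn_mono[OF F(3)]) (simp add: D_def)
  define lft where "lft = (\<lambda>R (as :: 'a list). R (map ((!) as) [0]) :: bool)"
  define rgt where "rgt = (\<lambda>R (as :: 'a list). R (map ((!) as) [1]) :: bool)"
  have dl: "dfn N D [s, s'] (lft R)" if "dfn N D [s] R" for R
    unfolding lft_def by (rule dfn_reindex[OF that]) auto
  have dr: "dfn N D [s, s'] (rgt R)" if "dfn N D [s'] R" for R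
    unfolding rgt_def by (rule dfn_reindex[OF that]) auto
  have lft [simp]: "lft R [x, y] \<longleftrightarrow> R [x]" and rgt [simp]: "rgt R [x, y] \<longleftrightarrow> R [y]" for R x y
    by (simp_all add: lft_def rgt_def)
  define \<R>1 where "\<R>1 = {R. dfn N D [s] R \<and> P.inp R}"
  \<comment> \<open>Only formulas over \<open>A\<close> are imposed on the second coordinate; that
    the limit realizes \<open>q\<close> over \<open>D\<close> is what the first coordinate has to
    yield.\<close>
  define \<R>2 where "\<R>2 = {R. dfn N A [s'] R \<and> Q.inp R}"
  define \<R> where "\<R> = lft ` \<R>1 \<union> rgt ` \<R>2 \<union> {\<Phi>, rgt \<psi>}"
  have fin: "finite {i. \<not> T [a i, c i]}" if T: "T \<in> \<R>" for T
  proof -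
    consider R where "R \<in> \<R>1" "T = lft R" | R where "R \<in> \<R>2" "T = rgt R" | "T = \<Phi>" | "T = rgt \<psi>"
      using T unfolding \<R>_def by blast
    then show ?thesis
    proof cases
      case 1
      then have "dfn N (univ N) [s] R" "P.inp R" unfolding \<R>1_def using dfn_mono uD by blast+
      from P.gs_cofinite[OF gs a(1) this] show ?thesis unfolding 1 by simp
    next
      case 2
      have "dfn N A [s'] R" "Q.inp R" using 2(1) unfolding \<R>2_def by blast+
      then have "R [c i]" for i using Q.rl_D[OF Q.rl_mono[OF c[of i], of A] _ A_univ, of R] by blast
      then show ?thesis unfolding 2 by simp
    qed (simp_all add: a(2) all)
  qed
  have "\<exists>as\<in>tuples N [s, s']. \<forall>T\<in>\<R>. T as"
  proof (rule P.realize_family[OF D(1)])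
    show "set [s, s'] \<subseteq> sorts N" using P.s_sort Q.s_sort by simp
    fix T assume "T \<in> \<R>"
    then consider R where "R \<in> \<R>1" "T = lft R" | R where "R \<in> \<R>2" "T = rgt R" | "T = \<Phi>" | "T = rgt \<psi>"
      unfolding \<R>_def by blast
    then show "dfn N D [s, s'] T"
    proof cases
      case 1
      then show ?thesis using dl unfolding \<R>1_def by blast
    next
      case 2
      then show ?thesis using dr dfn_mono[OF _ D(2)] unfolding \<R>2_def by blast
    next
      case 3
      then show ?thesis using dfn_mono[OF dfn_\<Phi> D(2)] by simp
    next
      case 4
      then show ?thesis using dr[OF dpsi] by simp
    qed
  next
    fix G assume G: "finite G" "G \<subseteq> \<R>"
    \<comment> \<open>Each of finitely many conditions fails at finitely many indices, so a single
      pair \<open>[a i, c i]\<close> meets all of them.\<close>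
    have "finite (\<Union>T\<in>G. {i. \<not> T [a i, c i]})" using G fin by blast
    then obtain i where "i \<notin> (\<Union>T\<in>G. {i. \<not> T [a i, c i]})" using ex_new_if_finite[OF infinite_UNIV_nat] by blast
    then have "\<forall>T\<in>G. T [a i, c i]" by blast
    moreover have "[a i, c i] \<in> tuples N [s, s']"
      using P.rl_univ[OF a(1)] P.rl_sort[OF a(1)] Q.rl_univ[OF c] Q.rl_sort[OF c] by simp
    ultimately show "\<exists>as\<in>tuples N [s, s']. \<forall>T\<in>G. T as" by blast
  qed
  then obtain as where as: "as \<in> tuples N [s, s']" "\<forall>T\<in>\<R>. T as" by (rule bexE)
  from as(1) obtain x y where xy: "as = [x, y]" "x \<in> univ N" "sort_of N x = s" "y \<in> univ N" "sort_of N y = s'"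
    unfolding tuples_Cons tuples_Nil by blast
  have "R [x]" if "dfn N D [s] R" "P.inp R" for R
  proof -
    have "lft R \<in> \<R>" unfolding \<R>_def \<R>1_def using that by blast
    from bspec[OF as(2) this] show ?thesis unfolding xy(1) by simp
  qed
  then have Px: "P.rl D x" unfolding P.rl_iff[OF uD] using xy by blast
  have "R [y]" if "dfn N A [s'] R" "Q.inp R" for R
  proof -
    have "rgt R \<in> \<R>" unfolding \<R>_def \<R>2_def using that by blast
    from bspec[OF as(2) this] show ?thesis unfolding xy(1) by simp
  qed
  then have Qy: "Q.rl A y" unfolding Q.rl_iff[OF A_univ] using xy by blast
  have "\<Phi> \<in> \<R>" "rgt \<psi> \<in> \<R>" unfolding \<R>_def by simp_all
  then have "\<Phi> as" "rgt \<psi> as" using as(2) by blast+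
  then have "\<Phi> [x, y]" "\<psi> [y]" unfolding xy(1) by simp_all
  then have "Q.rl D y" using dependent_over[OF D Px Qy] by simp
  then show False using Q.rl_D[OF _ dpsi uD] \<psi>(2) \<open>\<psi> [y]\<close> by blast
qed

text \<open>A formula outside \<open>q\<close> that held infinitely often would hold along an
  increasing subsequence, and a subsequence of a Morley sequence over \<open>A\<close> is again one.
  So such a formula holds finitely often; apply this to \<open>\<phi>\<close> or to its
  negation.\<close>

theorem gs_over_transfer:
  assumes gs: "gs_over N s p A"
  shows "gs_over N s' q A"
  unfolding gs_over_def
proof (intro allI impI ballI, elim conjE)
  fix r :: "'a rel" and b \<phi>
  assume wo: "Well_order r" and mor: "morley_sequence N s' q A r b"
    and p: "\<phi> \<in> formulas N (univ N) {(s', 0)}"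
  have fin: "finite {i \<in> Field r. sat N (\<lambda>_. b i) \<psi>}"
    if \<psi>: "\<psi> \<in> formulas N (univ N) {(s', 0)}" "\<psi> \<notin> q" for \<psi>
  proof (rule ccontr)
    assume "\<not> ?thesis"
    then obtain e :: "nat \<Rightarrow> 'a" where e: "\<And>i. e i \<in> {i \<in> Field r. sat N (\<lambda>_. b i) \<psi>}"
      "\<And>i j. j < i \<Longrightarrow> e j \<in> underS r (e i)"
      using ex_increasing_sequence[OF wo, of "{i \<in> Field r. sat N (\<lambda>_. b i) \<psi>}"] by blast
    have c: "Q.rl (A \<union> (\<lambda>i. b (e i)) ` {..<i}) (b (e i))" for i
    proof (rule Q.rl_mono)
      show "Q.rl (A \<union> b ` underS r (e i)) (b (e i))"
        using mor e(1)[of i] unfolding morley_sequence_def Q.rl_def by blast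
      show "A \<union> (\<lambda>i. b (e i)) ` {..<i} \<subseteq> A \<union> b ` underS r (e i)" using e(2) by blast
    qed
    let ?R = "\<lambda>as. sat N (\<lambda>_. as ! 0) \<psi>"
    have "dfn N (univ N) [s'] ?R" unfolding dfn_single by (intro bexI[OF _ \<psi>(1)]) simp
    moreover have "\<not> Q.inp ?R" using Q.in_type_formula[OF \<psi>(1), of ?R] \<psi>(2) by simp
    ultimately obtain i where "\<not> ?R [b (e i)]" using no_constant_sequence[OF gs c] by blast
    then show False using e(1)[of i] by simp
  qed
  show "finite {i \<in> Field r. sat N (\<lambda>_. b i) \<phi>} \<or> finite {i \<in> Field r. \<not> sat N (\<lambda>_. b i) \<phi>}"
  proof (cases "\<phi> \<in> q")
    case True
    have n: "Neg \<phi> \<in> formulas N (univ N) {(s', 0)}" using p by (simp add: formulas_def)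
    have "Neg \<phi> \<notin> q" using Q.p_fin_sat[of "{\<phi>, Neg \<phi>}"] True by auto
    from fin[OF n this] show ?thesis by simp
  next
    case False
    from fin[OF p this] show ?thesis by simp
  qed
qed

end

section \<open>Orthogonality\<close>

lemma shift_formula:
  assumes "\<psi> \<in> formulas N A {(s, 0)}"
  shows "shift \<psi> \<in> formulas N A {(s, 1)}"
    and "sat N e (shift \<psi>) \<longleftrightarrow> sat N (\<lambda>_. e (s, 1)) \<psi>"
proof -
  let ?h = "map_prod id Suc :: 'a \<times> nat \<Rightarrow> 'a \<times> nat"
  have h: "inj ?h" "\<And>v. fst (?h v) = fst v" by (auto intro: prod.inj_map)
  have s: "shift \<psi> = map_fm ?h (\<lambda>x. x) (\<lambda>x. x) (\<lambda>x. x) \<psi>" unfolding shift_def id_def ..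
  show "shift \<psi> \<in> formulas N A {(s, 1)}"
    using assms unfolding s formulas_def by (auto simp: fv_rename[OF h(1)] wf_fm_rename)
  have "sat N e (shift \<psi>) \<longleftrightarrow> sat N (\<lambda>v. e (?h v)) \<psi>" unfolding s by (rule sat_rename[OF h])
  also have "\<dots> \<longleftrightarrow> sat N (\<lambda>_. e (s, 1)) \<psi>"
    by (rule sat_cong) (use assms in \<open>auto simp: formulas_def\<close>)
  finally show "sat N e (shift \<psi>) \<longleftrightarrow> sat N (\<lambda>_. e (s, 1)) \<psi>" .
qed

text \<open>Says that \<open>p(x)\<close> together with \<open>q(y)\<close> leaves
  \<open>\<Phi>\<close> undecided, but through realizations over small sets instead of complete
  types over the monster.\<close>

definition non_orth ::
  "'k rel \<Rightarrow> ('s, 'f, 'r, 'a) struct \<Rightarrow> 's \<Rightarrow> ('s, 'f, 'r, 'a) formula set \<Rightarrow>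
     's \<Rightarrow> ('s, 'f, 'r, 'a) formula set \<Rightarrow> bool" where
  "non_orth \<kappa> N s p s' q \<longleftrightarrow>
     (\<exists>\<Phi>. dfn N (univ N) [s, s'] \<Phi> \<and>
        (\<forall>D. small \<kappa> N D \<longrightarrow>
           (\<exists>a b. realizes N s (restrict_type N p D) a \<and> realizes N s' (restrict_type N q D) b \<and> \<Phi> [a, b]) \<and>
           (\<exists>a b. realizes N s (restrict_type N p D) a \<and> realizes N s' (restrict_type N q D) b \<and> \<not> \<Phi> [a, b])))"

text \<open>Exchange the coordinates of \<open>\<Phi>\<close>. With relations on tuples this is a
  reindexing, whereas \<open>orthogonal\<close> attaches fixed variables to its two
  arguments.\<close>

lemma non_orth_sym:
  assumes "non_orth \<kappa> N s p s' q"
  shows "non_orth \<kappa> N s' q s p"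
proof -
  obtain \<Phi> where \<Phi>: "dfn N (univ N) [s, s'] \<Phi>"
    "\<And>D. small \<kappa> N D \<Longrightarrow>
       (\<exists>a b. realizes N s (restrict_type N p D) a \<and> realizes N s' (restrict_type N q D) b \<and> \<Phi> [a, b]) \<and>
       (\<exists>a b. realizes N s (restrict_type N p D) a \<and> realizes N s' (restrict_type N q D) b \<and> \<not> \<Phi> [a, b])"
    using assms unfolding non_orth_def by blast
  let ?\<Psi> = "\<lambda>as. \<Phi> (map ((!) as) [1, 0])"
  have "dfn N (univ N) [s', s] ?\<Psi>" by (rule dfn_reindex[OF \<Phi>(1)]) auto
  moreover have "?\<Psi> [b, a] \<longleftrightarrow> \<Phi> [a, b]" for a b by simp
  ultimately show ?thesis unfolding non_orth_def using \<Phi>(2) by (intro exI[of _ ?\<Psi>]) metis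
qed

context regular_pair
begin

abbreviation xy where "xy \<equiv> [(s, 0 :: nat), (s', 1)]"

lemma xy: "distinct xy" "map fst xy = [s, s']" "set xy = {(s, 0), (s', 1)}" by simp_all

lemma sat_x: "\<phi> \<in> p \<Longrightarrow> sat N (val xy [a, b]) \<phi> \<longleftrightarrow> sat N (\<lambda>_. a) \<phi>"
  using sat_single[of \<phi> N "univ N" "(s, 0)" "val xy [a, b]" a] P.p_formulas by auto

lemma sat_y: "\<phi> \<in> q \<Longrightarrow> sat N (val xy [a, b]) (shift \<phi>) \<longleftrightarrow> sat N (\<lambda>_. b) \<phi>"
  using shift_formula(2)[of \<phi> N "univ N" s' "val xy [a, b]"] Q.p_formulas by auto

lemma union_formulas: "p \<union> shift ` q \<subseteq> formulas N (univ N) (set xy)"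
proof -
  have "p \<subseteq> formulas N (univ N) (set xy)"
    using P.p_formulas formulas_mono[of "univ N" "univ N" "{(s, 0)}" "set xy" N] by auto
  moreover have "shift \<phi> \<in> formulas N (univ N) (set xy)" if "\<phi> \<in> q" for \<phi>
    using shift_formula(1)[of \<phi> N "univ N" s'] Q.p_formulas that
      formulas_mono[of "univ N" "univ N" "{(s', 1)}" "set xy" N] by auto
  ultimately show ?thesis by blast
qed

lemma restrict_finite:
  assumes "finite \<Delta>" "\<And>\<phi>. \<phi> \<in> \<Delta> \<Longrightarrow> wf_fm N (univ N) \<phi>"
  shows "\<exists>F. finite F \<and> F \<subseteq> univ N \<and> (\<forall>\<phi>\<in>\<Delta>. wf_fm N F \<phi>)"
proof -
  have "\<forall>\<phi>\<in>\<Delta>. \<exists>F. F \<subseteq> univ N \<and> finite F \<and> wf_fm N F \<phi>"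
    using assms(2) wf_fm_finite_params by blast
  then obtain F where F: "\<forall>\<phi>\<in>\<Delta>. F \<phi> \<subseteq> univ N \<and> finite (F \<phi>) \<and> wf_fm N (F \<phi>) \<phi>"
    by (rule bchoice[THEN exE])
  then have "\<forall>\<phi>\<in>\<Delta>. wf_fm N (\<Union>\<phi>\<in>\<Delta>. F \<phi>) \<phi>" by (meson UN_upper wf_fm_mono)
  moreover have "finite (\<Union>\<phi>\<in>\<Delta>. F \<phi>)" "(\<Union>\<phi>\<in>\<Delta>. F \<phi>) \<subseteq> univ N" using F assms(1) by auto
  ultimately show ?thesis by blast
qed

text \<open>A finite part of the two types mentions a finite set \<open>F\<close> of parameters, so
  realizations over \<open>F\<close> satisfy it.\<close>

lemma fin_sat_union:
  assumes "\<And>D. P.sm D \<Longrightarrow> \<exists>a b. P.rl D a \<and> Q.rl D b \<and> sat N (val xy [a, b]) \<theta>"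
  shows "fin_sat N (set xy) (insert \<theta> (p \<union> shift ` q))"
  unfolding fin_sat_def
proof (intro allI impI, elim conjE)
  fix \<Delta> assume D: "finite \<Delta>" "\<Delta> \<subseteq> insert \<theta> (p \<union> shift ` q)"
  have "finite (\<Delta> \<inter> shift ` q)" using D(1) by simp
  then obtain G where G: "G \<subseteq> q" "finite G" "\<Delta> \<inter> shift ` q = shift ` G"
    using finite_subset_image[of "\<Delta> \<inter> shift ` q" shift q] by blast
  have "\<exists>F. finite F \<and> F \<subseteq> univ N \<and> (\<forall>\<phi>\<in>\<Delta> \<inter> p \<union> G. wf_fm N F \<phi>)"
  proof (rule restrict_finite)
    show "finite (\<Delta> \<inter> p \<union> G)" using D(1) G(2) by simp
    show "wf_fm N (univ N) \<phi>" if "\<phi> \<in> \<Delta> \<inter> p \<union> G" for \<phi>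
      using that G(1) P.p_formulas Q.p_formulas unfolding formulas_def by blast
  qed
  then obtain F where F: "finite F" "F \<subseteq> univ N" "\<forall>\<phi>\<in>\<Delta> \<inter> p \<union> G. wf_fm N F \<phi>" by blast
  then obtain a b where ab: "P.rl F a" "Q.rl F b" "sat N (val xy [a, b]) \<theta>"
    using assms[of F] P.sm_finite by blast
  have "sat N (val xy [a, b]) \<phi>" if \<phi>: "\<phi> \<in> \<Delta>" for \<phi>
  proof -
    consider "\<phi> = \<theta>" | "\<phi> \<in> \<Delta> \<inter> p" | \<psi> where "\<psi> \<in> G" "\<phi> = shift \<psi>" using \<phi> D(2) G(3) by blast
    then show ?thesis
    proof cases
      case 1
      then show ?thesis using ab(3) by simp
    next
      case 2
      then have "\<phi> \<in> restrict_type N p F" using F(3) by (simp add: restrict_type_def)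
      then have "sat N (\<lambda>_. a) \<phi>" using ab(1) by (simp add: P.rl_def realizes_def)
      then show ?thesis using sat_x[of \<phi>] 2 by blast
    next
      case 3
      then have "\<psi> \<in> restrict_type N q F" using F(3) G(1) by (auto simp: restrict_type_def)
      then have "sat N (\<lambda>_. b) \<psi>" using ab(2) by (simp add: Q.rl_def realizes_def)
      then show ?thesis using sat_y[of \<psi>] 3 G(1) by blast
    qed
  qed
  moreover have "assignment N (set xy) (val xy [a, b])"
    by (rule val_assignment[OF xy(1)])
      (use P.rl_univ[OF ab(1)] P.rl_sort[OF ab(1)] Q.rl_univ[OF ab(2)] Q.rl_sort[OF ab(2)] in simp)
  ultimately show "\<exists>e. assignment N (set xy) e \<and> (\<forall>\<phi>\<in>\<Delta>. sat N e \<phi>)" by blast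
qed

text \<open>\<open>u\<close> has all elements as parameters. Cut down to a small set that contains
  \<open>D\<close> and the parameters of \<open>\<theta>\<close>, it is realized by saturation in
  two variables.\<close>

lemma realize_pair:
  assumes "complete_type N (univ N) (set xy) u" "p \<union> shift ` q \<subseteq> u" "\<theta> \<in> u" "P.sm D"
  shows "\<exists>a b. P.rl D a \<and> Q.rl D b \<and> sat N (val xy [a, b]) \<theta>"
proof -
  have uf: "u \<subseteq> formulas N (univ N) (set xy)" using assms(1) by (simp add: complete_type_def)
  then have "wf_fm N (univ N) \<theta>" using assms(3) unfolding formulas_def by blast
  from wf_fm_finite_params[OF this]
  obtain F where F: "F \<subseteq> univ N" "finite F" "wf_fm N F \<theta>" by (elim exE conjE)
  define E where "E = D \<union> F"
  have E: "P.sm E" unfolding E_def by (rule P.sm_Un[OF assms(4) P.sm_finite[OF F(2,1)]])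
  define g where "g = (\<lambda>\<phi> as. sat N (val xy as) \<phi>)"
  define v where "v = {\<phi> \<in> u. wf_fm N E \<phi>}"
  have vf: "\<phi> \<in> formulas N E (set xy)" if "\<phi> \<in> v" for \<phi>
    using that uf unfolding v_def formulas_def by blast
  have "\<exists>as\<in>tuples N [s, s']. \<forall>T\<in>g ` v. T as"
  proof (rule P.realize_family[OF E])
    show "set [s, s'] \<subseteq> sorts N" using P.s_sort Q.s_sort by simp
    fix T assume "T \<in> g ` v"
    then obtain \<phi> where p: "\<phi> \<in> v" "T = g \<phi>" by blast
    show "dfn N E [s, s'] T" unfolding p(2) g_def
      by (rule dfnI[OF xy(1,2) vf[OF p(1)]]) simp
  next
    fix G assume G: "finite G" "G \<subseteq> g ` v"
    obtain \<Delta> where \<Delta>: "\<Delta> \<subseteq> v" "finite \<Delta>" "G = g ` \<Delta>" using finite_subset_image[OF G] by blast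
    have "\<Delta> \<subseteq> u" using \<Delta>(1) unfolding v_def by blast
    then obtain e where e: "assignment N (set xy) e" "\<forall>\<phi>\<in>\<Delta>. sat N e \<phi>"
      using assms(1) \<Delta>(2) unfolding complete_type_def by blast
    have "map e xy \<in> tuples N [s, s']" using assignment_tuple[OF e(1)] by simp
    moreover have "sat N (val xy (map e xy)) \<phi>" if "\<phi> \<in> \<Delta>" for \<phi>
    proof -
      have "fv \<phi> \<subseteq> set xy" using vf that \<Delta>(1) unfolding formulas_def by blast
      then have "sat N (val xy (map e xy)) \<phi> \<longleftrightarrow> sat N e \<phi>"
        by (intro sat_cong val_map) (rule subsetD)
      then show ?thesis using e(2) that by blast
    qed
    ultimately show "\<exists>as\<in>tuples N [s, s']. \<forall>T\<in>G. T as" unfolding \<Delta>(3) g_def by blast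
  qed
  then obtain as where as: "as \<in> tuples N [s, s']" "\<forall>T\<in>g ` v. T as" by (rule bexE)
  from as(1) obtain a b where ab: "as = [a, b]" "a \<in> univ N" "sort_of N a = s" "b \<in> univ N" "sort_of N b = s'"
    unfolding tuples_Cons tuples_Nil by blast
  have sv: "sat N (val xy [a, b]) \<phi>" if "\<phi> \<in> u" "wf_fm N E \<phi>" for \<phi>
  proof -
    have "g \<phi> \<in> g ` v" using that unfolding v_def by blast
    from bspec[OF as(2) this] show ?thesis unfolding g_def ab(1) .
  qed
  have "sat N (\<lambda>_. a) \<phi>" if "\<phi> \<in> restrict_type N p D" for \<phi>
  proof -
    have "\<phi> \<in> p" "wf_fm N E \<phi>" using that wf_fm_mono[of N D \<phi> E] unfolding restrict_type_def E_def by auto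
    then show ?thesis using sv[of \<phi>] sat_x[of \<phi>] assms(2) by blast
  qed
  then have "P.rl D a" using ab by (simp add: P.rl_def realizes_def)
  moreover have "sat N (\<lambda>_. b) \<phi>" if "\<phi> \<in> restrict_type N q D" for \<phi>
  proof -
    have q: "\<phi> \<in> q" "wf_fm N E \<phi>" using that wf_fm_mono[of N D \<phi> E] unfolding restrict_type_def E_def by auto
    then have "\<phi> \<in> formulas N E {(s', 0)}" using Q.p_formulas unfolding formulas_def by blast
    from shift_formula(1)[OF this] have "wf_fm N E (shift \<phi>)" by (simp add: formulas_def)
    then show ?thesis using sv[of "shift \<phi>"] sat_y[OF q(1)] q(1) assms(2) by blast
  qed
  then have "Q.rl D b" using ab by (simp add: Q.rl_def realizes_def)
  moreover have "wf_fm N E \<theta>" using F(3) by (rule wf_fm_mono) (simp add: E_def)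
  ultimately show ?thesis using sv[OF assms(3)] by blast
qed

lemma not_orthogonal_iff: "\<not> orthogonal N s p s' q \<longleftrightarrow> non_orth \<kappa> N s p s' q"
proof
  assume no: "\<not> orthogonal N s p s' q"
  let ?C = "\<lambda>u. complete_type N (univ N) (set xy) u \<and> p \<union> shift ` q \<subseteq> u"
  have nu: "\<not> (\<exists>!u. ?C u)" using no unfolding orthogonal_def weakly_orthogonal_def xy(3) .
  \<comment> \<open>A formula that always holds, so that \<open>fin_sat_union\<close> yields the
    consistency of the union alone.\<close>
  let ?t = "Eq (Var (s, 0)) (Var (s, 0))"
  have "fin_sat N (set xy) (insert ?t (p \<union> shift ` q))"
    by (rule fin_sat_union) (use P.rl_ex Q.rl_ex in auto)
  moreover have "insert ?t (p \<union> shift ` q) \<subseteq> formulas N (univ N) (set xy)"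
    using union_formulas P.s_sort by (simp add: formulas_def)
  ultimately obtain u0 where u0: "?C u0"
    using extend_to_complete_type[of "insert ?t (p \<union> shift ` q)" N "univ N" "set xy"] by blast
  have "\<exists>u1. ?C u1 \<and> u0 \<noteq> u1"
  proof (rule ccontr)
    assume n: "\<nexists>u1. ?C u1 \<and> u0 \<noteq> u1"
    have "\<exists>!u. ?C u"
    proof (rule ex1I[of _ u0])
      fix u assume "?C u"
      then show "u = u0" using n by (metis (no_types))
    qed (rule u0)
    then show False using nu by (rule notE[rotated])
  qed
  then obtain u1 where u1: "?C u1 \<and> u0 \<noteq> u1" by (rule exE)
  note u = u0 conjunct1[OF u1] conjunct2[OF u1]
  have dec: "\<phi> \<in> u \<or> Neg \<phi> \<in> u" if "?C u" "\<phi> \<in> formulas N (univ N) (set xy)" for u \<phi>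
    using that unfolding complete_type_def by blast
  have sub: "\<phi> \<in> formulas N (univ N) (set xy)" if "?C u" "\<phi> \<in> u" for u \<phi>
    using that unfolding complete_type_def by blast
  \<comment> \<open>Two distinct complete types disagree on some formula; the two cases settle which
    of them contains it and which its negation.\<close>
  have "\<exists>u u' \<phi>. ?C u \<and> ?C u' \<and> \<phi> \<in> u \<and> Neg \<phi> \<in> u'"
  proof (cases "u0 \<subseteq> u1")
    case True
    then obtain \<phi> where "\<phi> \<in> u1" "\<phi> \<notin> u0" using u(3) by blast
    then have "Neg \<phi> \<in> u0" using dec[OF u(1)] sub[OF u(2)] by blast
    then show ?thesis using u \<open>\<phi> \<in> u1\<close> by blast
  next
    case False
    then obtain \<phi> where "\<phi> \<in> u0" "\<phi> \<notin> u1" by blast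
    then have "Neg \<phi> \<in> u1" using dec[OF u(2)] sub[OF u(1)] by blast
    then show ?thesis using u \<open>\<phi> \<in> u0\<close> by blast
  qed
  then obtain u u' \<phi> where c: "?C u" "?C u'" "\<phi> \<in> u" "Neg \<phi> \<in> u'" by blast
  have pf: "\<phi> \<in> formulas N (univ N) (set xy)" using sub[OF c(1,3)] .
  show "non_orth \<kappa> N s p s' q"
    unfolding non_orth_def P.rl_def[symmetric] Q.rl_def[symmetric]
  proof (intro exI[of _ "\<lambda>as. sat N (val xy as) \<phi>"] conjI allI impI)
    show "dfn N (univ N) [s, s'] (\<lambda>as. sat N (val xy as) \<phi>)"
      by (rule dfnI[OF xy(1,2) pf]) simp
    fix D assume D: "P.sm D"
    show "\<exists>a b. P.rl D a \<and> Q.rl D b \<and> sat N (val xy [a, b]) \<phi>"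
      by (rule realize_pair[OF conjunct1[OF c(1)] conjunct2[OF c(1)] c(3) D])
    show "\<exists>a b. P.rl D a \<and> Q.rl D b \<and> \<not> sat N (val xy [a, b]) \<phi>"
      using realize_pair[OF conjunct1[OF c(2)] conjunct2[OF c(2)] c(4) D] unfolding sat.simps(3) .
  qed
next
  assume "non_orth \<kappa> N s p s' q"
  then obtain \<Phi> where \<Phi>: "dfn N (univ N) [s, s'] \<Phi>"
    "\<And>D. P.sm D \<Longrightarrow> (\<exists>a b. P.rl D a \<and> Q.rl D b \<and> \<Phi> [a, b]) \<and> (\<exists>a b. P.rl D a \<and> Q.rl D b \<and> \<not> \<Phi> [a, b])"
    unfolding non_orth_def P.rl_def[symmetric] Q.rl_def[symmetric] by blast
  obtain \<phi> where p: "\<phi> \<in> formulas N (univ N) (set xy)"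
    "\<And>as. as \<in> tuples N [s, s'] \<Longrightarrow> \<Phi> as \<longleftrightarrow> sat N (val xy as) \<phi>"
    by (rule dfnE[OF \<Phi>(1) xy(1,2)]) (rule that)
  have v: "\<Phi> [a, b] \<longleftrightarrow> sat N (val xy [a, b]) \<phi>" if ab: "P.rl D a" "Q.rl D b" for D a b
    using p(2)[of "[a, b]"] P.rl_univ[OF ab(1)] P.rl_sort[OF ab(1)] Q.rl_univ[OF ab(2)] Q.rl_sort[OF ab(2)]
    by simp
  have n: "Neg \<phi> \<in> formulas N (univ N) (set xy)" using p(1) by (simp add: formulas_def)
  have 1: "fin_sat N (set xy) (insert \<phi> (p \<union> shift ` q))"
    by (rule fin_sat_union) (use \<Phi>(2) v in blast)
  have 2: "fin_sat N (set xy) (insert (Neg \<phi>) (p \<union> shift ` q))"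
    by (rule fin_sat_union) (unfold sat.simps(3), use \<Phi>(2) v in blast)
  obtain u1 where u1: "complete_type N (univ N) (set xy) u1" "insert \<phi> (p \<union> shift ` q) \<subseteq> u1"
    using extend_to_complete_type[OF _ 1, of "univ N"] p(1) union_formulas by blast
  obtain u2 where u2: "complete_type N (univ N) (set xy) u2" "insert (Neg \<phi>) (p \<union> shift ` q) \<subseteq> u2"
    using extend_to_complete_type[OF _ 2, of "univ N"] n union_formulas by blast
  have "u1 \<noteq> u2"
  proof
    assume "u1 = u2"
    then have "{\<phi>, Neg \<phi>} \<subseteq> u1" using u1(2) u2(2) by blast
    moreover have "finite {\<phi>, Neg \<phi>}" by simp
    ultimately obtain e where "\<forall>\<psi>\<in>{\<phi>, Neg \<phi>}. sat N e \<psi>"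
      using u1(1) unfolding complete_type_def by blast
    then show False by simp
  qed
  then show "\<not> orthogonal N s p s' q"
    unfolding orthogonal_def weakly_orthogonal_def xy(3)[symmetric] using u1 u2 by blast
qed

text \<open>All pairs with \<open>b\<close> realizing \<open>q\<close> over \<open>C\<close> and
  \<open>a\<close> realizing \<open>p\<close> over \<open>C\<close> and \<open>b\<close> have the
  same type over \<open>C\<close>, so the undecided formula has one truth value on them. The formula
  or its negation, whichever is false there, expresses dependence.\<close>

lemma ex_dependent_pair:
  assumes "non_orth \<kappa> N s p s' q"
  shows "\<exists>C \<Phi>. A \<subseteq> C \<and> P.sm C \<and> dependent_pair N \<kappa> s p s' q C \<Phi>"
proof -
  obtain \<Phi> where \<Phi>: "dfn N (univ N) [s, s'] \<Phi>"
    "\<And>D. P.sm D \<Longrightarrow> \<exists>a b. P.rl D a \<and> Q.rl D b \<and> \<Phi> [a, b]"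
    "\<And>D. P.sm D \<Longrightarrow> \<exists>a b. P.rl D a \<and> Q.rl D b \<and> \<not> \<Phi> [a, b]"
    using assms unfolding non_orth_def P.rl_def[symmetric] Q.rl_def[symmetric] by blast
  obtain F where F: "F \<subseteq> univ N" "finite F" "dfn N F [s, s'] \<Phi>"
    using dfn_finite_params[OF \<Phi>(1)] by blast
  define C where "C = A \<union> F"
  have C: "A \<subseteq> C" "P.sm C" unfolding C_def using P.sm_Un[OF P.sm_A P.sm_finite[OF F(2,1)]] by simp_all
  have uC: "C \<subseteq> univ N" using C(2) by (rule P.sm_univ)
  obtain b0 where b0: "Q.rl C b0" using Q.rl_ex[OF C(2)] by blast
  have "P.sm (insert b0 C)"
    using P.sm_Un[OF C(2) P.sm_finite[of "{b0}"]] Q.rl_univ[OF b0] by simp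
  then obtain a0 where a0: "P.rl (insert b0 C) a0" using P.rl_ex by blast
  have "\<exists>\<Psi>. dfn N C [s, s'] \<Psi> \<and> (\<forall>D. P.sm D \<longrightarrow> (\<exists>a b. P.rl D a \<and> Q.rl D b \<and> \<Psi> [a, b])) \<and> \<not> \<Psi> [a0, b0]"
  proof -
    have d: "dfn N C [s, s'] \<Phi>" by (rule dfn_mono[OF F(3)]) (simp add: C_def)
    show ?thesis
    proof (cases "\<Phi> [a0, b0]")
      case True
      then show ?thesis using dfn_neg[OF d] \<Phi>(3) by (intro exI[of _ "\<lambda>as. \<not> \<Phi> as"]) simp
    next
      case False
      then show ?thesis using d \<Phi>(2) by (intro exI[of _ \<Phi>]) simp
    qed
  qed
  then obtain \<Psi> where \<Psi>: "dfn N C [s, s'] \<Psi>"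
    "\<And>D. P.sm D \<Longrightarrow> \<exists>a b. P.rl D a \<and> Q.rl D b \<and> \<Psi> [a, b]" "\<not> \<Psi> [a0, b0]" by blast
  interpret PC: regular_type N \<kappa> s p C by (rule P.regular_mono[OF C])
  interpret QC: regular_type N \<kappa> s' q C by (rule Q.regular_mono[OF C])
  have "dependent_pair N \<kappa> s p s' q C \<Psi>"
  proof unfold_locales
    show "dfn N C [s, s'] \<Psi>" by (rule \<Psi>(1))
    show "\<exists>a b. P.rl D a \<and> Q.rl D b \<and> \<Psi> [a, b]" if "P.sm D" "C \<subseteq> D" for D
      by (rule \<Psi>(2)[OF that(1)])
    show "\<not> \<Psi> [a, b]" if ab: "P.rl (insert b C) a" "Q.rl C b" for a b
    proof -
      have "EQ N C [b] [b0]"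
        using Q.EQ_Cons_rl[OF C(1) uC P.EQ_refl[of "[]"], of b b0] ab(2) b0 by simp
      then have "EQ N C [a, b] [a0, b0]"
        using P.EQ_Cons_rl[OF C(1) uC, of "[b]" "[b0]" a a0] ab(1) a0 by simp
      moreover have "[a, b] \<in> tuples N [s, s']"
        using P.rl_univ[OF ab(1)] P.rl_sort[OF ab(1)] Q.rl_univ[OF ab(2)] Q.rl_sort[OF ab(2)] by simp
      ultimately show ?thesis using P.EQ_D[OF _ _ \<Psi>(1)] \<Psi>(3) by blast
    qed
  qed
  then show ?thesis using C by blast
qed

end

text \<open>Equality is undecided: it holds between a realization and itself, and fails between
  \<open>a\<close> and a realization over a base that contains \<open>a\<close>.\<close>

lemma (in regular_type) non_orth_refl: "non_orth \<kappa> N s p s p"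
  unfolding non_orth_def rl_def[symmetric]
proof (intro exI[of _ "\<lambda>as. as ! 0 = as ! 1"] conjI allI impI)
  show "dfn N (univ N) [s, s] (\<lambda>as. as ! 0 = as ! 1)" by (rule dfn_eq[OF s_sort])
  fix D assume D: "sm D"
  obtain a where a: "rl D a" using rl_ex[OF D] by blast
  then show "\<exists>a b. rl D a \<and> rl D b \<and> [a, b] ! 0 = [a, b] ! 1" by auto
  have Da: "sm (insert a D)" using sm_Un[OF D sm_finite[of "{a}"]] rl_univ[OF a] by simp
  obtain b where b: "rl (insert a D) b" using rl_ex[OF Da] by blast
  then have "b \<noteq> a" by (rule rl_neq) (use sm_univ[OF Da] in simp_all)
  then show "\<exists>a b. rl D a \<and> rl D b \<and> [a, b] ! 0 \<noteq> [a, b] ! 1"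
    using a rl_mono[OF b, of D] by (intro exI[of _ a] exI[of _ b]) auto
qed

text \<open>If \<open>p\<close> and \<open>t\<close> were orthogonal, the composition of
  \<open>\<Phi>\<close> and \<open>\<Psi>\<close> through realizations of \<open>q\<close>, which
  holds for some pairs, would also hold for an independent pair \<open>(a0, c0)\<close>. A middle
  element \<open>b\<close> would then realize \<open>q\<close> over \<open>c0\<close> by
  \<open>dependent_over\<close>, because \<open>a0\<close> realizes \<open>p\<close> over
  \<open>c0\<close>; this contradicts \<open>\<Psi>(b, c0)\<close>.\<close>

lemma (in maximal_dependent_pair) non_orth_trans:
  assumes "dependent_pair N \<kappa> s' q s'' t A \<Psi>"
  shows "non_orth \<kappa> N s p s'' t"
proof (rule ccontr)
  assume no: "\<not> non_orth \<kappa> N s p s'' t"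
  interpret QR: dependent_pair N \<kappa> s' q s'' t A \<Psi> by (rule assms)
  \<comment> \<open>\<open>\<rho>\<close> will be a formula of \<open>q\<close> over
    \<open>A\<close> imposed on the middle element. That one middle element can satisfy all of them
    follows by compactness.\<close>
  define \<Theta> where "\<Theta> = (\<lambda>\<rho> as. \<exists>y\<in>univ N. sort_of N y = s' \<and>
    (\<Phi> (map ((!) (y # as)) [1, 0]) \<and> \<Psi> (map ((!) (y # as)) [0, 2]) \<and> \<rho> (map ((!) (y # as)) [0])))"
  have d\<Theta>: "dfn N A [s, s''] (\<Theta> \<rho>)" if "dfn N A [s'] \<rho>" for \<rho>
    unfolding \<Theta>_def
  proof (rule dfn_ex[OF _ Q.s_sort], intro dfn_conj)
    show "dfn N A [s', s, s''] (\<lambda>as. \<Phi> (map ((!) as) [1, 0]))" by (rule dfn_reindex[OF dfn_\<Phi>]) auto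
    show "dfn N A [s', s, s''] (\<lambda>as. \<Psi> (map ((!) as) [0, 2]))" by (rule dfn_reindex[OF QR.dfn_\<Phi>]) auto
    show "dfn N A [s', s, s''] (\<lambda>as. \<rho> (map ((!) as) [0]))" by (rule dfn_reindex[OF that]) auto
  qed
  have \<Theta>: "\<Theta> \<rho> [a, c] \<longleftrightarrow> (\<exists>y\<in>univ N. sort_of N y = s' \<and> \<Phi> [a, y] \<and> \<Psi> [y, c] \<and> \<rho> [y])" for \<rho> a c
    unfolding \<Theta>_def by simp
  obtain c0 where c0: "QR.Q.rl A c0" using QR.Q.rl_ex[OF P.sm_A] by blast
  have sc0: "P.sm (insert c0 A)" by (rule sm_insert[OF P.sm_A QR.Q.rl_univ[OF c0]])
  obtain a0 where a0: "P.rl (insert c0 A) a0" using P.rl_ex[OF sc0] by blast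
  have a0c0: "\<Theta> \<rho> [a0, c0]" if r: "dfn N A [s'] \<rho>" "Q.inp \<rho>" for \<rho>
  proof -
    \<comment> \<open>Since \<open>\<Theta> \<rho>\<close> does not witness non-orthogonality, it
      takes a single truth value on realizations over some small \<open>D\<close>.\<close>
    obtain D where D: "P.sm D"
      "\<not> (\<exists>a b. P.rl D a \<and> QR.Q.rl D b \<and> \<Theta> \<rho> [a, b]) \<or> \<not> (\<exists>a b. P.rl D a \<and> QR.Q.rl D b \<and> \<not> \<Theta> \<rho> [a, b])"
      using no dfn_mono[OF d\<Theta>[OF r(1)] A_univ]
      unfolding non_orth_def P.rl_def[symmetric] QR.Q.rl_def[symmetric] by blast
    have E: "P.sm (A \<union> D)" by (rule P.sm_Un[OF P.sm_A D(1)])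
    obtain b c where bc: "Q.rl (A \<union> D) b" "QR.Q.rl (A \<union> D) c" "\<Psi> [b, c]"
      using QR.cofinal[OF E] by blast
    obtain a where a: "P.rl (A \<union> D) a" "\<Phi> [a, b]" using cofinal_at[OF E _ bc(1)] by blast
    have "\<rho> [b]" using Q.rl_D[OF Q.rl_mono[OF bc(1), of A] r(1) A_univ] r(2) by simp
    then have "\<Theta> \<rho> [a, c]" unfolding \<Theta> using a(2) bc(3) Q.rl_univ[OF bc(1)] Q.rl_sort[OF bc(1)] by blast
    then have all: "\<Theta> \<rho> [x, z]" if "P.rl D x" "QR.Q.rl D z" for x z
      using D(2) P.rl_mono[OF a(1), of D] QR.Q.rl_mono[OF bc(2), of D] that by blast
    \<comment> \<open>That truth value is true, as the dependent chain \<open>a\<close>,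
      \<open>b\<close>, \<open>c\<close> shows. It also applies to \<open>x\<close>, chosen
      independent from \<open>c\<close>, and \<open>(x, c)\<close> has the type of
      \<open>(a0, c0)\<close> over \<open>A\<close>.\<close>
    obtain x where x: "P.rl (insert c (A \<union> D)) x"
      using P.rl_ex[OF sm_insert[OF E QR.Q.rl_univ[OF bc(2)]]] by blast
    have xc: "\<Theta> \<rho> [x, c]"
      by (rule all) (use P.rl_mono[OF x, of D] QR.Q.rl_mono[OF bc(2), of D] in auto)
    have "EQ N A [c] [c0]"
      using QR.Q.EQ_Cons_rl[OF subset_refl A_univ P.EQ_refl[of "[]"], of c c0]
        QR.Q.rl_mono[OF bc(2), of A] c0 by simp
    then have "EQ N A [x, c] [a0, c0]"
      using P.EQ_Cons_rl[OF subset_refl A_univ, of "[c]" "[c0]" x a0] P.rl_mono[OF x, of "insert c A"] a0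
      by auto
    moreover have "[x, c] \<in> tuples N [s, s'']"
      using P.rl_univ[OF x] P.rl_sort[OF x] QR.Q.rl_univ[OF bc(2)] QR.Q.rl_sort[OF bc(2)] by simp
    ultimately show ?thesis using P.EQ_D[OF _ _ d\<Theta>[OF r(1)]] xc by blast
  qed
  define \<R>0 where "\<R>0 = {R. dfn N A [s'] R \<and> Q.inp R}"
  define R1 where "R1 = (\<lambda>xs :: 'a list. \<Phi> [a0, xs ! 0])"
  define R2 where "R2 = (\<lambda>xs :: 'a list. \<Psi> (xs @ [c0]))"
  define E where "E = insert a0 (insert c0 A)"
  have E: "P.sm E" unfolding E_def by (rule sm_insert[OF sc0 P.rl_univ[OF a0]])
  have "\<exists>xs\<in>tuples N [s']. \<forall>R\<in>\<R>0 \<union> {R1, R2}. R xs"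
  proof (rule P.realize_one[OF E Q.s_sort])
    fix R assume "R \<in> \<R>0 \<union> {R1, R2}"
    then consider "R \<in> \<R>0" | "R = R1" | "R = R2" by blast
    then show "dfn N E [s'] R"
    proof cases
      case 1
      then have "dfn N A [s'] R" unfolding \<R>0_def by blast
      then show ?thesis by (rule dfn_mono) (auto simp: E_def)
    next
      case 2
      show ?thesis unfolding 2 R1_def
        by (rule dfn_mono[OF fibre_right[OF P.rl_univ[OF a0] P.rl_sort[OF a0]]]) (auto simp: E_def)
    next
      case 3
      show ?thesis unfolding 3 R2_def
        by (rule dfn_mono[OF QR.fibre_left[OF QR.Q.rl_univ[OF c0] QR.Q.rl_sort[OF c0]]]) (auto simp: E_def)
    qed
  next
    fix F assume F: "finite F" "F \<subseteq> \<R>0 \<union> {R1, R2}"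
    \<comment> \<open>Finitely many formulas of \<open>q\<close> are merged into one
      \<open>\<rho>\<close>; the requirements \<open>R1\<close> and \<open>R2\<close> are already
      part of \<open>\<Theta>\<close>.\<close>
    let ?\<rho> = "\<lambda>xs. \<forall>R\<in>F \<inter> \<R>0. R xs"
    have dr: "dfn N A [s'] ?\<rho>"
      by (rule dfn_ball_finite[OF P.sorts_nonempty]) (use F(1) in \<open>auto simp: \<R>0_def\<close>)
    obtain b where b: "Q.rl A b" using Q.rl_ex[OF P.sm_A] by blast
    have "R [b]" if "R \<in> F \<inter> \<R>0" for R
    proof -
      have "dfn N A [s'] R" "Q.inp R" using that unfolding \<R>0_def by blast+
      then show ?thesis using Q.rl_D[OF b _ A_univ, of R] by blast
    qed
    then have "?\<rho> [b]" by blast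
    then have "Q.inp ?\<rho>" using Q.rl_D[OF b dr A_univ] by blast
    then obtain y where y: "y \<in> univ N" "sort_of N y = s'" "\<Phi> [a0, y]" "\<Psi> [y, c0]" "?\<rho> [y]"
      using a0c0[OF dr] unfolding \<Theta> by blast
    have "R1 [y]" "R2 [y]" using y(3,4) by (simp_all add: R1_def R2_def)
    then have "\<forall>R\<in>F. R [y]" using y(5) F(2) by blast
    then show "\<exists>xs\<in>tuples N [s']. \<forall>R\<in>F. R xs" using y(1,2) by (intro bexI[of _ "[y]"]) simp_all
  qed
  then obtain xs where xs: "xs \<in> tuples N [s']" "\<forall>R\<in>\<R>0 \<union> {R1, R2}. R xs" by (rule bexE)
  from xs(1) obtain b where b: "xs = [b]" "b \<in> univ N" "sort_of N b = s'"
    unfolding tuples_Cons tuples_Nil by blast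
  have "R [b]" if "dfn N A [s'] R" "Q.inp R" for R
    using bspec[OF xs(2), of R] that b(1) unfolding \<R>0_def by simp
  then have Qb: "Q.rl A b" unfolding Q.rl_iff[OF A_univ] using b by blast
  have "R1 xs" "R2 xs" using xs(2) by blast+
  then have "\<Phi> [a0, b]" "\<Psi> [b, c0]" unfolding b(1) R1_def R2_def by simp_all
  then have "Q.rl (insert c0 A) b" using dependent_over[OF sc0 subset_insertI a0 Qb] by simp
  then show False using QR.dependent[OF _ c0] \<open>\<Psi> [b, c0]\<close> by blast
qed

section \<open>The theorem for saturated structures\<close>

context saturated_structure
begin

lemma regular_locale:
  assumes "regular \<kappa> N s p"
  obtains A where "regular_type N \<kappa> s p A" "sm A"
  using assms regular_over_locale unfolding regular_def regular_over_def by blast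

lemma generically_stable_gs_over:
  assumes "generically_stable \<kappa> N s p"
  obtains A where "sm A" "gs_over N s p A"
  using assms unfolding generically_stable_def gs_over_def by blast

lemma gs_over_generically_stable:
  assumes "regular_type N \<kappa> s p A" "gs_over N s p A"
  shows "generically_stable \<kappa> N s p"
proof -
  interpret regular_type N \<kappa> s p A by (rule assms(1))
  show ?thesis
    unfolding generically_stable_def using gt na sm_A inv assms(2)[unfolded gs_over_def] by blast
qed

text \<open>All bases are merged before \<open>\<Phi>\<close> and \<open>k\<close> are chosen. The
  extra set \<open>B\<close> allows one pair to be built over the base of another, as transitivity
  requires.\<close>

lemma ex_maximal_pair:
  assumes "regular \<kappa> N s p" "regular \<kappa> N s' q" "\<not> orthogonal N s p s' q" "generically_stable \<kappa> N s p" "sm B"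
  shows "\<exists>C \<Phi> k. B \<subseteq> C \<and> gs_over N s p C \<and> maximal_dependent_pair N \<kappa> s p s' q C \<Phi> k"
proof -
  obtain A1 where A1: "regular_type N \<kappa> s p A1" "sm A1" using regular_locale[OF assms(1)] .
  obtain A2 where A2: "regular_type N \<kappa> s' q A2" "sm A2" using regular_locale[OF assms(2)] .
  obtain A3 where A3: "sm A3" "gs_over N s p A3" using generically_stable_gs_over[OF assms(4)] .
  define A where "A = A1 \<union> A2 \<union> A3 \<union> B"
  have A: "sm A" unfolding A_def by (intro sm_Un[OF sm_Un[OF sm_Un]] A1(2) A2(2) A3(1) assms(5))
  interpret P: regular_type N \<kappa> s p A
    by (rule regular_type.regular_mono[OF A1(1) _ A]) (auto simp: A_def)
  interpret Q: regular_type N \<kappa> s' q A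
    by (rule regular_type.regular_mono[OF A2(1) _ A]) (auto simp: A_def)
  interpret PQ: regular_pair N \<kappa> s p s' q A ..
  have "non_orth \<kappa> N s p s' q" using assms(3) PQ.not_orthogonal_iff by simp
  then obtain C \<Phi> where C: "A \<subseteq> C" "sm C" "dependent_pair N \<kappa> s p s' q C \<Phi>"
    using PQ.ex_dependent_pair by blast
  have gs: "gs_over N s p C" by (rule gs_over_mono[OF A3(2)]) (use C(1) in \<open>auto simp: A_def\<close>)
  obtain k D where D: "C \<subseteq> D" "maximal_dependent_pair N \<kappa> s p s' q D \<Phi> k"
    using dependent_pair.ex_maximal[OF C(3) gs] by blast
  have "B \<subseteq> D" using D(1) C(1) by (auto simp: A_def)
  then show ?thesis using D(2) gs_over_mono[OF gs D(1)] by blast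
qed

theorem generically_stable_transfer:
  assumes "regular \<kappa> N s p" "regular \<kappa> N s' q" "\<not> orthogonal N s p s' q" "generically_stable \<kappa> N s p"
  shows "generically_stable \<kappa> N s' q"
proof -
  obtain C \<Phi> k where C: "gs_over N s p C" "maximal_dependent_pair N \<kappa> s p s' q C \<Phi> k"
    using ex_maximal_pair[OF assms sm_finite[of "{}"]] by auto
  interpret maximal_dependent_pair N \<kappa> s p s' q C \<Phi> k by (rule C(2))
  show ?thesis
    by (rule gs_over_generically_stable[OF _ gs_over_transfer[OF C(1)]]) unfold_locales
qed

lemma orthogonal_iff:
  assumes "regular \<kappa> N s p" "regular \<kappa> N s' q"
  shows "\<not> orthogonal N s p s' q \<longleftrightarrow> non_orth \<kappa> N s p s' q"
proof -
  obtain A1 where A1: "regular_type N \<kappa> s p A1" "sm A1" using regular_locale[OF assms(1)] .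
  obtain A2 where A2: "regular_type N \<kappa> s' q A2" "sm A2" using regular_locale[OF assms(2)] .
  have A: "sm (A1 \<union> A2)" by (rule sm_Un[OF A1(2) A2(2)])
  interpret P: regular_type N \<kappa> s p "A1 \<union> A2" by (rule regular_type.regular_mono[OF A1(1) _ A]) simp
  interpret Q: regular_type N \<kappa> s' q "A1 \<union> A2" by (rule regular_type.regular_mono[OF A2(1) _ A]) simp
  interpret PQ: regular_pair N \<kappa> s p s' q "A1 \<union> A2" ..
  show ?thesis by (rule PQ.not_orthogonal_iff)
qed

lemma not_orthogonal_trans:
  assumes "regular \<kappa> N s p" "regular \<kappa> N s' q" "regular \<kappa> N s'' t"
    and "generically_stable \<kappa> N s p" "generically_stable \<kappa> N s' q"
    and "\<not> orthogonal N s p s' q" "\<not> orthogonal N s' q s'' t"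
  shows "\<not> orthogonal N s p s'' t"
proof -
  \<comment> \<open>Being a dependent pair passes to larger bases. So \<open>\<Psi>\<close> is
    chosen first, and the maximal pair for \<open>\<Phi>\<close> over a base that contains that of
    \<open>\<Psi>\<close>.\<close>
  obtain C \<Psi> k where C: "maximal_dependent_pair N \<kappa> s' q s'' t C \<Psi> k"
    using ex_maximal_pair[OF assms(2,3,7,5) sm_finite[of "{}"]] by auto
  interpret QR: maximal_dependent_pair N \<kappa> s' q s'' t C \<Psi> k by (rule C)
  obtain D \<Phi> l where D: "C \<subseteq> D" "maximal_dependent_pair N \<kappa> s p s' q D \<Phi> l"
    using ex_maximal_pair[OF assms(1,2,6,4) QR.P.sm_A] by blast
  interpret PQ: maximal_dependent_pair N \<kappa> s p s' q D \<Phi> l by (rule D(2))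
  have "dependent_pair N \<kappa> s' q s'' t D \<Psi>" by (rule QR.dependent_pair_mono[OF D(1) PQ.P.sm_A])
  then have "non_orth \<kappa> N s p s'' t" by (rule PQ.non_orth_trans)
  then show ?thesis using orthogonal_iff[OF assms(1,3)] by simp
qed

lemma not_orthogonal_sym:
  assumes "regular \<kappa> N s p" "regular \<kappa> N s' q" "\<not> orthogonal N s p s' q"
  shows "\<not> orthogonal N s' q s p"
  using assms orthogonal_iff non_orth_sym by metis

lemma not_orthogonal_refl:
  assumes "regular \<kappa> N s p"
  shows "\<not> orthogonal N s p s p"
proof -
  obtain A where "regular_type N \<kappa> s p A" "sm A" using regular_locale[OF assms] .
  then show ?thesis using regular_type.non_orth_refl[of N \<kappa> s p A] orthogonal_iff[OF assms assms] by simp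
qed

end

section \<open>Saturation of the imaginary expansion\<close>

lemma sat_Exists_list:
  assumes "distinct ws"
  shows "sat M e (foldr Exists ws \<psi>) \<longleftrightarrow>
    (\<exists>ds\<in>tuples M (map fst ws). sat M (\<lambda>w. if w \<in> set ws then val ws ds w else e w) \<psi>)"
  using assms
proof (induction ws arbitrary: e)
  case (Cons w ws)
  have ov: "(\<lambda>x. if x \<in> set ws then val ws ds x else (e(w := d)) x) =
            (\<lambda>x. if x \<in> set (w # ws) then val (w # ws) (d # ds) x else e x)" for d ds
    using Cons.prems by (auto simp: fun_eq_iff)
  have IH: "sat M (e(w := d)) (foldr Exists ws \<psi>) \<longleftrightarrow> (\<exists>ds\<in>tuples M (map fst ws).
      sat M (\<lambda>x. if x \<in> set ws then val ws ds x else (e(w := d)) x) \<psi>)" for d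
    by (rule Cons.IH) (use Cons.prems in simp)
  have "sat M e (foldr Exists (w # ws) \<psi>) \<longleftrightarrow>
    (\<exists>d\<in>univ M. sort_of M d = fst w \<and> (\<exists>ds\<in>tuples M (map fst ws).
       sat M (\<lambda>x. if x \<in> set (w # ws) then val (w # ws) (d # ds) x else e x) \<psi>))"
    by (simp only: foldr.simps o_apply sat.simps IH[unfolded ov])
  also have "\<dots> \<longleftrightarrow> (\<exists>ds\<in>tuples M (map fst (w # ws)).
       sat M (\<lambda>x. if x \<in> set (w # ws) then val (w # ws) ds x else e x) \<psi>)"
    unfolding list.map Bex_def tuples_Cons by blast
  finally show ?case .
qed simp

lemma fv_Exists_list: "fv (foldr Exists ws \<psi>) = fv \<psi> - set ws"
  by (induction ws) auto

lemma wf_Exists_list: "wf_fm M A (foldr Exists ws \<psi>) \<longleftrightarrow> fst ` set ws \<subseteq> sorts M \<and> wf_fm M A \<psi>"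
  by (induction ws) auto

text \<open>Substitution written as "there is v equal to t such that ...", which avoids a
  capture-avoiding substitution of terms for variables. It needs variables that do not occur in the
  terms.\<close>

primrec subst_terms :: "('v \<times> ('v, 'f, 'a) tm) list \<Rightarrow> ('v, 'f, 'r, 'a) fm \<Rightarrow> ('v, 'f, 'r, 'a) fm" where
  "subst_terms [] \<phi> = \<phi>"
| "subst_terms (vt # ps) \<phi> = Exists (fst vt) (Conj (Eq (Var (fst vt)) (snd vt)) (subst_terms ps \<phi>))"

lemma sat_subst_terms:
  assumes "length vs = length ts" "distinct vs" "\<And>t. t \<in> set ts \<Longrightarrow> fv_tm t \<inter> set vs = {}"
    "map (tm_val M e) ts \<in> tuples M (map fst vs)"
  shows "sat M e (subst_terms (zip vs ts) \<phi>) \<longleftrightarrow>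
    sat M (\<lambda>w. if w \<in> set vs then val vs (map (tm_val M e) ts) w else e w) \<phi>"
  using assms
proof (induction vs ts arbitrary: e rule: list_induct2)
  case (Cons v vs t ts)
  let ?a = "tm_val M e t"
  let ?e = "e(v := ?a)"
  \<comment> \<open>The equations are evaluated one after another; binding \<open>v\<close> does not
    change the later terms, since no term contains a variable of the list.\<close>
  have same: "tm_val M ?e u = tm_val M e u" if "u \<in> set (t # ts)" for u
    by (rule tm_val_cong) (use Cons.prems(2)[OF that] in auto)
  have vals: "map (tm_val M ?e) ts = map (tm_val M e) ts" using same by simp
  have a: "?a \<in> univ M" "sort_of M ?a = fst v" "map (tm_val M e) ts \<in> tuples M (map fst vs)"
    using Cons.prems(3) by simp_all
  have "sat M e (subst_terms (zip (v # vs) (t # ts)) \<phi>) \<longleftrightarrow>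
    (\<exists>d\<in>univ M. sort_of M d = fst v \<and> d = tm_val M (e(v := d)) t \<and> sat M (e(v := d)) (subst_terms (zip vs ts) \<phi>))"
    by simp
  also have "\<dots> \<longleftrightarrow> sat M ?e (subst_terms (zip vs ts) \<phi>)"
  proof -
    have "tm_val M (e(v := d)) t = ?a" for d
      by (rule tm_val_cong) (use Cons.prems(2)[of t] in auto)
    then show ?thesis using a(1,2) by auto
  qed
  also have "\<dots> \<longleftrightarrow> sat M (\<lambda>w. if w \<in> set vs then val vs (map (tm_val M ?e) ts) w else ?e w) \<phi>"
  proof (rule Cons.IH)
    show "distinct vs" using Cons.prems(1) by simp
    show "fv_tm u \<inter> set vs = {}" if "u \<in> set ts" for u using Cons.prems(2)[of u] that by auto
    show "map (tm_val M ?e) ts \<in> tuples M (map fst vs)" unfolding vals by (rule a(3))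
  qed
  also have "(\<lambda>w. if w \<in> set vs then val vs (map (tm_val M ?e) ts) w else ?e w) =
    (\<lambda>w. if w \<in> set (v # vs) then val (v # vs) (map (tm_val M e) (t # ts)) w else e w)"
    using Cons.prems(1) unfolding vals by (auto simp: fun_eq_iff)
  finally show ?case .
qed simp

lemma fv_subst_terms:
  "length vs = length ts \<Longrightarrow> fv (subst_terms (zip vs ts) \<phi>) \<subseteq> (\<Union>t\<in>set ts. fv_tm t) \<union> (fv \<phi> - set vs)"
  by (induction vs ts rule: list_induct2) auto

lemma wf_subst_terms:
  assumes "length vs = length ts" "map (tm_sort M) ts = map fst vs" "fst ` set vs \<subseteq> sorts M"
    "\<forall>t\<in>set ts. wf_tm M A t" "wf_fm M A \<phi>"
  shows "wf_fm M A (subst_terms (zip vs ts) \<phi>)"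
  using assms by (induction vs ts rule: list_induct2) auto

lemma dfn_subst_terms:
  fixes M :: "('s, 'f, 'r, 'a) struct"
  assumes "dfn M A ss R" "map (tm_sort M) ts = ss" "set ss \<subseteq> sorts M" "\<forall>t\<in>set ts. wf_tm M A t"
  shows "\<exists>\<psi>\<in>formulas M A (\<Union>t\<in>set ts. fv_tm t). \<forall>e. map (tm_val M e) ts \<in> tuples M ss \<longrightarrow>
    (sat M e \<psi> \<longleftrightarrow> R (map (tm_val M e) ts))"
proof -
  have "finite (\<Union>t\<in>set ts. fv_tm t)" by (simp add: finite_fv_tm)
  then obtain vs where v: "distinct vs" "map fst vs = ss" "set vs \<inter> (\<Union>t\<in>set ts. fv_tm t) = {}"
    using ex_fresh_vars[of "\<Union>t\<in>set ts. fv_tm t" ss] by blast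
  obtain \<phi> where p: "\<phi> \<in> formulas M A (set vs)"
    "\<And>as. as \<in> tuples M ss \<Longrightarrow> R as \<longleftrightarrow> sat M (val vs as) \<phi>"
    by (rule dfnE[OF assms(1) v(1,2)]) (rule that)
  have l: "length vs = length ts" using v(2) assms(2) by (metis length_map)
  have f: "fv \<phi> \<subseteq> set vs" "wf_fm M A \<phi>" using p(1) by (simp_all add: formulas_def)
  let ?\<psi> = "subst_terms (zip vs ts) \<phi>"
  have "wf_fm M A ?\<psi>"
  proof (rule wf_subst_terms[OF l _ _ assms(4) f(2)])
    show "map (tm_sort M) ts = map fst vs" using assms(2) v(2) by simp
    show "fst ` set vs \<subseteq> sorts M" using assms(3) unfolding v(2)[symmetric] by simp
  qed
  moreover have "fv ?\<psi> \<subseteq> (\<Union>t\<in>set ts. fv_tm t)" using fv_subst_terms[OF l, of \<phi>] f(1) by blast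
  ultimately have "?\<psi> \<in> formulas M A (\<Union>t\<in>set ts. fv_tm t)" by (simp add: formulas_def)
  moreover have "sat M e ?\<psi> \<longleftrightarrow> R (map (tm_val M e) ts)" if t: "map (tm_val M e) ts \<in> tuples M ss" for e
  proof -
    have "sat M e ?\<psi> \<longleftrightarrow> sat M (\<lambda>w. if w \<in> set vs then val vs (map (tm_val M e) ts) w else e w) \<phi>"
      by (rule sat_subst_terms[OF l v(1)]) (use v(2,3) t in blast)+
    also have "\<dots> \<longleftrightarrow> sat M (val vs (map (tm_val M e) ts)) \<phi>"
      by (rule sat_cong) (use f(1) in auto)
    finally show ?thesis using p(2)[OF t] by simp
  qed
  ultimately show ?thesis by blast
qed

lemma zero_definable_equiv_dfn:
  assumes "zero_definable_equiv M ss E"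
  shows "dfn M {} (ss @ ss) (\<lambda>as. (take (length ss) as, drop (length ss) as) \<in> E)"
proof -
  obtain xs ys \<phi> where x: "distinct (xs @ ys)" "map fst xs = ss" "map fst ys = ss"
    "\<phi> \<in> formulas M {} (set (xs @ ys))"
    "E = {(map e xs, map e ys) | e. assignment M (set (xs @ ys)) e \<and> sat M e \<phi>}"
    using assms unfolding zero_definable_equiv_def by blast
  have l: "length xs = length ss" "length ys = length ss"
    using arg_cong[OF x(2), of length] arg_cong[OF x(3), of length] by simp_all
  have f: "fv \<phi> \<subseteq> set (xs @ ys)" using x(4) by (simp add: formulas_def)
  show ?thesis
  proof (rule dfnI[OF x(1) _ x(4)])
    show "map fst (xs @ ys) = ss @ ss" using x(2,3) by simp
    fix as assume "as \<in> tuples M (ss @ ss)"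
    then have as: "as \<in> tuples M (map fst (xs @ ys))" "length as = length ss + length ss"
      using x(2,3) tuples_length[of as M "ss @ ss"] by simp_all
    have m: "map (val (xs @ ys) as) (xs @ ys) = as" by (rule map_val[OF x(1)]) (simp add: l as(2))
    define f where "f = val (xs @ ys) as"
    have m': "map f xs @ map f ys = as" using m unfolding f_def by simp
    have "take (length ss) (map f xs @ map f ys) = map f xs" "drop (length ss) (map f xs @ map f ys) = map f ys"
      using l by simp_all
    then have td: "take (length ss) as = map f xs" "drop (length ss) as = map f ys"
      by (simp_all only: m')
    show "(take (length ss) as, drop (length ss) as) \<in> E \<longleftrightarrow> sat M (val (xs @ ys) as) \<phi>"
    proof
      assume "(take (length ss) as, drop (length ss) as) \<in> E"
      then obtain e where e: "take (length ss) as = map e xs" "drop (length ss) as = map e ys" "sat M e \<phi>"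
        unfolding x(5) by blast
      have "as = map e (xs @ ys)" using e(1,2) append_take_drop_id[of "length ss" as] by simp
      moreover have "sat M (val (xs @ ys) (map e (xs @ ys))) \<phi> \<longleftrightarrow> sat M e \<phi>"
        by (intro sat_cong val_map) (use f in blast)
      ultimately show "sat M (val (xs @ ys) as) \<phi>" using e(3) by simp
    next
      assume "sat M (val (xs @ ys) as) \<phi>"
      then show "(take (length ss) as, drop (length ss) as) \<in> E"
        unfolding x(5) td using val_assignment[OF x(1) as(1)] unfolding f_def by blast
    qed
  qed
qed

section \<open>Representing imaginaries by tuples, and translating formulas\<close>

primrec home_sorts :: "('s, 'a) eq_sort \<Rightarrow> 's list" where
  "home_sorts (Home s) = [s]"
| "home_sorts (Quot ss E) = ss"

lemma concat_home_sorts: "concat (map home_sorts (map Home ss)) = ss"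
  by (induction ss) simp_all

text \<open>A real element has one representative, a class has each of its members. The translation
  is proved correct for every choice of representatives.\<close>

primrec represents :: "('s, 'a) eq_elem \<Rightarrow> 'a list \<Rightarrow> bool" where
  "represents (Real a) as \<longleftrightarrow> as = [a]"
| "represents (Class ss E X) as \<longleftrightarrow> as \<in> X"

text \<open>Formulas over \<open>Meq M\<close> are translated to formulas over \<open>M\<close>: \<open>c\<close> assigns to every variable a
  tuple of variables that ranges over the representatives of its values, and \<open>\<rho>\<close> assigns
  representatives to the parameters.\<close>

primrec home_terms ::
  "(('s, 'a) eq_elem \<Rightarrow> 'a list) \<Rightarrow> (('s, 'a) eq_sort \<times> nat \<Rightarrow> ('s \<times> nat) list) \<Rightarrow>
     (('s, 'a) eq_sort \<times> nat, ('s, 'f, 'a) eq_fun, ('s, 'a) eq_elem) tm \<Rightarrow> ('s \<times> nat, 'f, 'a) tm list" where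
  "home_terms \<rho> c (Var v) = map Var (c v)"
| "home_terms \<rho> c (Par x) = map Par (\<rho> x)"
| "home_terms \<rho> c (App g ts) =
     (let us = concat (map (home_terms \<rho> c) ts) in
      case g of Base f \<Rightarrow> [App f us] | Proj ss E \<Rightarrow> us)"

locale imaginaries =
  fixes M :: "('s, 'f, 'r, 'a) struct"
  assumes is_structure: "is_structure M"
begin

abbreviation N where "N \<equiv> Meq M"

lemma sort_Real [simp]: "sort_of N (Real a) = Home (sort_of M a)"
  and sort_Class [simp]: "sort_of N (Class ss E X) = Quot ss E"
  and Real_univ [simp]: "Real a \<in> univ N \<longleftrightarrow> a \<in> univ M"
  and Class_univ [simp]: "Class ss E X \<in> univ N \<longleftrightarrow> zero_definable_equiv M ss E \<and> X \<in> tuples M ss // E"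
  and Home_sorts [simp]: "Home s \<in> sorts N \<longleftrightarrow> s \<in> sorts M"
  and Quot_sorts [simp]: "Quot ss E \<in> sorts N \<longleftrightarrow> zero_definable_equiv M ss E"
  by (auto simp: Meq_def)

lemma sort_of_sorts: "a \<in> univ M \<Longrightarrow> sort_of M a \<in> sorts M"
  using is_structure unfolding is_structure_def by blast

lemma sort_of_sorts_Meq: "x \<in> univ N \<Longrightarrow> sort_of N x \<in> sorts N"
  using sort_of_sorts by (cases x) simp_all

lemma home_sorts_sorts: "S \<in> sorts N \<Longrightarrow> set (home_sorts S) \<subseteq> sorts M"
  by (cases S) (simp_all add: zero_definable_equiv_def)

lemma zd_equiv: "zero_definable_equiv M ss E \<Longrightarrow> equiv (tuples M ss) E"
  by (simp add: zero_definable_equiv_def)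

lemma represents_tuples:
  assumes "x \<in> univ N" "represents x as"
  shows "as \<in> tuples M (home_sorts (sort_of N x))"
proof (cases x)
  case (Real a)
  then show ?thesis using assms by simp
next
  case (Class ss E X)
  then have "X \<subseteq> tuples M ss"
    using assms(1) zd_equiv in_quotient_imp_subset by fastforce
  then show ?thesis using assms(2) Class by auto
qed

lemma ex_represents:
  assumes "x \<in> univ N"
  shows "\<exists>as. represents x as"
proof (cases x)
  case (Class ss E X)
  then have "X \<noteq> {}" using assms zd_equiv in_quotient_imp_non_empty by fastforce
  then show ?thesis using Class by auto
qed simp

lemma ex_represented:
  assumes "S \<in> sorts N" "as \<in> tuples M (home_sorts S)"
  shows "\<exists>x\<in>univ N. sort_of N x = S \<and> represents x as"
proof (cases S)
  case (Home s)
  then obtain a where "as = [a]" "a \<in> univ M" "sort_of M a = s" using assms(2) by (auto simp: tuples_Cons)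
  then show ?thesis using Home by (intro bexI[of _ "Real a"]) simp_all
next
  case (Quot ss E)
  then have zd: "zero_definable_equiv M ss E" and as: "as \<in> tuples M ss" using assms by simp_all
  have "E `` {as} \<in> tuples M ss // E" using as by (rule quotientI)
  moreover have "as \<in> E `` {as}" using equiv_class_self[OF zd_equiv[OF zd] as] .
  ultimately show ?thesis using zd Quot by (intro bexI[of _ "Class ss E (E `` {as})"]) simp_all
qed

lemma represents_Home:
  assumes "x \<in> univ N" "sort_of N x = Home s" "represents x as"
  shows "\<exists>a. x = Real a \<and> as = [a] \<and> a \<in> univ M \<and> sort_of M a = s"
  using assms by (cases x) simp_all

lemma represents_eq_Quot:
  assumes "x \<in> univ N" "sort_of N x = Quot ss E" "represents x as"
    "y \<in> univ N" "sort_of N y = Quot ss E" "represents y bs"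
  shows "x = y \<longleftrightarrow> (as, bs) \<in> E"
proof -
  obtain X where X: "x = Class ss E X" using assms(2) by (cases x) simp_all
  obtain Y where Y: "y = Class ss E Y" using assms(5) by (cases y) simp_all
  have e: "equiv (tuples M ss) E" using assms(1) X zd_equiv by simp
  have q: "X \<in> tuples M ss // E" "Y \<in> tuples M ss // E" "as \<in> X" "bs \<in> Y" using assms X Y by simp_all
  show ?thesis using quotient_eq_iff[OF e q] X Y by simp
qed

context
  fixes \<rho> :: "('s, 'a) eq_elem \<Rightarrow> 'a list" and A :: "('s, 'a) eq_elem set"
  assumes A_univ: "A \<subseteq> univ N" and \<rho>: "\<And>x. x \<in> A \<Longrightarrow> represents x (\<rho> x)"
begin

definition A' :: "'a set" where "A' = (\<Union>x\<in>A. set (\<rho> x))"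

lemma fv_home_terms: "u \<in> set (home_terms \<rho> c t) \<Longrightarrow> fv_tm u \<subseteq> (\<Union>v\<in>fv_tm t. set (c v))"
proof (induction t arbitrary: u)
  case (App g ts)
  let ?us = "concat (map (home_terms \<rho> c) ts)"
  have "fv_tm w \<subseteq> (\<Union>v\<in>fv_tm (App g ts). set (c v))" if "w \<in> set ?us" for w
    using that App.IH by fastforce
  then show ?case using App.prems by (cases g) auto
qed auto

lemma wf_home_terms:
  assumes "wf_tm N A t" "\<And>v. v \<in> fv_tm t \<Longrightarrow> map fst (c v) = home_sorts (fst v)"
  shows "(\<forall>u\<in>set (home_terms \<rho> c t). wf_tm M A' u) \<and>
    map (tm_sort M) (home_terms \<rho> c t) = home_sorts (tm_sort N t)"
  using assms
proof (induction t)
  case (Var v)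
  have m: "map fst (c v) = home_sorts (fst v)" using Var.prems(2) by simp
  have "fst ` set (c v) \<subseteq> sorts M"
    using home_sorts_sorts[of "fst v"] Var.prems(1) unfolding m[symmetric] by simp
  then show ?case using m by (auto simp: comp_def)
next
  case (Par x)
  have x: "x \<in> A" using Par.prems(1) by simp
  then have "\<rho> x \<in> tuples M (home_sorts (sort_of N x))"
    using represents_tuples \<rho> A_univ by blast
  then show ?case using x by (auto simp: A'_def tuples_def comp_def)
next
  case (App g ts)
  have wf: "g \<in> fsyms N" "\<And>t. t \<in> set ts \<Longrightarrow> wf_tm N A t" "map (tm_sort N) ts = farg N g"
    using App.prems(1) by simp_all
  let ?us = "concat (map (home_terms \<rho> c) ts)"
  have IH: "(\<forall>u\<in>set (home_terms \<rho> c t). wf_tm M A' u) \<and>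
    map (tm_sort M) (home_terms \<rho> c t) = home_sorts (tm_sort N t)" if "t \<in> set ts" for t
    by (rule App.IH[OF that wf(2)[OF that]]) (use that App.prems(2) in auto)
  then have us: "\<forall>u\<in>set ?us. wf_tm M A' u" by auto
  have "map (tm_sort M) ?us = concat (map (\<lambda>t. map (tm_sort M) (home_terms \<rho> c t)) ts)"
    by (simp add: map_concat comp_def)
  also have "\<dots> = concat (map (\<lambda>t. home_sorts (tm_sort N t)) ts)"
    using IH by (intro arg_cong[where f = concat] map_cong) auto
  also have "\<dots> = concat (map home_sorts (map (tm_sort N) ts))" by (simp add: comp_def)
  finally have s: "map (tm_sort M) ?us = concat (map home_sorts (farg N g))" unfolding wf(3) .
  show ?case
  proof (cases g)
    case (Base f)
    then have "f \<in> fsyms M" "farg N g = map Home (farg M f)" "fres N g = Home (fres M f)"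
      using wf(1) by (auto simp: Meq_def)
    then show ?thesis using us s concat_home_sorts Base by (simp add: Let_def)
  next
    case (Proj ss E)
    then have "farg N g = map Home ss" "fres N g = Quot ss E" by (simp_all add: Meq_def)
    then show ?thesis using us s concat_home_sorts Proj by (simp add: Let_def)
  qed
qed

text \<open>Function symbols of \<open>Meq M\<close> take arguments of home sorts only, so a
  projection can occur only as the outermost symbol. There it needs no translation: the argument
  tuple represents its own class.\<close>

lemma val_home_terms:
  assumes "wf_tm N A t"
    "\<And>v. v \<in> fv_tm t \<Longrightarrow> e v \<in> univ N \<and> sort_of N (e v) = fst v \<and> represents (e v) (map e' (c v))"
  shows "tm_val N e t \<in> univ N \<and> sort_of N (tm_val N e t) = tm_sort N t \<and>
    represents (tm_val N e t) (map (tm_val M e') (home_terms \<rho> c t))"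
  using assms
proof (induction t)
  case (Var v)
  then show ?case by (simp add: comp_def)
next
  case (Par x)
  then show ?case using A_univ \<rho>[of x] by (auto simp: comp_def)
next
  case (App g ts)
  have wf: "g \<in> fsyms N" "\<And>t. t \<in> set ts \<Longrightarrow> wf_tm N A t" "map (tm_sort N) ts = farg N g"
    using App.prems(1) by simp_all
  let ?us = "concat (map (home_terms \<rho> c) ts)"
  have IH: "tm_val N e t \<in> univ N \<and> sort_of N (tm_val N e t) = tm_sort N t \<and>
    represents (tm_val N e t) (map (tm_val M e') (home_terms \<rho> c t))" if "t \<in> set ts" for t
    by (rule App.IH[OF that wf(2)[OF that]]) (use that App.prems(2) in auto)
  \<comment> \<open>An argument of home sort translates to a single term with the same value, so
    concatenating the translations gives the argument tuple in \<open>M\<close>.\<close>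
  have list: "map (tm_val M e') (concat (map (home_terms \<rho> c) ts)) = map the_Real (map (tm_val N e) ts) \<and>
      map the_Real (map (tm_val N e) ts) \<in> tuples M ss" 
    if "map (tm_sort N) ts = map Home ss" for ss
    using that IH
  proof (induction ts arbitrary: ss)
    case (Cons t ts)
    then obtain s' ss' where ss: "ss = s' # ss'" "tm_sort N t = Home s'" "map (tm_sort N) ts = map Home ss'"
      by (cases ss) simp_all
    have t: "tm_val N e t \<in> univ N" "sort_of N (tm_val N e t) = Home s'"
      "represents (tm_val N e t) (map (tm_val M e') (home_terms \<rho> c t))"
      using Cons.prems(2)[of t] ss(2) by simp_all
    from represents_Home[OF t] obtain a where
      a: "tm_val N e t = Real a" "map (tm_val M e') (home_terms \<rho> c t) = [a]" "a \<in> univ M" "sort_of M a = s'"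
      by (elim exE conjE)
    then show ?case using Cons.IH[OF ss(3)] Cons.prems(2) ss(1) by simp
  qed simp
  show ?case
  proof (cases g)
    case (Base f)
    then have g: "f \<in> fsyms M" "farg N g = map Home (farg M f)" "fres N g = Home (fres M f)"
      "\<And>xs. fint N g xs = Real (fint M f (map the_Real xs))"
      using wf(1) by (auto simp: Meq_def)
    note l = list[of "farg M f", unfolded wf(3), OF g(2)]
    let ?as = "map the_Real (map (tm_val N e) ts)"
    have "fint M f ?as \<in> univ M" "sort_of M (fint M f ?as) = fres M f"
      using is_structure g(1) conjunct2[OF l] unfolding is_structure_def by blast+
    moreover have "tm_val N e (App g ts) = Real (fint M f ?as)" using g(4) by simp
    moreover have "map (tm_val M e') (home_terms \<rho> c (App g ts)) = [fint M f ?as]"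
      using conjunct1[OF l] Base by (simp add: Let_def)
    ultimately show ?thesis using g(3) by (simp only: Real_univ sort_Real represents.simps tm_sort.simps)
  next
    case (Proj ss E)
    then have g: "zero_definable_equiv M ss E" "farg N g = map Home ss" "fres N g = Quot ss E"
      "\<And>xs. fint N g xs = Class ss E (E `` {map the_Real xs})"
      using wf(1) by (auto simp: Meq_def)
    note l = list[of ss, unfolded wf(3), OF g(2)]
    let ?as = "map the_Real (map (tm_val N e) ts)"
    have "E `` {?as} \<in> tuples M ss // E" using conjunct2[OF l] by (rule quotientI)
    moreover have "?as \<in> E `` {?as}" by (rule equiv_class_self[OF zd_equiv[OF g(1)] conjunct2[OF l]])
    moreover have "tm_val N e (App g ts) = Class ss E (E `` {?as})" using g(4) by simp
    moreover have "map (tm_val M e') (home_terms \<rho> c (App g ts)) = ?as"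
      using conjunct1[OF l] Proj by (simp add: Let_def)
    ultimately show ?thesis using g(1,3)
      by (simp only: Class_univ sort_Class represents.simps tm_sort.simps simp_thms)
  qed
qed

lemma home_args:
  assumes "\<And>t. t \<in> set ts \<Longrightarrow> wf_tm N A t" "map (tm_sort N) ts = map Home ss"
    "\<And>v. v \<in> (\<Union>t\<in>set ts. fv_tm t) \<Longrightarrow>
       e v \<in> univ N \<and> sort_of N (e v) = fst v \<and> represents (e v) (map e' (c v))"
  shows "map (tm_val M e') (concat (map (home_terms \<rho> c) ts)) = map the_Real (map (tm_val N e) ts)"
  using assms
proof (induction ts arbitrary: ss)
  case (Cons t ts)
  then obtain s' ss' where ss: "tm_sort N t = Home s'" "map (tm_sort N) ts = map Home ss'"
    by (cases ss) simp_all
  have t: "tm_val N e t \<in> univ N \<and> sort_of N (tm_val N e t) = tm_sort N t \<and>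
    represents (tm_val N e t) (map (tm_val M e') (home_terms \<rho> c t))"
    by (rule val_home_terms) (use Cons.prems(1,3) in auto)
  obtain a where a: "tm_val N e t = Real a" "map (tm_val M e') (home_terms \<rho> c t) = [a]"
    using represents_Home[of "tm_val N e t" s' "map (tm_val M e') (home_terms \<rho> c t)"] t ss(1) by auto
  then show ?case using Cons.IH[OF _ ss(2)] Cons.prems(1,3) by simp
qed simp

text \<open>Equality at a home sort stays equality; at a quotient sort it becomes the relation
  \<open>E\<close> between the tuples of terms, a formula supplied by
  \<open>dfn_subst_terms\<close>.\<close>

lemma translate_Eq:
  assumes "wf_fm N A (Eq t u)" "\<And>v. v \<in> fv (Eq t u) \<Longrightarrow> map fst (c v) = home_sorts (fst v)"
  shows "\<exists>\<psi>\<in>formulas M A' (\<Union>v\<in>fv (Eq t u). set (c v)). \<forall>e e'.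
    (\<forall>v\<in>fv (Eq t u). e v \<in> univ N \<and> sort_of N (e v) = fst v \<and> represents (e v) (map e' (c v))) \<longrightarrow>
    (sat N e (Eq t u) \<longleftrightarrow> sat M e' \<psi>)"
proof -
  have wf: "wf_tm N A t" "wf_tm N A u" "tm_sort N t = tm_sort N u" using assms(1) by simp_all
  have ht: "\<forall>w\<in>set (home_terms \<rho> c t). wf_tm M A' w" "map (tm_sort M) (home_terms \<rho> c t) = home_sorts (tm_sort N t)"
    using wf_home_terms[OF wf(1), of c] assms(2) by simp_all
  have hu: "\<forall>w\<in>set (home_terms \<rho> c u). wf_tm M A' w" "map (tm_sort M) (home_terms \<rho> c u) = home_sorts (tm_sort N t)"
    using wf_home_terms[OF wf(2), of c] assms(2) wf(3) by simp_all
  have fv: "(\<Union>w\<in>set (home_terms \<rho> c t @ home_terms \<rho> c u). fv_tm w) \<subseteq> (\<Union>v\<in>fv (Eq t u). set (c v))"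
    using fv_home_terms[of _ c t] fv_home_terms[of _ c u] by auto
  have vt: "tm_val N e t \<in> univ N" "sort_of N (tm_val N e t) = tm_sort N t"
      "represents (tm_val N e t) (map (tm_val M e') (home_terms \<rho> c t))"
      "tm_val N e u \<in> univ N" "sort_of N (tm_val N e u) = tm_sort N t"
      "represents (tm_val N e u) (map (tm_val M e') (home_terms \<rho> c u))"
    if "\<forall>v\<in>fv (Eq t u). e v \<in> univ N \<and> sort_of N (e v) = fst v \<and> represents (e v) (map e' (c v))" for e e'
    using val_home_terms[OF wf(1), of e e' c] val_home_terms[OF wf(2), of e e' c] that wf(3) by simp_all
  show ?thesis
  proof (cases "tm_sort N t")
    case (Home s)
    obtain t' u' where tu: "home_terms \<rho> c t = [t']" "home_terms \<rho> c u = [u']" "tm_sort M t' = s" "tm_sort M u' = s"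
      using ht(2) hu(2) unfolding Home by auto
    show ?thesis
    proof (intro bexI[of _ "Eq t' u'"] allI impI)
      show "Eq t' u' \<in> formulas M A' (\<Union>v\<in>fv (Eq t u). set (c v))"
        using tu ht(1) hu(1) fv by (simp add: formulas_def)
      fix e e'
      assume a: "\<forall>v\<in>fv (Eq t u). e v \<in> univ N \<and> sort_of N (e v) = fst v \<and> represents (e v) (map e' (c v))"
      note v = vt[OF a, unfolded Home]
      show "sat N e (Eq t u) \<longleftrightarrow> sat M e' (Eq t' u')"
        using represents_Home[OF v(1-3)] represents_Home[OF v(4-6)] tu(1,2) by auto
    qed
  next
    case (Quot ss E)
    let ?ts = "home_terms \<rho> c t @ home_terms \<rho> c u"
    have hs: "map (tm_sort M) (home_terms \<rho> c t) = ss" "map (tm_sort M) (home_terms \<rho> c u) = ss"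
      using ht(2) hu(2) unfolding Quot by simp_all
    have lt: "length (home_terms \<rho> c t) = length ss" using arg_cong[OF hs(1), of length] by simp
    show ?thesis
    proof (cases "zero_definable_equiv M ss E")
      case True
      have d: "dfn M A' (ss @ ss) (\<lambda>as. (take (length ss) as, drop (length ss) as) \<in> E)"
        by (rule dfn_mono[OF zero_definable_equiv_dfn[OF True]]) simp
      have so: "map (tm_sort M) ?ts = ss @ ss" using hs by simp
      have sub: "set (ss @ ss) \<subseteq> sorts M" using True by (simp add: zero_definable_equiv_def)
      have wts: "\<forall>w\<in>set ?ts. wf_tm M A' w" using ht(1) hu(1) by auto
      obtain \<psi> where p: "\<psi> \<in> formulas M A' (\<Union>w\<in>set ?ts. fv_tm w)"
        "\<forall>e. map (tm_val M e) ?ts \<in> tuples M (ss @ ss) \<longrightarrow> (sat M e \<psi> \<longleftrightarrow>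
          (take (length ss) (map (tm_val M e) ?ts), drop (length ss) (map (tm_val M e) ?ts)) \<in> E)"
        using dfn_subst_terms[OF d so sub wts] by (rule bexE) (rule that)
      show ?thesis
      proof (intro bexI[of _ \<psi>] allI impI)
        show "\<psi> \<in> formulas M A' (\<Union>v\<in>fv (Eq t u). set (c v))"
          using p(1) formulas_mono[OF subset_refl fv] by blast
        fix e e'
        assume a: "\<forall>v\<in>fv (Eq t u). e v \<in> univ N \<and> sort_of N (e v) = fst v \<and> represents (e v) (map e' (c v))"
        note v = vt[OF a, unfolded Quot]
        have "map (tm_val M e') (home_terms \<rho> c t) \<in> tuples M ss" "map (tm_val M e') (home_terms \<rho> c u) \<in> tuples M ss"
          using represents_tuples[OF v(1,3)] represents_tuples[OF v(4,6)] v(2,5) by simp_all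
        then have "map (tm_val M e') ?ts \<in> tuples M (ss @ ss)" by auto
        from p(2)[rule_format, OF this]
        have "sat M e' \<psi> \<longleftrightarrow> (map (tm_val M e') (home_terms \<rho> c t), map (tm_val M e') (home_terms \<rho> c u)) \<in> E"
          by (simp add: lt)
        then show "sat N e (Eq t u) \<longleftrightarrow> sat M e' \<psi>" using represents_eq_Quot[OF v] by simp
      qed
    next
      case False
      \<comment> \<open>Here the claim is vacuous: under such an assignment the term would have a
        value in \<open>univ N\<close>, and the sort of a value belongs to \<open>sorts N\<close>.
        Any formula serves.\<close>
      have no: "\<not> (\<forall>v\<in>fv (Eq t u). e v \<in> univ N \<and> sort_of N (e v) = fst v \<and> represents (e v) (map e' (c v)))" for e e'
      proof
        assume "\<forall>v\<in>fv (Eq t u). e v \<in> univ N \<and> sort_of N (e v) = fst v \<and> represents (e v) (map e' (c v))"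
        from sort_of_sorts_Meq[OF vt(1)[OF this]] vt(2)[OF this] show False using False Quot by simp
      qed
      have "\<exists>\<psi>. \<psi> \<in> formulas M A' {}"
      proof -
        obtain s where "s \<in> sorts M" using is_structure unfolding is_structure_def by blast
        then show ?thesis
          by (intro exI[of _ "Exists (s, 0) (Eq (Var (s, 0)) (Var (s, 0)))"]) (simp add: formulas_def)
      qed
      then obtain \<psi> where "\<psi> \<in> formulas M A' {}" ..
      then have "\<psi> \<in> formulas M A' (\<Union>v\<in>fv (Eq t u). set (c v))"
        using formulas_mono[OF subset_refl, of "{}"] by blast
      then show ?thesis
      proof (rule bexI[rotated], intro allI impI)
        fix e e'
        assume "\<forall>v\<in>fv (Eq t u). e v \<in> univ N \<and> sort_of N (e v) = fst v \<and> represents (e v) (map e' (c v))"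
        with no show "sat N e (Eq t u) \<longleftrightarrow> sat M e' \<psi>" by (rule notE)
      qed
    qed
  qed
qed

text \<open>A quantifier over an imaginary becomes a block of quantifiers over a representing tuple.
  This is faithful because every tuple of the right sorts represents an element and every element
  has a representative.\<close>

lemma translate:
  assumes "wf_fm N A \<phi>" "\<And>v. v \<in> fv \<phi> \<Longrightarrow> map fst (c v) = home_sorts (fst v)"
  shows "\<exists>\<psi>\<in>formulas M A' (\<Union>v\<in>fv \<phi>. set (c v)). \<forall>e e'.
    (\<forall>v\<in>fv \<phi>. e v \<in> univ N \<and> sort_of N (e v) = fst v \<and> represents (e v) (map e' (c v))) \<longrightarrow>
    (sat N e \<phi> \<longleftrightarrow> sat M e' \<psi>)"
  using assms
proof (induction \<phi> arbitrary: c)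
  case (Eq t u)
  then show ?case by (rule translate_Eq)
next
  case (Rel r ts)
  have wf: "r \<in> rsyms N" "\<And>t. t \<in> set ts \<Longrightarrow> wf_tm N A t" "map (tm_sort N) ts = rarg N r"
    using Rel.prems(1) by simp_all
  have r: "r \<in> rsyms M" "rarg N r = map Home (rarg M r)" "\<And>xs. rint N r xs = rint M r (map the_Real xs)"
    using wf(1) by (simp_all add: Meq_def)
  let ?us = "concat (map (home_terms \<rho> c) ts)"
  have h: "(\<forall>u\<in>set (home_terms \<rho> c t). wf_tm M A' u) \<and>
    map (tm_sort M) (home_terms \<rho> c t) = home_sorts (tm_sort N t)" if "t \<in> set ts" for t
    by (rule wf_home_terms[OF wf(2)[OF that]]) (use that Rel.prems(2) in auto)
  have "map (tm_sort M) ?us = concat (map (\<lambda>t. map (tm_sort M) (home_terms \<rho> c t)) ts)"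
    by (simp add: map_concat comp_def)
  also have "\<dots> = concat (map (\<lambda>t. home_sorts (tm_sort N t)) ts)"
    using h by (intro arg_cong[where f = concat] map_cong) auto
  also have "\<dots> = concat (map home_sorts (map (tm_sort N) ts))" by (simp add: comp_def)
  also have "\<dots> = concat (map home_sorts (map Home (rarg M r) :: ('s, 'a) eq_sort list))"
    by (simp only: wf(3) r(2))
  also have "\<dots> = rarg M r" by (rule concat_home_sorts)
  finally have s: "map (tm_sort M) ?us = rarg M r" .
  show ?case
  proof (intro bexI[of _ "Rel r ?us"] allI impI)
    have "\<forall>u\<in>set ?us. wf_tm M A' u" using h by auto
    moreover have "(\<Union>u\<in>set ?us. fv_tm u) \<subseteq> (\<Union>v\<in>fv (Rel r ts). set (c v))"
      using fv_home_terms[of _ c] by fastforce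
    ultimately show "Rel r ?us \<in> formulas M A' (\<Union>v\<in>fv (Rel r ts). set (c v))"
      using s r(1) by (simp add: formulas_def)
    fix e e'
    assume a: "\<forall>v\<in>fv (Rel r ts). e v \<in> univ N \<and> sort_of N (e v) = fst v \<and> represents (e v) (map e' (c v))"
    have "map (tm_val M e') ?us = map the_Real (map (tm_val N e) ts)"
      by (rule home_args[OF wf(2)]) (use wf(3) r(2) a in auto)
    then show "sat N e (Rel r ts) \<longleftrightarrow> sat M e' (Rel r ?us)" using r(3) by (simp only: sat.simps)
  qed
next
  case (Neg \<phi>)
  have w: "wf_fm N A \<phi>" "\<And>v. v \<in> fv \<phi> \<Longrightarrow> map fst (c v) = home_sorts (fst v)"
    using Neg.prems by simp_all
  obtain \<psi> where p: "\<psi> \<in> formulas M A' (\<Union>v\<in>fv \<phi>. set (c v))"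
    "\<forall>e e'. (\<forall>v\<in>fv \<phi>. e v \<in> univ N \<and> sort_of N (e v) = fst v \<and> represents (e v) (map e' (c v))) \<longrightarrow>
      (sat N e \<phi> \<longleftrightarrow> sat M e' \<psi>)" using Neg.IH[OF w] by blast
  show ?case
    by (rule bexI[of _ "Neg \<psi>"]) (use p in \<open>simp_all add: formulas_def\<close>)
next
  case (Conj \<phi>1 \<phi>2)
  have w1: "wf_fm N A \<phi>1" "\<And>v. v \<in> fv \<phi>1 \<Longrightarrow> map fst (c v) = home_sorts (fst v)"
    and w2: "wf_fm N A \<phi>2" "\<And>v. v \<in> fv \<phi>2 \<Longrightarrow> map fst (c v) = home_sorts (fst v)"
    using Conj.prems by simp_all
  obtain \<psi>1 where p1: "\<psi>1 \<in> formulas M A' (\<Union>v\<in>fv \<phi>1. set (c v))"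
    "\<forall>e e'. (\<forall>v\<in>fv \<phi>1. e v \<in> univ N \<and> sort_of N (e v) = fst v \<and> represents (e v) (map e' (c v))) \<longrightarrow>
      (sat N e \<phi>1 \<longleftrightarrow> sat M e' \<psi>1)" using Conj.IH(1)[OF w1] by blast
  obtain \<psi>2 where p2: "\<psi>2 \<in> formulas M A' (\<Union>v\<in>fv \<phi>2. set (c v))"
    "\<forall>e e'. (\<forall>v\<in>fv \<phi>2. e v \<in> univ N \<and> sort_of N (e v) = fst v \<and> represents (e v) (map e' (c v))) \<longrightarrow>
      (sat N e \<phi>2 \<longleftrightarrow> sat M e' \<psi>2)" using Conj.IH(2)[OF w2] by blast
  show ?case
  proof (intro bexI[of _ "Conj \<psi>1 \<psi>2"] allI impI)
    show "Conj \<psi>1 \<psi>2 \<in> formulas M A' (\<Union>v\<in>fv (Conj \<phi>1 \<phi>2). set (c v))"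
      using p1(1) p2(1) by (simp add: formulas_def UN_Un le_supI1 le_supI2)
    fix e e'
    assume a: "\<forall>v\<in>fv (Conj \<phi>1 \<phi>2). e v \<in> univ N \<and> sort_of N (e v) = fst v \<and> represents (e v) (map e' (c v))"
    have "sat N e \<phi>1 \<longleftrightarrow> sat M e' \<psi>1"
      by (rule p1(2)[THEN spec, THEN spec, THEN mp]) (use a in simp)
    moreover have "sat N e \<phi>2 \<longleftrightarrow> sat M e' \<psi>2"
      by (rule p2(2)[THEN spec, THEN spec, THEN mp]) (use a in simp)
    ultimately show "sat N e (Conj \<phi>1 \<phi>2) \<longleftrightarrow> sat M e' (Conj \<psi>1 \<psi>2)" by simp
  qed
next
  case (Exists v \<phi>)
  have S: "fst v \<in> sorts N" and wf: "wf_fm N A \<phi>" using Exists.prems(1) by simp_all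
  \<comment> \<open>The new block must avoid the tuples of the variables that stay free. The old
    tuple of \<open>v\<close> need not be avoided, because \<open>v\<close> gets a new one.\<close>
  let ?Z = "\<Union>w\<in>fv \<phi> - {v}. set (c w)"
  have "finite ?Z" using finite_fv[of \<phi>] by simp
  then obtain ws where w: "distinct ws" "map fst ws = home_sorts (fst v)" "set ws \<inter> ?Z = {}"
    using ex_fresh_vars[of ?Z "home_sorts (fst v)"] by blast
  let ?c = "c(v := ws)"
  have "map fst (?c x) = home_sorts (fst x)" if "x \<in> fv \<phi>" for x
    using that w(2) Exists.prems(2)[of x] by simp
  then obtain \<psi> where p: "\<psi> \<in> formulas M A' (\<Union>x\<in>fv \<phi>. set (?c x))"
    "\<And>e e'. (\<forall>x\<in>fv \<phi>. e x \<in> univ N \<and> sort_of N (e x) = fst x \<and> represents (e x) (map e' (?c x))) \<Longrightarrow>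
      (sat N e \<phi> \<longleftrightarrow> sat M e' \<psi>)" using Exists.IH[OF wf, of ?c] by blast
  have wS: "fst ` set ws \<subseteq> sorts M"
    using home_sorts_sorts[OF S] unfolding w(2)[symmetric] by simp
  show ?case
  proof (intro bexI[of _ "foldr Exists ws \<psi>"] allI impI)
    have "fv \<psi> \<subseteq> set ws \<union> ?Z"
    proof -
      have "set (?c x) \<subseteq> set ws \<union> ?Z" if "x \<in> fv \<phi>" for x
        using that by (cases "x = v") auto
      then have "(\<Union>x\<in>fv \<phi>. set (?c x)) \<subseteq> set ws \<union> ?Z" by (rule UN_least)
      then show ?thesis using p(1) unfolding formulas_def by blast
    qed
    moreover have "wf_fm M A' \<psi>" using p(1) unfolding formulas_def by blast
    ultimately show "foldr Exists ws \<psi> \<in> formulas M A' (\<Union>w\<in>fv (Exists v \<phi>). set (c w))"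
      using wS by (auto simp: formulas_def fv_Exists_list wf_Exists_list)
    fix e e'
    assume a: "\<forall>x\<in>fv (Exists v \<phi>). e x \<in> univ N \<and> sort_of N (e x) = fst x \<and> represents (e x) (map e' (c x))"
    let ?o = "\<lambda>ds x. if x \<in> set ws then val ws ds x else e' x"
    have key: "sat N (e(v := d)) \<phi> \<longleftrightarrow> sat M (?o ds) \<psi>"
      if d: "d \<in> univ N" "sort_of N d = fst v" "represents d ds" for d ds
    proof (rule p(2), rule ballI)
      have "length ws = length ds"
        using tuples_length[OF represents_tuples[OF d(1,3)]] arg_cong[OF w(2), of length] d(2) by simp
      then have mw: "map (?o ds) ws = ds" using map_val[OF w(1), of ds] by (simp cong: map_cong)
      fix x assume x: "x \<in> fv \<phi>"
      show "(e(v := d)) x \<in> univ N \<and> sort_of N ((e(v := d)) x) = fst x \<and>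
        represents ((e(v := d)) x) (map (?o ds) (?c x))"
      proof (cases "x = v")
        case True
        then show ?thesis using d mw by simp
      next
        case False
        then have xv: "x \<in> fv (Exists v \<phi>)" using x by simp
        have "set (c x) \<inter> set ws = {}" using w(3) x False by blast
        then have "map (?o ds) (c x) = map e' (c x)" by auto
        moreover have "?c x = c x" "(e(v := d)) x = e x" using False by simp_all
        ultimately show ?thesis using bspec[OF a xv] by (simp only:)
      qed
    qed
    have "sat N e (Exists v \<phi>) \<longleftrightarrow> (\<exists>d\<in>univ N. sort_of N d = fst v \<and> sat N (e(v := d)) \<phi>)" by simp
    also have "\<dots> \<longleftrightarrow> (\<exists>ds\<in>tuples M (home_sorts (fst v)). sat M (?o ds) \<psi>)"
    proof
      assume "\<exists>d\<in>univ N. sort_of N d = fst v \<and> sat N (e(v := d)) \<phi>"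
      then obtain d where d: "d \<in> univ N" "sort_of N d = fst v" "sat N (e(v := d)) \<phi>" by blast
      obtain ds where ds: "represents d ds" using ex_represents[OF d(1)] by blast
      have "ds \<in> tuples M (home_sorts (fst v))" using represents_tuples[OF d(1) ds] d(2) by simp
      then show "\<exists>ds\<in>tuples M (home_sorts (fst v)). sat M (?o ds) \<psi>" using key[OF d(1,2) ds] d(3) by blast
    next
      assume "\<exists>ds\<in>tuples M (home_sorts (fst v)). sat M (?o ds) \<psi>"
      then obtain ds where ds: "ds \<in> tuples M (home_sorts (fst v))" "sat M (?o ds) \<psi>" by blast
      obtain d where d: "d \<in> univ N" "sort_of N d = fst v" "represents d ds"
        using ex_represented[OF S ds(1)] by blast
      then show "\<exists>d\<in>univ N. sort_of N d = fst v \<and> sat N (e(v := d)) \<phi>" using key[OF d] ds(2) by blast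
    qed
    also have "\<dots> \<longleftrightarrow> sat M e' (foldr Exists ws \<psi>)"
      unfolding sat_Exists_list[OF w(1)] w(2) ..
    finally show "sat N e (Exists v \<phi>) \<longleftrightarrow> sat M e' (foldr Exists ws \<psi>)" .
  qed
qed

end

text \<open>A type in one imaginary variable becomes a finitely satisfiable family of relations on
  representing tuples, which \<open>realize_family\<close> realizes in \<open>M\<close>. Its
  parameters are the entries of one representative for each element of \<open>A\<close>; as
  representatives are finite lists, they form a small set.\<close>

lemma saturated_Meq:
  assumes "saturated_structure M \<kappa>"
  shows "saturated \<kappa> N"
  unfolding saturated_def
proof (intro allI impI, elim conjE)
  interpret saturated_structure M \<kappa> by (rule assms)
  fix A :: "('s, 'a) eq_elem set" and S p
  assume A: "A \<subseteq> univ N" "|A| <o \<kappa>" and S: "S \<in> sorts N" and p: "complete_type N A {(S, 0)} p"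
  define \<rho> :: "('s, 'a) eq_elem \<Rightarrow> 'a list" where "\<rho> = (\<lambda>x. SOME as. represents x as)"
  have \<rho>: "represents x (\<rho> x)" if "x \<in> A" for x
    unfolding \<rho>_def by (rule someI_ex[OF ex_represents]) (use that A(1) in blast)
  let ?B = "\<Union>x\<in>A. set (\<rho> x)"
  have B: "A' \<rho> A = ?B" by (rule A'_def[OF A(1) \<rho>])
  have uB: "?B \<subseteq> univ M"
  proof
    fix a assume "a \<in> ?B"
    then obtain x where "x \<in> A" "a \<in> set (\<rho> x)" by blast
    then show "a \<in> univ M" using tuples_set[OF represents_tuples[OF _ \<rho>]] A(1) by blast
  qed
  have sB: "sm ?B"
  proof (cases "finite A")
    case True
    then show ?thesis using uB by (intro sm_finite) simp_all
  next
    case False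
    have "|set (\<rho> x)| \<le>o |A|" for x
      by (rule ordLess_imp_ordLeq[OF finite_ordLess_infinite])
        (use False in \<open>simp_all add: Field_card_of card_of_well_order_on\<close>)
    then have "|?B| \<le>o |A|" by (intro card_of_UNION_ordLeq_infinite[OF False]) (simp_all add: card_of_mono1)
    then show ?thesis using A(2) uB ordLeq_ordLess_trans unfolding small_def by blast
  qed
  obtain ws :: "('s \<times> nat) list" where w: "distinct ws" "map fst ws = home_sorts S"
    using ex_vars by blast
  have pf: "wf_fm N A \<phi>" "fv \<phi> \<subseteq> {(S, 0)}" if "\<phi> \<in> p" for \<phi>
    using p that unfolding complete_type_def formulas_def by blast+
  have "\<exists>\<psi>. \<psi> \<in> formulas M ?B (set ws) \<and> (\<forall>d ds. d \<in> univ N \<and> sort_of N d = S \<and> represents d ds \<longrightarrow>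
    (sat N (\<lambda>_. d) \<phi> \<longleftrightarrow> sat M (val ws ds) \<psi>))" if f: "\<phi> \<in> p" for \<phi>
  proof -
    have "map fst ws = home_sorts (fst v)" if "v \<in> fv \<phi>" for v using pf(2)[OF f] that w(2) by auto
    then obtain \<psi> where q: "\<psi> \<in> formulas M ?B (\<Union>v\<in>fv \<phi>. set ws)"
      "\<And>e e'. (\<forall>v\<in>fv \<phi>. e v \<in> univ N \<and> sort_of N (e v) = fst v \<and> represents (e v) (map e' ws)) \<Longrightarrow>
        (sat N e \<phi> \<longleftrightarrow> sat M e' \<psi>)"
      using translate[OF A(1) \<rho> pf(1)[OF f], of "\<lambda>_. ws"] unfolding B by blast
    have "\<psi> \<in> formulas M ?B (set ws)" using q(1) formulas_mono[of ?B ?B "\<Union>v\<in>fv \<phi>. set ws" "set ws"] by blast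
    moreover have "sat N (\<lambda>_. d) \<phi> \<longleftrightarrow> sat M (val ws ds) \<psi>"
      if d: "d \<in> univ N" "sort_of N d = S" "represents d ds" for d ds
    proof (rule q(2), rule ballI)
      fix v assume "v \<in> fv \<phi>"
      then have "fst v = S" using pf(2)[OF f] by auto
      moreover have "length ws = length ds"
        using tuples_length[OF represents_tuples[OF d(1,3)]] arg_cong[OF w(2), of length] d(2) by simp
      ultimately show "d \<in> univ N \<and> sort_of N d = fst v \<and> represents d (map (val ws ds) ws)"
        using d map_val[OF w(1), of ds] by simp
    qed
    ultimately show ?thesis by blast
  qed
  then obtain g where g: "\<And>\<phi>. \<phi> \<in> p \<Longrightarrow> g \<phi> \<in> formulas M ?B (set ws)"
    "\<And>\<phi> d ds. \<phi> \<in> p \<Longrightarrow> d \<in> univ N \<Longrightarrow> sort_of N d = S \<Longrightarrow> represents d ds \<Longrightarrow>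
      (sat N (\<lambda>_. d) \<phi> \<longleftrightarrow> sat M (val ws ds) (g \<phi>))" by metis
  define h where "h = (\<lambda>\<phi> as. sat M (val ws as) (g \<phi>))"
  have "\<exists>as\<in>tuples M (home_sorts S). \<forall>R\<in>h ` p. R as"
  proof (rule realize_family[OF sB home_sorts_sorts[OF S]])
    fix R assume "R \<in> h ` p"
    then obtain \<phi> where f: "\<phi> \<in> p" "R = h \<phi>" by blast
    show "dfn M ?B (home_sorts S) R" unfolding f(2) h_def by (rule dfnI[OF w g(1)[OF f(1)]]) simp
  next
    fix F assume F: "finite F" "F \<subseteq> h ` p"
    obtain \<Delta> where \<Delta>: "\<Delta> \<subseteq> p" "finite \<Delta>" "F = h ` \<Delta>" using finite_subset_image[OF F] by blast
    obtain e where e: "assignment N {(S, 0)} e" "\<forall>\<phi>\<in>\<Delta>. sat N e \<phi>"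
      using p \<Delta> unfolding complete_type_def by blast
    let ?d = "e (S, 0)"
    have d: "?d \<in> univ N" "sort_of N ?d = S" using e(1) by (simp_all add: assignment_def)
    obtain ds where ds: "represents ?d ds" using ex_represents[OF d(1)] by blast
    have t: "ds \<in> tuples M (home_sorts S)" using represents_tuples[OF d(1) ds] d(2) by simp
    have "h \<phi> ds" if "\<phi> \<in> \<Delta>" for \<phi>
    proof -
      have "\<phi> \<in> p" using that \<Delta>(1) by blast
      moreover from this have "\<phi> \<in> formulas N A {(S, 0)}" using pf by (simp add: formulas_def)
      then have "sat N (\<lambda>_. ?d) \<phi>" using sat_single[of \<phi> N A "(S, 0)" e ?d] e(2) that by blast
      ultimately show ?thesis using g(2)[OF _ d ds] unfolding h_def by blast
    qed
    then show "\<exists>as\<in>tuples M (home_sorts S). \<forall>R\<in>F. R as" using t unfolding \<Delta>(3) by blast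
  qed
  then obtain as where as: "as \<in> tuples M (home_sorts S)" "\<forall>R\<in>h ` p. R as" by (rule bexE)
  obtain d where d: "d \<in> univ N" "sort_of N d = S" "represents d as" using ex_represented[OF S as(1)] by blast
  have "sat N (\<lambda>_. d) \<phi>" if "\<phi> \<in> p" for \<phi>
  proof -
    have "h \<phi> as" using as(2) that by blast
    then show ?thesis using g(2)[OF that d] unfolding h_def by blast
  qed
  then have "realizes N S p d" using d(1,2) by (simp add: realizes_def)
  then show "\<exists>a. realizes N S p a" by blast
qed

end

section \<open>From the monster model to the theorem\<close>

lemma monster_model_saturated_structure:
  assumes "monster_model T \<kappa> M"
  shows "saturated_structure M \<kappa>"
proof
  have m: "is_structure M" "Card_order \<kappa>" "|formulas M {} UNIV| <o \<kappa>" "saturated \<kappa> M"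
    using assms by (simp_all add: monster_model_def)
  show "saturated \<kappa> M" "Card_order \<kappa>" by (fact m)+
  show "sort_of M a \<in> sorts M" if "a \<in> univ M" for a
    using m(1) that unfolding is_structure_def by blast
  show "sorts M \<noteq> {}" using m(1) unfolding is_structure_def by blast
  then obtain s where s: "s \<in> sorts M" by blast
  \<comment> \<open>Infinitely many variables give infinitely many formulas, so the bound on the
    number of formulas makes \<open>\<kappa>\<close> uncountable.\<close>
  let ?f = "\<lambda>n. Eq (Var (s, n)) (Var (s, n)) :: ('a, 'b, 'c, 'd) formula"
  have "|UNIV :: nat set| \<le>o |formulas M {} UNIV|"
  proof (rule card_of_ordLeqI[of ?f])
    show "inj_on ?f UNIV" by (rule inj_onI) simp
    show "?f n \<in> formulas M {} UNIV" for n using s by (simp add: formulas_def)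
  qed
  then show "|UNIV :: nat set| <o \<kappa>" using m(3) by (rule ordLeq_ordLess_trans)
qed

lemma monster_model_Meq:
  assumes "monster_model T \<kappa> M"
  shows "saturated_structure (Meq M) \<kappa>"
proof -
  interpret imaginaries M by unfold_locales (use assms in \<open>simp add: monster_model_def\<close>)
  have M: "saturated_structure M \<kappa>" using assms by (rule monster_model_saturated_structure)
  interpret saturated_structure M \<kappa> by (rule M)
  show ?thesis
  proof
    show "saturated \<kappa> N" using M by (rule saturated_Meq)
    show "Card_order \<kappa>" "|UNIV :: nat set| <o \<kappa>" by (rule card, rule uncountable)
    show "sort_of N x \<in> sorts N" if "x \<in> univ N" for x using that by (rule sort_of_sorts_Meq)
    show "sorts N \<noteq> {}" using sorts_nonempty by (simp add: Meq_def)
  qed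
qed

theorem theorem1:
  fixes M :: "('s, 'f, 'r, 'a) struct"
    and T :: "('s, 'f, 'r, 'a) formula set"
    and \<kappa> :: "'k rel"
  assumes "complete_theory M T" and "monster_model T \<kappa> M"
  shows "(\<forall>s p s' q.
            regular \<kappa> (Meq M) s p \<and> regular \<kappa> (Meq M) s' q \<and>
            \<not> orthogonal (Meq M) s p s' q \<and> generically_stable \<kappa> (Meq M) s p \<longrightarrow>
            generically_stable \<kappa> (Meq M) s' q)
       \<and> (let GR = {(s, p). regular \<kappa> (Meq M) s p \<and> generically_stable \<kappa> (Meq M) s p} in
            equiv GR {((s, p), (s', q)). (s, p) \<in> GR \<and> (s', q) \<in> GR \<and>
                                         \<not> orthogonal (Meq M) s p s' q})"
proof -
  interpret saturated_structure "Meq M" \<kappa> using assms(2) by (rule monster_model_Meq)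
  let ?GR = "{(s, p). regular \<kappa> (Meq M) s p \<and> generically_stable \<kappa> (Meq M) s p}"
  let ?R = "{((s, p), (s', q)). (s, p) \<in> ?GR \<and> (s', q) \<in> ?GR \<and> \<not> orthogonal (Meq M) s p s' q}"
  have "equiv ?GR ?R"
  proof (rule equivI)
    show "?R \<subseteq> ?GR \<times> ?GR" by blast
    show "refl_on ?GR ?R" by (auto simp: refl_on_def not_orthogonal_refl)
    show "sym ?R" by (auto simp: sym_def dest: not_orthogonal_sym)
    show "trans ?R"
    proof (rule transI)
      fix x y z assume xy: "(x, y) \<in> ?R" and yz: "(y, z) \<in> ?R"
      obtain s p s' q s'' t where "x = (s, p)" "y = (s', q)" "z = (s'', t)"
        by (cases x, cases y, cases z)
      then show "(x, z) \<in> ?R" using xy yz not_orthogonal_trans[of s p s' q s'' t] by simp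
    qed
  qed
  then show ?thesis unfolding Let_def using generically_stable_transfer by blast
qed

end
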